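(* Let $\Omega$ be a locally compact and separable metric space with Borel $\sigma$-algebra $\mathcal{B}(\Omega)$. Let $T=(T_\omega)$ be a random $\mathbb{Z}_+$-dynamical system on a compact metric space $(X,d)$ over an ergodic measure-preserving system $(\Omega,\mathcal{B}(\Omega),\mathbb{P},\theta)$. If $\mathbb{E}\overline{\mathrm{mdim}}_{pre}(T,X,d)<\infty$, then $$\mathbb{E}\overline{\mathrm{mdim}}_{pre}(T,X,d)=\max_{\mu\in\mathcal{M}_{\mathbb{P}}(\Omega\times X,G)}\mathbb{E}\overline{\mathrm{mdim}}_{pre,\mu}(T),$$ $$\mathbb{E}\overline{\mathrm{mdim}}_{pre,s}(T,X,d)=\max_{\mu\in\mathcal{M}_{\mathbb{P}}(\Omega\times X,G)}\mathbb{E}\overline{\mathrm{mdim}}_{s,\mu}(T),\qquad s\in\{p,m\},$$ where $G=\mathbb{Z}_+$ and $$\mathbb{E}\overline{\mathrm{mdim}}_{pre,\mu}(T)=\inf\Big\{\mathbb{E}\overline{\mathrm{mdim}}_{pre}(T,f,d)-\int f\,d\mu:f\in L^1_{\mathbb{P}}(\Omega,C(X))\Big\},$$ $$\mathbb{E}\overline{\mathrm{mdim}}_{s,\mu}(T)=\inf\Big\{\mathbb{E}\overline{\mathrm{mdim}}_{pre,s}(T,f,d)-\int f\,d\mu:f\in L^1_{\mathbb{P}}(\Omega,C(X))\Big\}.$$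
   Context: A random $\mathbb{Z}_+$-dynamical system over a measure-preserving system $(\Omega,\mathcal{F},\mathbb{P},\theta)$ is given by continuous maps $T_\omega:X\to X$ ($\omega\in\Omega$) of a compact metric space $(X,d)$, with $(\omega,x)\mapsto T_\omega x$ measurable; iterates are $T_\omega^n=T_{\theta^{n-1}\omega}\circ\cdots\circ T_\omega$ for $n\ge1$, $T_\omega^0=\mathrm{id}$. The skew product is $\Theta(\omega,x)=(\theta\omega,T_\omega x)$. For $x\in X$, $T_\omega^{-k}x=(T_\omega^k)^{-1}\{x\}$. $L^1_{\mathbb{P}}(\Omega,C(X))$ is the Banach space of functions $f:\Omega\times X\to\mathbb{R}$, measurable in $(\omega,x)$ and continuous in $x$, with $\|f\|=\int\sup_{x}|f(\omega,x)|\,d\mathbb{P}(\omega)<\infty$ (identifying $f,g$ with $\|f-g\|=0$). $\mathcal{M}_{\mathbb{P}}(\Omega\times X,G)$ is the set of $\Theta$-invariant probability measures on $\Omega\times X$ (with $\mathcal{F}\otimes\mathcal{B}(X)$) whose marginal on $\Omega$ is $\mathbb{P}$. Let $d_n^\omega(x,y)=\max_{0\le j\le n-1}d(T_\omega^jx,T_\omega^jy)$ and $S_nf(\omega,x)=\sum_{j=0}^{n-1}f(\theta^j\omega,T_\omega^jx)$. A set $F\subset E\subset X$ is an $(\omega,n,\epsilon)$-separated set of $E$ if $d_n^\omega(x,y)>\epsilon$ for all distinct $x,y\in F$. For $f\in L^1_{\mathbb{P}}(\Omega,C(X))$ define $$P_{pre,n}(T,f,\omega,\epsilon,k)=\sup_{x\in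 X}\sup\Big\{\sum_{y\in F}e^{S_nf(\omega,y)}:F\text{ is an }(\omega,n,\epsilon)\text{-separated set of }T_\omega^{-k}x\Big\},$$ $$P_{pre}(T,f,\epsilon)=\limsup_{n\to\infty}\frac1n\sup_{k\ge n}\int\log P_{pre,n}(T,f,\omega,\epsilon,k)\,d\mathbb{P}(\omega),$$ $$P_{pre,n}(T,f,\omega,x,\epsilon)=\sup\Big\{\sum_{y\in E}e^{S_nf(\omega,y)}:E\text{ is an }(\omega,n,\epsilon)\text{-separated set of }T_\omega^{-n}x\Big\},$$ $$P_{pre,m}(T,f,\epsilon)=\limsup_{n\to\infty}\frac1n\int\log\sup_{x\in X}P_{pre,n}(T,f,\omega,x,\epsilon)\,d\mathbb{P}(\omega),$$ $$P_{pre,p}(T,f,\epsilon)=\sup_{x\in X}\limsup_{n\to\infty}\frac1n\int\log P_{pre,n}(T,f,\omega,x,\epsilon)\,d\mathbb{P}(\omega)$$ (these integrands are measurable in $\omega$; empty sums are $0$ and $\log0=-\infty$). The upper preimage and pointwise preimage metric mean dimensions with potential $f$ are $$\mathbb{E}\overline{\mathrm{mdim}}_{pre}(T,f,d)=\limsup_{\epsilon\to0}\frac{P_{pre}(T,f\cdot\log\frac1\epsilon,\epsilon)}{\log\frac1\epsilon},\qquad \mathbb{E}\overline{\mathrm{mdim}}_{pre,s}(T,f,d)=\limsup_{\epsilon\to0}\frac{P_{pre,s}(T,f\cdot\log\frac1\epsilon,\epsilon)}{\log\frac1\epsilon},\ s\in\{m,p\},$$ and $\mathbb{E}\overline{\mathrm{mdim}}_{pre}(T,X,d)=\mathbb{E}\overline{\mathrm{mdim}}_{pre}(T,0,d)$,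 $\mathbb{E}\overline{\mathrm{mdim}}_{pre,s}(T,X,d)=\mathbb{E}\overline{\mathrm{mdim}}_{pre,s}(T,0,d)$. *)

theory Defs
  imports "HOL-Probability.Probability"
begin

text \<open>
  The metric \<open>d\<close> of the fibre space is \<^const>\<open>dist\<close> of the type \<open>'x\<close>; compactness of the
  type is not built into the definitions and is assumed where needed.
\<close>

locale measure_preserving_system = prob_space P
  for P :: "'w measure" +
  fixes \<theta> :: "'w \<Rightarrow> 'w"
  assumes base_measurable: "\<theta> \<in> P \<rightarrow>\<^sub>M P"
    and base_preserving: "distr P P \<theta> = P"

locale ergodic_system = measure_preserving_system P \<theta>
  for P :: "'w measure" and \<theta> +
  assumes ergodic:
    "\<And>A. A \<in> sets P \<Longrightarrow> \<theta> -` A \<inter> space P = A \<Longrightarrow> measure P A = 0 \<or> measure P A = 1"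

locale random_dynamical_system = measure_preserving_system P \<theta>
  for P :: "'w measure" and \<theta> +
  fixes T :: "'w \<Rightarrow> 'x::metric_space \<Rightarrow> 'x"
  assumes fibre_continuous: "\<And>\<omega>. \<omega> \<in> space P \<Longrightarrow> continuous_on UNIV (T \<omega>)"
    and fibre_measurable: "(\<lambda>(\<omega>, x). T \<omega> x) \<in> P \<Otimes>\<^sub>M borel \<rightarrow>\<^sub>M borel"

primrec rds_iter :: "('w \<Rightarrow> 'w) \<Rightarrow> ('w \<Rightarrow> 'x \<Rightarrow> 'x) \<Rightarrow> nat \<Rightarrow> 'w \<Rightarrow> 'x \<Rightarrow> 'x" where
  "rds_iter \<theta> T 0 \<omega> = id"
| "rds_iter \<theta> T (Suc n) \<omega> = T ((\<theta> ^^ n) \<omega>) \<circ> rds_iter \<theta> T n \<omega>"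

definition skew_product :: "('w \<Rightarrow> 'w) \<Rightarrow> ('w \<Rightarrow> 'x \<Rightarrow> 'x) \<Rightarrow> 'w \<times> 'x \<Rightarrow> 'w \<times> 'x" where
  "skew_product \<theta> T = (\<lambda>(\<omega>, x). (\<theta> \<omega>, T \<omega> x))"

text \<open>
  Representatives of the elements of \<open>L\<^sup>1\<^sub>P(\<Omega>, C(X))\<close>. No quotient is formed; the
  quantities below do not distinguish functions at distance \<open>0\<close>.
\<close>

definition L1_fibre_continuous :: "'w measure \<Rightarrow> ('w \<times> 'x::metric_space \<Rightarrow> real) set" where
  "L1_fibre_continuous P =
     {f \<in> borel_measurable (P \<Otimes>\<^sub>M borel).
        (\<forall>\<omega>\<in>space P. continuous_on UNIV (\<lambda>x. f (\<omega>, x))) \<and>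
        (\<integral>\<^sup>+\<omega>. (SUP x. ennreal \<bar>f (\<omega>, x)\<bar>) \<partial>P) < \<infinity>}"

definition invariant_measures ::
  "'w measure \<Rightarrow> ('w \<Rightarrow> 'w) \<Rightarrow> ('w \<Rightarrow> 'x::metric_space \<Rightarrow> 'x) \<Rightarrow> ('w \<times> 'x) measure set" where
  "invariant_measures P \<theta> T =
     {\<mu>. prob_space \<mu> \<and> sets \<mu> = sets (P \<Otimes>\<^sub>M (borel :: 'x measure)) \<and>
         distr \<mu> P fst = P \<and> distr \<mu> \<mu> (skew_product \<theta> T) = \<mu>}"

text \<open>For \<open>n = 0\<close> the maximum is unspecified; only limits \<open>n \<rightarrow> \<infinity>\<close> are used below.\<close>

definition bowen_dist ::
  "('w \<Rightarrow> 'w) \<Rightarrow> ('w \<Rightarrow> 'x::metric_space \<Rightarrow> 'x) \<Rightarrow> 'w \<Rightarrow> nat \<Rightarrow> 'x \<Rightarrow> 'x \<Rightarrow> real" where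
  "bowen_dist \<theta> T \<omega> n x y =
     Max ((\<lambda>j. dist (rds_iter \<theta> T j \<omega> x) (rds_iter \<theta> T j \<omega> y)) ` {..<n})"

definition birkhoff_sum ::
  "('w \<Rightarrow> 'w) \<Rightarrow> ('w \<Rightarrow> 'x \<Rightarrow> 'x) \<Rightarrow> ('w \<times> 'x \<Rightarrow> real) \<Rightarrow> nat \<Rightarrow> 'w \<Rightarrow> 'x \<Rightarrow> real" where
  "birkhoff_sum \<theta> T f n \<omega> x = (\<Sum>j<n. f ((\<theta> ^^ j) \<omega>, rds_iter \<theta> T j \<omega> x))"

definition separated_subsets ::
  "('w \<Rightarrow> 'w) \<Rightarrow> ('w \<Rightarrow> 'x::metric_space \<Rightarrow> 'x) \<Rightarrow> 'w \<Rightarrow> nat \<Rightarrow> real \<Rightarrow> 'x set \<Rightarrow> 'x set set" where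
  "separated_subsets \<theta> T \<omega> n \<epsilon> E =
     {F. F \<subseteq> E \<and> (\<forall>x\<in>F. \<forall>y\<in>F. x \<noteq> y \<longrightarrow> bowen_dist \<theta> T \<omega> n x y > \<epsilon>)}"

text \<open>
  \<open>fibre_sum \<theta> T f \<omega> n \<epsilon> k x\<close> is the supremum of \<open>\<Sum>y\<in>F. exp (S\<^sub>n f (\<omega>, y))\<close> over the
  \<open>(\<omega>, n, \<epsilon>)\<close>-separated sets \<open>F\<close> of the \<open>k\<close>-th preimage of \<open>x\<close>. On a compact fibre space
  separated sets are finite when \<open>n \<ge> 1\<close> and \<open>\<epsilon> > 0\<close>. In any case the convention that \<^const>\<open>sum\<close> is \<open>0\<close>
  on infinite sets does not change the supremum, since subsets of separated sets are separated.
\<close>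

definition fibre_sum ::
  "('w \<Rightarrow> 'w) \<Rightarrow> ('w \<Rightarrow> 'x::metric_space \<Rightarrow> 'x) \<Rightarrow> ('w \<times> 'x \<Rightarrow> real)
     \<Rightarrow> 'w \<Rightarrow> nat \<Rightarrow> real \<Rightarrow> nat \<Rightarrow> 'x \<Rightarrow> ennreal" where
  "fibre_sum \<theta> T f \<omega> n \<epsilon> k x =
     (SUP F \<in> separated_subsets \<theta> T \<omega> n \<epsilon> (rds_iter \<theta> T k \<omega> -` {x}).
        \<Sum>y\<in>F. ennreal (exp (birkhoff_sum \<theta> T f n \<omega> y)))"

definition elog :: "ennreal \<Rightarrow> ereal" where
  "elog a = (if a = 0 then -\<infinity> else if a = \<infinity> then \<infinity> else ereal (ln (enn2real a)))"

text \<open>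
  Integral of an extended real function as the difference of the integrals of its positive and
  negative parts. The integrands below have positive part with finite integral for potentials in
  \<^const>\<open>L1_fibre_continuous\<close> (when \<open>n \<ge> 1\<close>, \<open>\<epsilon> > 0\<close>), so \<open>\<infinity> - \<infinity>\<close> does not arise, while
  the value \<open>-\<infinity>\<close> is possible in the pointwise case.
\<close>

definition eintegral :: "'a measure \<Rightarrow> ('a \<Rightarrow> ereal) \<Rightarrow> ereal" where
  "eintegral M g =
     enn2ereal (\<integral>\<^sup>+z. e2ennreal (g z) \<partial>M) - enn2ereal (\<integral>\<^sup>+z. e2ennreal (- g z) \<partial>M)"

definition P_pre ::
  "'w measure \<Rightarrow> ('w \<Rightarrow> 'w) \<Rightarrow> ('w \<Rightarrow> 'x::metric_space \<Rightarrow> 'x) \<Rightarrow> ('w \<times> 'x \<Rightarrow> real)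
     \<Rightarrow> real \<Rightarrow> ereal" where
  "P_pre P \<theta> T f \<epsilon> =
     limsup (\<lambda>n. (SUP k\<in>{n..}. eintegral P (\<lambda>\<omega>. elog (SUP x. fibre_sum \<theta> T f \<omega> n \<epsilon> k x)))
                  / ereal (real n))"

definition P_pre_m ::
  "'w measure \<Rightarrow> ('w \<Rightarrow> 'w) \<Rightarrow> ('w \<Rightarrow> 'x::metric_space \<Rightarrow> 'x) \<Rightarrow> ('w \<times> 'x \<Rightarrow> real)
     \<Rightarrow> real \<Rightarrow> ereal" where
  "P_pre_m P \<theta> T f \<epsilon> =
     limsup (\<lambda>n. eintegral P (\<lambda>\<omega>. elog (SUP x. fibre_sum \<theta> T f \<omega> n \<epsilon> n x))
                  / ereal (real n))"

definition P_pre_p ::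
  "'w measure \<Rightarrow> ('w \<Rightarrow> 'w) \<Rightarrow> ('w \<Rightarrow> 'x::metric_space \<Rightarrow> 'x) \<Rightarrow> ('w \<times> 'x \<Rightarrow> real)
     \<Rightarrow> real \<Rightarrow> ereal" where
  "P_pre_p P \<theta> T f \<epsilon> =
     (SUP x. limsup (\<lambda>n. eintegral P (\<lambda>\<omega>. elog (fibre_sum \<theta> T f \<omega> n \<epsilon> n x))
                          / ereal (real n)))"

text \<open>The three mean dimensions differ only in the pressure they scale.\<close>

definition mdim_of ::
  "(('w \<times> 'x \<Rightarrow> real) \<Rightarrow> real \<Rightarrow> ereal) \<Rightarrow> ('w \<times> 'x \<Rightarrow> real) \<Rightarrow> ereal" where
  "mdim_of Q f =
     Limsup (at_right 0) (\<lambda>\<epsilon>. Q (\<lambda>z. f z * ln (1 / \<epsilon>)) \<epsilon> / ereal (ln (1 / \<epsilon>)))"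

definition mdim_pre ::
  "'w measure \<Rightarrow> ('w \<Rightarrow> 'w) \<Rightarrow> ('w \<Rightarrow> 'x::metric_space \<Rightarrow> 'x) \<Rightarrow> ('w \<times> 'x \<Rightarrow> real) \<Rightarrow> ereal" where
  "mdim_pre P \<theta> T = mdim_of (P_pre P \<theta> T)"

definition mdim_pre_m ::
  "'w measure \<Rightarrow> ('w \<Rightarrow> 'w) \<Rightarrow> ('w \<Rightarrow> 'x::metric_space \<Rightarrow> 'x) \<Rightarrow> ('w \<times> 'x \<Rightarrow> real) \<Rightarrow> ereal" where
  "mdim_pre_m P \<theta> T = mdim_of (P_pre_m P \<theta> T)"

definition mdim_pre_p ::
  "'w measure \<Rightarrow> ('w \<Rightarrow> 'w) \<Rightarrow> ('w \<Rightarrow> 'x::metric_space \<Rightarrow> 'x) \<Rightarrow> ('w \<times> 'x \<Rightarrow> real) \<Rightarrow> ereal" where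
  "mdim_pre_p P \<theta> T = mdim_of (P_pre_p P \<theta> T)"

text \<open>The mean dimension of a measure \<open>\<mu>\<close> induced by a potential-dependent mean dimension \<open>D\<close>.\<close>

definition measure_mdim ::
  "'w measure \<Rightarrow> (('w \<times> 'x::metric_space \<Rightarrow> real) \<Rightarrow> ereal) \<Rightarrow> ('w \<times> 'x) measure \<Rightarrow> ereal" where
  "measure_mdim P D \<mu> = (INF f \<in> L1_fibre_continuous P. D f - ereal (\<integral>z. f z \<partial>\<mu>))"

definition is_max_over :: "'b::order \<Rightarrow> 'a set \<Rightarrow> ('a \<Rightarrow> 'b) \<Rightarrow> bool" where
  "is_max_over m A V \<longleftrightarrow> (\<exists>a\<in>A. V a = m) \<and> (\<forall>a\<in>A. V a \<le> m)"

end

theory Submission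
  imports Defs
begin

text \<open>
  Each of the three mean dimensions \<open>D\<close> is a convex function of the potential, satisfies
  \<open>D f \<le> D g + \<integral> H dP\<close> whenever \<open>f \<le> g + H(\<omega>)\<close>, and does not increase under coboundaries:
  \<open>D (f \<circ> \<Theta> - f) \<le> D 0\<close>. If \<open>D 0\<close> is finite, the theorem of Hahn and Banach gives a linear
  functional \<open>l\<close> with \<open>l f \<le> D f - D 0\<close>. The listed properties make \<open>l\<close> positive,
  \<open>\<Theta>\<close>-invariant and equal to \<open>\<integral> h dP\<close> on potentials \<open>h(\<omega>)\<close>; with Dini's theorem on the compact
  fibres it is a Daniell integral, so \<open>l f = \<integral> f d\<mu>\<close> for an invariant measure \<open>\<mu>\<close> with marginal
  \<open>P\<close>. Then \<open>D f - \<integral> f d\<mu> \<ge> D 0\<close> for all \<open>f\<close>, and \<open>f = 0\<close> bounds the infimum from above for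
  every measure. The pointwise mean dimension may be \<open>-\<infinity>\<close>; then every invariant measure attains it.
\<close>

section \<open>Linear functionals below a sublinear functional\<close>

text \<open>\<open>D f - D 0\<close> is convex but not positively homogeneous, so Hahn-Banach is
  applied to its one-sided derivative at 0, which lies below it. Two obstacles shape the rest.
  Potentials are only measurable in \<omega>, so representation theorems for continuous functions on
  a compact space do not apply to the product. Countable additivity has to come from comparison with
  functions of \<omega> alone: it turns a monotone limit of potentials into a limit of integrals
  over the base. The same comparison bounds truncation errors, so a measure built from bounded
  potentials also represents the functional on unbounded ones. Convexity of \<open>D\<close> needs
  additivity of the integral over \<omega>, hence measurability of suprema over separated sets of
  preimages. This is a projection problem, and compactness of the space of sequences in the fibre
  solves it without measurable selections. A preimage may be empty. Whether this has positive
  probability depends on the dynamics only, so for given n, k and target the value -\<infinity>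
  occurs for all potentials or for none. Replacing the target point by a closed target set lets one
  argument serve all three mean dimensions.\<close>

locale function_space =
  fixes V :: "('a \<Rightarrow> real) set"
  assumes zero: "(\<lambda>x. 0) \<in> V"
    and add: "f \<in> V \<Longrightarrow> g \<in> V \<Longrightarrow> (\<lambda>x. f x + g x) \<in> V"
    and scale: "f \<in> V \<Longrightarrow> (\<lambda>x. c * f x) \<in> V"
begin

lemma uminus: "f \<in> V \<Longrightarrow> (\<lambda>x. - f x) \<in> V"
  using scale[of f "-1"] by simp

lemma diff: "f \<in> V \<Longrightarrow> g \<in> V \<Longrightarrow> (\<lambda>x. f x - g x) \<in> V"
  using add[of f "\<lambda>x. - g x"] uminus[of g] by simp

lemma sum: "(\<And>i. i \<in> I \<Longrightarrow> f i \<in> V) \<Longrightarrow> (\<lambda>x. \<Sum>i\<in>I. f i x) \<in> V"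
  by (induction I rule: infinite_finite_induct) (simp_all add: zero add)

definition sublinear :: "(('a \<Rightarrow> real) \<Rightarrow> real) \<Rightarrow> bool" where
  "sublinear q \<longleftrightarrow>
     (\<forall>f\<in>V. \<forall>g\<in>V. q (\<lambda>x. f x + g x) \<le> q f + q g) \<and>
     (\<forall>f\<in>V. \<forall>c>0. q (\<lambda>x. c * f x) = c * q f)"

lemma sublinearD:
  assumes "sublinear q" "f \<in> V"
  shows "g \<in> V \<Longrightarrow> q (\<lambda>x. f x + g x) \<le> q f + q g"
    and "c > 0 \<Longrightarrow> q (\<lambda>x. c * f x) = c * q f"
  using assms unfolding sublinear_def by auto

definition linear_functional :: "(('a \<Rightarrow> real) \<Rightarrow> real) \<Rightarrow> bool" where
  "linear_functional l \<longleftrightarrow>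
     (\<forall>f\<in>V. \<forall>g\<in>V. l (\<lambda>x. f x + g x) = l f + l g) \<and>
     (\<forall>f\<in>V. \<forall>c. l (\<lambda>x. c * f x) = c * l f)"

lemma linear_functionalD:
  assumes "linear_functional l" "f \<in> V"
  shows "g \<in> V \<Longrightarrow> l (\<lambda>x. f x + g x) = l f + l g"
    and "l (\<lambda>x. c * f x) = c * l f"
    and "l (\<lambda>x. - f x) = - l f"
    and "g \<in> V \<Longrightarrow> l (\<lambda>x. f x - g x) = l f - l g"
    and "l (\<lambda>x. 0) = 0"
proof -
  have a: "\<And>f g. f \<in> V \<Longrightarrow> g \<in> V \<Longrightarrow> l (\<lambda>x. f x + g x) = l f + l g"
    and s: "\<And>f c. f \<in> V \<Longrightarrow> l (\<lambda>x. c * f x) = c * l f"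
    using assms(1) by (auto simp: linear_functional_def)
  have m: "\<And>f. f \<in> V \<Longrightarrow> l (\<lambda>x. - f x) = - l f"
    using s[of _ "-1"] by simp
  show "g \<in> V \<Longrightarrow> l (\<lambda>x. f x + g x) = l f + l g"
    "l (\<lambda>x. c * f x) = c * l f" "l (\<lambda>x. - f x) = - l f"
    using a s m assms(2) by blast+
  show "g \<in> V \<Longrightarrow> l (\<lambda>x. f x - g x) = l f - l g"
    using a[of f "\<lambda>x. - g x"] m[of g] uminus[of g] assms(2) by simp
  show "l (\<lambda>x. 0) = 0"
    using s[of f 0] assms(2) by simp
qed

lemma linear_functional_sum:
  assumes l: "linear_functional l" and f: "\<And>i. i \<in> I \<Longrightarrow> f i \<in> V"
  shows "l (\<lambda>x. \<Sum>i\<in>I. f i x) = (\<Sum>i\<in>I. l (f i))"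
  using f
  by (induction I rule: infinite_finite_induct)
    (simp_all add: linear_functionalD[OF l] linear_functionalD(5)[OF l zero] sum)

lemma sublinear_lower:
  assumes q: "sublinear q" and f: "f \<in> V"
  shows "- q (\<lambda>x. - f x) \<le> q f"
proof -
  \<comment> \<open>Homogeneity is only required for positive factors, so the value at 0 has to be
    extracted from \<open>0 = 2 * 0\<close>.\<close>
  have "q (\<lambda>x. 0) = 2 * q (\<lambda>x. 0)"
    using sublinearD(2)[OF q zero, of 2] by simp
  then have "q (\<lambda>x. 0) = 0" by simp
  moreover have "q (\<lambda>x. f x + - f x) \<le> q f + q (\<lambda>x. - f x)"
    using sublinearD(1)[OF q f uminus[OF f]] .
  ultimately show ?thesis by simp
qed

text \<open>The two infima are taken one index at a time; the common lower bound \<open>a\<close>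
  itself supplies the bounds that conditionally complete infima require. This is the form in which
  subadditivity of infima is proved, here and for \<open>slope\<close>.\<close>

lemma le_cINF_add:
  fixes F G :: "_ \<Rightarrow> real"
  assumes "S \<noteq> {}" "R \<noteq> {}" "\<And>s r. s \<in> S \<Longrightarrow> r \<in> R \<Longrightarrow> a \<le> F s + G r"
  shows "a \<le> (INF s\<in>S. F s) + (INF r\<in>R. G r)"
proof -
  have "a - F s \<le> (INF r\<in>R. G r)" if "s \<in> S" for s
    using assms(2) by (rule cINF_greatest) (use assms(3) that in fastforce)
  then have "a - (INF r\<in>R. G r) \<le> (INF s\<in>S. F s)"
    using assms(1) by (intro cINF_greatest) fastforce+
  then show ?thesis by simp
qed

text \<open>Domination by \<open>p\<close> also bounds every member from below, by
  \<open>- p (- f)\<close>. Subadditivity survives because two members of a chain have one of them,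
  \<open>u\<close>, below both, and \<open>u\<close> is subadditive.\<close>

lemma sublinear_Inf:
  assumes ne: "Q \<noteq> {}" and Q: "\<And>q. q \<in> Q \<Longrightarrow> sublinear q \<and> (\<forall>f\<in>V. q f \<le> p f)"
    and chain: "\<And>q q'. q \<in> Q \<Longrightarrow> q' \<in> Q \<Longrightarrow> (\<forall>f. q f \<le> q' f) \<or> (\<forall>f. q' f \<le> q f)"
    and f: "f \<in> V"
  shows "bdd_below ((\<lambda>q. q f) ` Q)"
    and "sublinear (\<lambda>f. INF q\<in>Q. q f)"
proof -
  have bdd: "bdd_below ((\<lambda>q. q f) ` Q)" if f: "f \<in> V" for f
  proof (rule bdd_belowI2)
    show "- p (\<lambda>x. - f x) \<le> q f" if "q \<in> Q" for q
      using sublinear_lower[of q f] Q[OF that] uminus[OF f] f by fastforce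
  qed
  from f show "bdd_below ((\<lambda>q. q f) ` Q)" by (rule bdd)
  show "sublinear (\<lambda>f. INF q\<in>Q. q f)"
    unfolding sublinear_def
  proof (intro conjI ballI allI impI)
    fix f g assume f: "f \<in> V" and g: "g \<in> V"
    show "(INF q\<in>Q. q (\<lambda>x. f x + g x)) \<le> (INF q\<in>Q. q f) + (INF q\<in>Q. q g)"
    proof (rule le_cINF_add[OF ne ne])
      fix q r assume qr: "q \<in> Q" "r \<in> Q"
      obtain u where u: "u \<in> Q" "u f \<le> q f" "u g \<le> r g"
        using chain[OF qr] qr by (metis order_refl)
      have "(INF q\<in>Q. q (\<lambda>x. f x + g x)) \<le> u (\<lambda>x. f x + g x)"
        using bdd[OF add[OF f g]] u(1) by (rule cINF_lower)
      also have "\<dots> \<le> u f + u g"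
        using Q[OF u(1)] sublinearD(1)[OF _ f g] by blast
      finally show "(INF q\<in>Q. q (\<lambda>x. f x + g x)) \<le> q f + r g" using u by linarith
    qed
  next
    fix f and c :: real assume f: "f \<in> V" and c: "c > 0"
    have eq: "q (\<lambda>x. c * f x) = c * q f" if "q \<in> Q" for q
      using Q[OF that] sublinearD(2)[OF _ f c] by blast
    have "(INF q\<in>Q. q (\<lambda>x. c * f x)) = (INF q\<in>Q. c * q f)"
      using eq by simp
    also have "\<dots> = c * (INF q\<in>Q. q f)"
    proof (rule antisym)
      have "(INF q\<in>Q. c * q f) / c \<le> (INF q\<in>Q. q f)"
      proof (rule cINF_greatest[OF ne])
        fix q assume "q \<in> Q"
        have "(INF q\<in>Q. c * q f) \<le> c * q f"
          using bdd[OF scale[OF f, of c]] eq \<open>q \<in> Q\<close> by (intro cINF_lower) (simp_all cong: image_cong)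
        then show "(INF q\<in>Q. c * q f) / c \<le> q f" using c by (simp add: field_simps)
      qed
      then show "(INF q\<in>Q. c * q f) \<le> c * (INF q\<in>Q. q f)" using c by (simp add: field_simps)
      show "c * (INF q\<in>Q. q f) \<le> (INF q\<in>Q. c * q f)"
        using c by (intro cINF_greatest[OF ne] mult_left_mono cINF_lower bdd f) auto
    qed
    finally show "(INF q\<in>Q. q (\<lambda>x. c * f x)) = c * (INF q\<in>Q. q f)" .
  qed
qed

text \<open>The infimum is finite because \<open>t * q y = q (t * y)\<close> and
  \<open>t * y\<close> splits as \<open>(f + t * y) + (- f)\<close>, which gives the lower bound
  \<open>- q (- f)\<close>. The parameter \<open>t = 0\<close> shows that \<open>r\<close> lies
  below \<open>q\<close>; \<open>t = 1\<close> gives the bound that forces a minimal functional to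
  be additive.\<close>

lemma sublinear_directional:
  assumes q: "sublinear q" and y: "y \<in> V"
  defines "r \<equiv> \<lambda>f. INF t\<in>{0..}. q (\<lambda>x. f x + t * y x) - t * q y"
  shows "sublinear r"
    and "f \<in> V \<Longrightarrow> t \<ge> 0 \<Longrightarrow> r f \<le> q (\<lambda>x. f x + t * y x) - t * q y"
proof -
  have qa: "q (\<lambda>x. f x + g x) \<le> q f + q g" if "f \<in> V" "g \<in> V" for f g
    using sublinearD(1)[OF q that] .
  have qs: "q (\<lambda>x. c * f x) = c * q f" if "f \<in> V" "c > 0" for f c
    using sublinearD(2)[OF q that] .
  have q0: "q (\<lambda>x. 0 * y x) = 0"
    using qs[OF zero, of 2] by simp
  have bdd: "bdd_below ((\<lambda>t. q (\<lambda>x. f x + t * y x) - t * q y) ` {0..})" if f: "f \<in> V" for f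
  proof (rule bdd_belowI2)
    fix t :: real assume "t \<in> {0..}"
    then have "t * q y = q (\<lambda>x. t * y x)"
      using qs[OF y, of t] q0 by (cases "t = 0") auto
    also have "\<dots> = q (\<lambda>x. (f x + t * y x) + - f x)" by simp
    also have "\<dots> \<le> q (\<lambda>x. f x + t * y x) + q (\<lambda>x. - f x)"
      by (intro qa add scale uminus f y)
    finally show "- q (\<lambda>x. - f x) \<le> q (\<lambda>x. f x + t * y x) - t * q y" by simp
  qed
  have le: "r f \<le> q (\<lambda>x. f x + t * y x) - t * q y" if "f \<in> V" "t \<ge> 0" for f t
    unfolding r_def using bdd[OF that(1)] by (rule cINF_lower) (use that in simp)
  show "f \<in> V \<Longrightarrow> t \<ge> 0 \<Longrightarrow> r f \<le> q (\<lambda>x. f x + t * y x) - t * q y"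
    by (rule le)
  have r_eq: "r f = (INF t\<in>{0..}. q (\<lambda>x. f x + t * y x) - t * q y)" for f
    by (simp add: r_def)
  have ne: "{0::real..} \<noteq> {}" by auto
  have scale_le: "r (\<lambda>x. c * f x) \<le> c * r f" if f: "f \<in> V" and c: "c > 0" for f c
  proof -
    have "r (\<lambda>x. c * f x) / c \<le> r f"
      unfolding r_eq[of f]
    proof (rule cINF_greatest[OF ne])
      fix t :: real assume t: "t \<in> {0..}"
      have "q (\<lambda>x. c * f x + (c * t) * y x) = c * q (\<lambda>x. f x + t * y x)"
        using qs[of "\<lambda>x. f x + t * y x" c] c add[OF f scale[OF y]]
        by (simp add: algebra_simps)
      moreover have "r (\<lambda>x. c * f x) \<le> q (\<lambda>x. c * f x + (c * t) * y x) - (c * t) * q y"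
        using le[OF scale[OF f], of "c * t"] t c by simp
      ultimately have "r (\<lambda>x. c * f x) \<le> c * (q (\<lambda>x. f x + t * y x) - t * q y)"
        by (simp add: algebra_simps)
      then show "r (\<lambda>x. c * f x) / c \<le> q (\<lambda>x. f x + t * y x) - t * q y"
        using c by (simp add: field_simps)
    qed
    then show ?thesis using c by (simp add: field_simps)
  qed
  show "sublinear r"
    unfolding sublinear_def
  proof (intro conjI ballI allI impI)
    fix f g assume f: "f \<in> V" and g: "g \<in> V"
    show "r (\<lambda>x. f x + g x) \<le> r f + r g"
      unfolding r_eq[of f] r_eq[of g]
    proof (rule le_cINF_add[OF ne ne])
      fix s t :: real assume st: "s \<in> {0..}" "t \<in> {0..}"
      have "r (\<lambda>x. f x + g x) \<le> q (\<lambda>x. (f x + g x) + (s + t) * y x) - (s + t) * q y"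
        using st by (intro le add f g) auto
      also have "q (\<lambda>x. (f x + g x) + (s + t) * y x) = q (\<lambda>x. (f x + s * y x) + (g x + t * y x))"
        by (simp add: algebra_simps)
      also have "\<dots> \<le> q (\<lambda>x. f x + s * y x) + q (\<lambda>x. g x + t * y x)"
        by (intro qa add f g scale y)
      finally show "r (\<lambda>x. f x + g x) \<le> (q (\<lambda>x. f x + s * y x) - s * q y) + (q (\<lambda>x. g x + t * y x) - t * q y)"
        by (simp add: algebra_simps)
    qed
  next
    fix f and c :: real assume f: "f \<in> V" and c: "c > 0"
    \<comment> \<open>The reverse inequality is \<open>scale_le\<close> for the factor
      \<open>1 / c\<close>.\<close>
    have "r (\<lambda>x. (1 / c) * (c * f x)) \<le> (1 / c) * r (\<lambda>x. c * f x)"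
      by (rule scale_le[OF scale[OF f]]) (use c in simp)
    then have "c * r f \<le> r (\<lambda>x. c * f x)"
      using c by (simp add: field_simps)
    then show "r (\<lambda>x. c * f x) = c * r f"
      using scale_le[OF f c] by linarith
  qed
qed

text \<open>A minimal sublinear functional \<open>m\<close> is linear: its directional modification in direction
  \<open>g\<close> lies below it, hence equals it, which says \<open>m f \<le> m (f + g) - m g\<close>.\<close>

theorem exists_linear_functional_le:
  assumes p: "sublinear p"
  shows "\<exists>l. linear_functional l \<and> (\<forall>f\<in>V. l f \<le> p f)"
proof -
  \<comment> \<open>Values outside \<open>V\<close> are pinned to 0, since \<open>below\<close>
    compares at every function and sublinearity controls nothing there.\<close>
  define S where "S = {q. sublinear q \<and> (\<forall>f\<in>V. q f \<le> p f) \<and> (\<forall>f. f \<notin> V \<longrightarrow> q f = 0)}"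
  \<comment> \<open>The order is reversed, so that a maximal element in Zorn's lemma is a minimal
    functional.\<close>
  define below where "below = (\<lambda>q r :: ('a \<Rightarrow> real) \<Rightarrow> real. \<forall>f. r f \<le> q f)"
  define restrict where "restrict = (\<lambda>(q :: ('a \<Rightarrow> real) \<Rightarrow> real) f. if f \<in> V then q f else 0)"
  have restrict: "sublinear (restrict q)" if "sublinear q" for q
    using that add scale by (auto simp: sublinear_def restrict_def)
  have "\<exists>m\<in>S. \<forall>q\<in>S. below m q \<longrightarrow> q = m"
  proof (rule predicate_Zorn)
    show "partial_order_on S (relation_of below S)"
    proof (rule partial_order_on_relation_ofI)
      show "below q q" for q by (simp add: below_def)
      show "below q s" if "below q r" "below r s" for q r s
        using that unfolding below_def by (blast intro: order_trans)
      show "q = r" if "below q r" "below r q" for q r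
        using that unfolding below_def by (blast intro: antisym ext)
    qed
    fix C assume C: "C \<in> Chains (relation_of below S)"
    have CS: "C \<subseteq> S" using C by (rule Chains_relation_of)
    show "\<exists>u\<in>S. \<forall>q\<in>C. below q u"
    proof (cases "C = {}")
      case True
      have "restrict p \<in> S"
        using restrict[OF p] unfolding S_def restrict_def by simp
      then show ?thesis using True by blast
    next
      case False
      have inf: "\<And>f. f \<in> V \<Longrightarrow> bdd_below ((\<lambda>q. q f) ` C)" "sublinear (\<lambda>f. INF q\<in>C. q f)"
      proof -
        have 1: "\<And>q. q \<in> C \<Longrightarrow> sublinear q \<and> (\<forall>f\<in>V. q f \<le> p f)"
          using CS unfolding S_def by blast
        have 2: "\<And>q q'. q \<in> C \<Longrightarrow> q' \<in> C \<Longrightarrow> (\<forall>f. q f \<le> q' f) \<or> (\<forall>f. q' f \<le> q f)"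
          using C unfolding Chains_def relation_of_def below_def by blast
        show "\<And>f. f \<in> V \<Longrightarrow> bdd_below ((\<lambda>q. q f) ` C)"
          by (rule sublinear_Inf(1)[OF False 1 2])
        show "sublinear (\<lambda>f. INF q\<in>C. q f)"
          by (rule sublinear_Inf(2)[OF False 1 2 zero])
      qed
      define u where "u = restrict (\<lambda>f. INF q\<in>C. q f)"
      have le: "u f \<le> q f" if "q \<in> C" for q f
        using cINF_lower[OF inf(1) that] CS that unfolding u_def restrict_def S_def by auto
      obtain q where "q \<in> C" using False by blast
      then have "\<forall>f\<in>V. u f \<le> p f"
        using le CS unfolding S_def by (blast intro: order_trans)
      then have "u \<in> S"
        using restrict[OF inf(2)] unfolding S_def u_def restrict_def by simp
      then show ?thesis using le unfolding below_def by blast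
    qed
  qed
  then obtain m where m: "m \<in> S" and min: "\<And>q. q \<in> S \<Longrightarrow> below m q \<Longrightarrow> q = m" by blast
  have sub: "sublinear m" and mp: "\<And>f. f \<in> V \<Longrightarrow> m f \<le> p f" using m unfolding S_def by auto
  have m_add: "m (\<lambda>x. f x + g x) = m f + m g" if f: "f \<in> V" and g: "g \<in> V" for f g
  proof (rule antisym)
    show "m (\<lambda>x. f x + g x) \<le> m f + m g" by (rule sublinearD(1)[OF sub f g])
    define r where "r = (\<lambda>f. INF t\<in>{0..}. m (\<lambda>x. f x + t * g x) - t * m g)"
    have r: "sublinear r" "\<And>f t. f \<in> V \<Longrightarrow> t \<ge> 0 \<Longrightarrow> r f \<le> m (\<lambda>x. f x + t * g x) - t * m g"
      using sublinear_directional[OF sub g] unfolding r_def by blast+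
    have "r f \<le> m f" if "f \<in> V" for f using r(2)[OF that, of 0] by simp
    then have "restrict r \<in> S" "below m (restrict r)"
      using restrict[OF r(1)] mp m unfolding S_def below_def restrict_def
      by (auto intro: order_trans)
    then have "restrict r = m" by (rule min)
    from fun_cong[OF this, of f] have "r f = m f" using f by (simp add: restrict_def)
    then show "m f + m g \<le> m (\<lambda>x. f x + g x)" using r(2)[OF f, of 1] by simp
  qed
  have m0: "m (\<lambda>x. 0) = 0" using m_add[OF zero zero] by simp
  have neg: "m (\<lambda>x. - f x) = - m f" if "f \<in> V" for f
    using m_add[OF that uminus[OF that]] m0 by simp
  have pos: "m (\<lambda>x. c * f x) = c * m f" if "f \<in> V" "c > 0" for f c
    by (rule sublinearD(2)[OF sub that])
  have "m (\<lambda>x. c * f x) = c * m f" if f: "f \<in> V" for f c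
  proof -
    consider "c = 0" | "c > 0" | "c < 0" by linarith
    then show ?thesis
    proof cases
      case 3
      then show ?thesis using pos[OF f, of "-c"] neg[OF scale[OF f, of "-c"]] by simp
    qed (use m0 pos f in auto)
  qed
  then have "linear_functional m" using m_add unfolding linear_functional_def by blast
  then show ?thesis using mp by blast
qed

end

section \<open>The Daniell integral\<close>

text \<open>The axiom \<open>mult\<close> goes beyond the usual lattice conditions: Caratheodory's
  criterion is checked by splitting a cover into \<open>h * u\<close> and
  \<open>h * (1 - u)\<close>. Boundedness yields integrability, because the measure turns out to be
  finite.\<close>

locale daniell_integral = function_space V
  for V :: "('a \<Rightarrow> real) set" +
  fixes l :: "('a \<Rightarrow> real) \<Rightarrow> real"
  assumes one: "(\<lambda>x. 1) \<in> V"
    and mult: "f \<in> V \<Longrightarrow> g \<in> V \<Longrightarrow> (\<lambda>x. f x * g x) \<in> V"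
    and pos: "f \<in> V \<Longrightarrow> (\<lambda>x. max 0 (f x)) \<in> V"
    and bounded: "f \<in> V \<Longrightarrow> \<exists>B. \<forall>x. \<bar>f x\<bar> \<le> B"
    and linear: "linear_functional l"
    and nonneg: "f \<in> V \<Longrightarrow> (\<And>x. 0 \<le> f x) \<Longrightarrow> 0 \<le> l f"
    and continuous: "(\<And>n. F n \<in> V) \<Longrightarrow> (\<And>n x. F (Suc n) x \<le> F n x) \<Longrightarrow>
      (\<And>x. (\<lambda>n. F n x) \<longlonglongrightarrow> 0) \<Longrightarrow> (\<lambda>n. l (F n)) \<longlonglongrightarrow> 0"
begin

lemmas l_simps = linear_functionalD[OF linear]

lemma const: "(\<lambda>x. c) \<in> V"
  using scale[OF one, of c] by simp

lemma min: "f \<in> V \<Longrightarrow> g \<in> V \<Longrightarrow> (\<lambda>x. min (f x) (g x)) \<in> V"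
proof -
  assume "f \<in> V" "g \<in> V"
  then have "(\<lambda>x. f x - max 0 (f x - g x)) \<in> V" by (intro diff pos)
  also have "(\<lambda>x. f x - max 0 (f x - g x)) = (\<lambda>x. min (f x) (g x))" by (auto simp: min_def max_def)
  finally show ?thesis .
qed

lemma mono: "f \<in> V \<Longrightarrow> g \<in> V \<Longrightarrow> (\<And>x. f x \<le> g x) \<Longrightarrow> l f \<le> l g"
  using nonneg[OF diff, of g f] l_simps(4)[of g f] by simp

section \<open>Outer measure from countable functional covers\<close>

definition cover :: "'a set \<Rightarrow> (nat \<Rightarrow> 'a \<Rightarrow> real) \<Rightarrow> bool" where
  "cover S h \<longleftrightarrow> (\<forall>i. h i \<in> V \<and> (\<forall>x. 0 \<le> h i x)) \<and> (\<forall>x\<in>S. 1 \<le> (\<Sum>i. ennreal (h i x)))"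

text \<open>Daniell's upper integral of the indicator of \<open>S\<close>. With countable covers
  built in, countable subadditivity is a re-indexing of a double series, and the analytic content
  moves to \<open>le_outer\<close>.\<close>

definition outer :: "'a set \<Rightarrow> ennreal" where
  "outer S = (INF h\<in>{h. cover S h}. \<Sum>i. ennreal (l (h i)))"

lemma outer_le_cover: "cover S h \<Longrightarrow> outer S \<le> (\<Sum>i. ennreal (l (h i)))"
  unfolding outer_def by (rule INF_lower) simp

lemma outer_le:
  assumes g: "g \<in> V" "\<And>x. 0 \<le> g x" "\<And>x. x \<in> S \<Longrightarrow> 1 \<le> g x"
  shows "outer S \<le> ennreal (l g)"
proof -
  define h where "h = (\<lambda>i::nat. if i = 0 then g else (\<lambda>x. 0))"
  have "(\<Sum>i. ennreal (h i x)) = ennreal (g x)" for x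
    by (subst suminf_finite[of "{0}"]) (auto simp: h_def)
  then have "cover S h"
    using g zero by (auto simp: cover_def h_def)
  moreover have "(\<Sum>i. ennreal (l (h i))) = ennreal (l g)"
    by (subst suminf_finite[of "{0}"]) (auto simp: h_def l_simps(5)[OF zero])
  ultimately show ?thesis using outer_le_cover by metis
qed

text \<open>This is where the axiom \<open>continuous\<close> enters. For a cover \<open>h\<close>,
  the remainders \<open>r n = max 0 (g - (h 0 + ... + h (n - 1)))\<close> decrease to 0 pointwise:
  on \<open>S\<close> the full sum is at least \<open>1 \<ge> g\<close>, and off \<open>S\<close>
  already \<open>g \<le> 0\<close>. Hence \<open>l (r n)\<close> tends to 0 in
  \<open>l g \<le> l (r n) + (l (h 0) + ... + l (h (n - 1)))\<close>.\<close>

lemma le_outer: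
  assumes g: "g \<in> V" and S: "\<And>x. g x \<le> indicator S x"
  shows "ennreal (l g) \<le> outer S"
  unfolding outer_def
proof (rule INF_greatest)
  fix h assume "h \<in> {h. cover S h}"
  then have h: "\<And>i. h i \<in> V" "\<And>i x. 0 \<le> h i x"
    and sum_ge: "\<And>x. x \<in> S \<Longrightarrow> 1 \<le> (\<Sum>i. ennreal (h i x))"
    unfolding cover_def by auto
  define r where "r = (\<lambda>n x. max 0 (g x - (\<Sum>i<n. h i x)))"
  have rV: "r n \<in> V" for n
    unfolding r_def by (intro pos diff sum h g)
  have r0: "(\<lambda>n. r n x) \<longlonglongrightarrow> 0" for x
  proof (rule LIMSEQ_I)
    fix e :: real assume e: "e > 0"
    have "\<forall>\<^sub>F n in sequentially. g x - (\<Sum>i<n. h i x) < e"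
    proof (cases "x \<in> S")
      case True
      \<comment> \<open>The comparison of \<open>1 - e\<close> with the series is made in
        \<open>ennreal\<close> and requires \<open>1 - e\<close> to be nonnegative; for
        \<open>e > 1\<close> the bound \<open>g x \<le> 1\<close> is enough.\<close>
      show ?thesis
      proof (cases "e > 1")
        case True
        have "g x - (\<Sum>i<n. h i x) < e" for n
          using S[of x] True \<open>x \<in> S\<close> sum_nonneg[of "{..<n}" "\<lambda>i. h i x"] h(2) by force
        then show ?thesis by simp
      next
        case False
        have "(\<lambda>n. \<Sum>i<n. ennreal (h i x)) \<longlonglongrightarrow> (\<Sum>i. ennreal (h i x))"
          by (intro summable_LIMSEQ) simp
        moreover have "ennreal (1 - e) < (\<Sum>i. ennreal (h i x))"
          using sum_ge[OF \<open>x \<in> S\<close>] e False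
          by (intro less_le_trans[OF _ sum_ge[OF \<open>x \<in> S\<close>]])
            (simp add: ennreal_less_iff flip: ennreal_1)
        ultimately have "\<forall>\<^sub>F n in sequentially. ennreal (1 - e) < (\<Sum>i<n. ennreal (h i x))"
          by (rule order_tendstoD)
        then show ?thesis
        proof eventually_elim
          case (elim n)
          then have "1 - e < (\<Sum>i<n. h i x)"
            using h(2) False by (simp add: sum_ennreal ennreal_less_iff)
          then show ?case using S[of x] \<open>x \<in> S\<close> by simp
        qed
      qed
    next
      case False
      have "g x - (\<Sum>i<n. h i x) < e" for n
        using S[of x] False e sum_nonneg[of "{..<n}" "\<lambda>i. h i x"] h(2) by force
      then show ?thesis by simp
    qed
    then have "\<forall>\<^sub>F n in sequentially. norm (r n x - 0) < e"
      by eventually_elim (use e in \<open>simp add: r_def\<close>)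
    then show "\<exists>no. \<forall>n\<ge>no. norm (r n x - 0) < e"
      by (simp add: eventually_sequentially)
  qed
  have "(\<lambda>n. l (r n)) \<longlonglongrightarrow> 0"
  proof (rule continuous[OF rV _ r0])
    show "r (Suc n) x \<le> r n x" for n x
      using h(2)[of n x] by (auto simp: r_def intro!: max.mono)
  qed
  then have lim: "(\<lambda>n. ennreal (l (r n)) + (\<Sum>i. ennreal (l (h i)))) \<longlonglongrightarrow> ennreal 0 + (\<Sum>i. ennreal (l (h i)))"
    by (intro tendsto_add tendsto_ennrealI tendsto_const)
  have "ennreal (l g) \<le> ennreal (l (r n)) + (\<Sum>i. ennreal (l (h i)))" for n
  proof -
    have "l g \<le> l (\<lambda>x. r n x + (\<Sum>i<n. h i x))"
      by (intro mono g add rV sum h) (simp add: r_def)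
    also have "\<dots> = l (r n) + (\<Sum>i<n. l (h i))"
      using rV h by (simp add: l_simps(1) sum linear_functional_sum[OF linear])
    finally have "ennreal (l g) \<le> ennreal (l (r n) + (\<Sum>i<n. l (h i)))"
      by (rule ennreal_leI)
    also have "\<dots> = ennreal (l (r n)) + (\<Sum>i<n. ennreal (l (h i)))"
      using nonneg rV h by (subst ennreal_plus) (auto simp: sum_nonneg r_def sum_ennreal)
    also have "\<dots> \<le> ennreal (l (r n)) + (\<Sum>i. ennreal (l (h i)))"
      by (intro add_left_mono sum_le_suminf) auto
    finally show ?thesis .
  qed
  with LIMSEQ_le_const[OF lim] show "ennreal (l g) \<le> (\<Sum>i. ennreal (l (h i)))"
    by simp
qed

lemma outer_finite: "outer S \<noteq> \<infinity>"
  using outer_le[OF one, of S] by (auto simp: top_unique)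

lemma outer_measure_space_outer: "outer_measure_space (Pow UNIV) outer"
  unfolding outer_measure_space_def
proof (intro conjI)
  show "positive (Pow UNIV) outer"
    using outer_le[OF zero, of "{}"] by (simp add: positive_def l_simps(5)[OF zero])
  show "increasing (Pow UNIV) outer"
    unfolding increasing_def outer_def cover_def by (auto intro!: INF_superset_mono)
  show "countably_subadditive (Pow UNIV) outer"
    unfolding countably_subadditive_def
  proof (intro allI impI)
    fix A :: "nat \<Rightarrow> 'a set"
    show "outer (\<Union>i. A i) \<le> (\<Sum>i. outer (A i))"
    proof (rule ennreal_le_epsilon)
      fix e :: real assume e: "e > 0"
      have "\<exists>h. cover (A n) h \<and> (\<Sum>i. ennreal (l (h i))) \<le> outer (A n) + ennreal (e * (1/2) ^ Suc n)" for n
      proof -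
        have "outer (A n) < outer (A n) + ennreal (e * (1/2) ^ Suc n)"
          using outer_finite[of "A n"] e by simp
        then show ?thesis
          unfolding outer_def INF_less_iff by (auto intro: less_imp_le)
      qed
      then obtain h where h: "\<And>n. cover (A n) (h n)"
        and he: "\<And>n. (\<Sum>i. ennreal (l (h n i))) \<le> outer (A n) + ennreal (e * (1/2) ^ Suc n)"
        by metis
      define H where "H = (\<lambda>i. case_prod h (prod_decode i))"
      have "cover (\<Union>i. A i) H"
        unfolding cover_def
      proof (intro conjI allI ballI)
        fix i show "H i \<in> V" "\<And>x. 0 \<le> H i x"
          using h unfolding H_def cover_def by (auto split: prod.split)
      next
        fix x assume "x \<in> (\<Union>i. A i)"
        then obtain n where "x \<in> A n" by blast
        then have "1 \<le> (\<Sum>j. ennreal (h n j x))" using h unfolding cover_def by blast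
        also have "\<dots> \<le> (\<Sum>m. \<Sum>j. ennreal (h m j x))"
          using sum_le_suminf[of "\<lambda>m. \<Sum>j. ennreal (h m j x)" "{n}"] by simp
        also have "\<dots> = (\<Sum>i. (\<lambda>(m, j). ennreal (h m j x)) (prod_decode i))"
          by (rule suminf_ennreal_2dimen[symmetric]) simp
        finally show "1 \<le> (\<Sum>i. ennreal (H i x))"
          by (simp add: H_def split_beta)
      qed
      then have "outer (\<Union>i. A i) \<le> (\<Sum>i. ennreal (l (H i)))" by (rule outer_le_cover)
      also have "\<dots> = (\<Sum>i. (\<lambda>(m, j). ennreal (l (h m j))) (prod_decode i))"
        by (simp add: H_def split_beta)
      also have "\<dots> = (\<Sum>m. \<Sum>j. ennreal (l (h m j)))"
        by (rule suminf_ennreal_2dimen) simp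
      also have "\<dots> \<le> (\<Sum>n. outer (A n) + ennreal (e * (1/2) ^ Suc n))"
        by (intro suminf_le he) auto
      also have "\<dots> = (\<Sum>n. outer (A n)) + (\<Sum>n. ennreal (e * (1/2) ^ Suc n))"
        by (rule suminf_add[symmetric]) auto
      also have "(\<Sum>n. ennreal (e * (1/2) ^ Suc n)) = ennreal e"
        using sums_mult[OF power_half_series, of e] e by (intro suminf_ennreal_eq) auto
      finally show "outer (\<Union>i. A i) \<le> (\<Sum>i. outer (A i)) + ennreal e" .
    qed
  qed
qed

lemma outer_Un: "outer (A \<union> B) \<le> outer A + outer B"
proof -
  interpret algebra UNIV "Pow (UNIV :: 'a set)" by (rule algebra_Pow)
  have "subadditive (Pow UNIV) outer"
    using outer_measure_space_outer unfolding outer_measure_space_def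
    by (intro countably_subadditive_subadditive) auto
  then have "outer (A \<union> (B - A)) \<le> outer A + outer (B - A)"
    unfolding subadditive_def by blast
  moreover have "outer (B - A) \<le> outer B"
    using outer_measure_space_outer unfolding outer_measure_space_def increasing_def by blast
  ultimately have "outer (A \<union> (B - A)) \<le> outer A + outer B"
    by (rule order_trans[OF _ add_left_mono])
  then show ?thesis by simp
qed

lemma outer_mono: "A \<subseteq> B \<Longrightarrow> outer A \<le> outer B"
  using outer_measure_space_outer unfolding outer_measure_space_def increasing_def by blast

text \<open>A cover \<open>h\<close> of \<open>S\<close> splits as
  \<open>h * u + h * (1 - u)\<close>. The first parts are unchanged where \<open>u = 1\<close> and
  the second parts where \<open>u = 0\<close>, so they cover the two pieces, and linearity of
  \<open>l\<close> adds the costs up exactly.\<close>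

lemma outer_split_le:
  assumes u: "u \<in> V" "\<And>x. 0 \<le> u x" "\<And>x. u x \<le> 1"
  shows "outer (S \<inter> {x. u x = 1}) + outer (S \<inter> {x. u x = 0}) \<le> outer S"
  unfolding outer_def[of S]
proof (rule INF_greatest)
  fix h assume "h \<in> {h. cover S h}"
  then have h: "\<And>i. h i \<in> V" "\<And>i x. 0 \<le> h i x"
    and sum_ge: "\<And>x. x \<in> S \<Longrightarrow> 1 \<le> (\<Sum>i. ennreal (h i x))"
    unfolding cover_def by auto
  define a b where "a = (\<lambda>i x. h i x * u x)" and "b = (\<lambda>i x. h i x * (1 - u x))"
  have V: "a i \<in> V" "b i \<in> V" for i
    unfolding a_def b_def by (intro mult diff one h u)+
  have ge0: "0 \<le> a i x" "0 \<le> b i x" for i x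
    using h(2) u unfolding a_def b_def by auto
  have "cover (S \<inter> {x. u x = 1}) a" "cover (S \<inter> {x. u x = 0}) b"
    using V ge0 sum_ge unfolding cover_def a_def b_def by auto
  then have "outer (S \<inter> {x. u x = 1}) + outer (S \<inter> {x. u x = 0})
      \<le> (\<Sum>i. ennreal (l (a i))) + (\<Sum>i. ennreal (l (b i)))"
    by (intro add_mono outer_le_cover)
  also have "\<dots> = (\<Sum>i. ennreal (l (a i)) + ennreal (l (b i)))"
    by (rule suminf_add) auto
  also have "\<dots> = (\<Sum>i. ennreal (l (h i)))"
  proof (rule arg_cong[where f = suminf], rule ext)
    fix i
    have "l (a i) + l (b i) = l (\<lambda>x. a i x + b i x)" using V by (simp add: l_simps(1))
    also have "(\<lambda>x. a i x + b i x) = h i" by (simp add: a_def b_def algebra_simps)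
    finally show "ennreal (l (a i)) + ennreal (l (b i)) = ennreal (l (h i))"
      using nonneg V ge0 by (simp flip: ennreal_plus)
  qed
  finally show "outer (S \<inter> {x. u x = 1}) + outer (S \<inter> {x. u x = 0}) \<le> (\<Sum>i. ennreal (l (h i)))" .
qed

text \<open>\<open>G = {g > 0}\<close> is exhausted by the sets where \<open>u\<^sub>n = min 1 (2\<^sup>n g\<^sup>+)\<close> equals \<open>1\<close>. The outer
  measure of the remainder is at most \<open>2 (sup\<^sub>k l u\<^sub>k - l u\<^sub>n)\<close>, because \<open>u\<^sub>n < 1 / 2\<close> on the
  set \<open>{u\<^sub>n\<^sub>+\<^sub>1 < 1}\<close>.\<close>

lemma positivity_set_lambda_system:
  assumes g: "g \<in> V"
  shows "{x. 0 < g x} \<in> lambda_system UNIV (Pow UNIV) outer"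
proof -
  define G where "G = {x. 0 < g x}"
  define u where "u = (\<lambda>n x. min 1 (2 ^ n * max 0 (g x)))"
  have uV: "u n \<in> V" for n unfolding u_def by (intro min one scale pos g)
  have u01: "0 \<le> u n x" "u n x \<le> 1" for n x unfolding u_def by auto
  have u_Suc: "u n x \<le> u (Suc n) x" for n x
    unfolding u_def by (intro min.mono mult_right_mono power_increasing) auto
  have u_lim: "(\<lambda>n. u n x) \<longlonglongrightarrow> 1" if "x \<in> G" for x
  proof -
    obtain N where N: "1 / g x < 2 ^ N"
      using real_arch_pow[of 2 "1 / g x"] by auto
    have "u n x = 1" if "n \<ge> N" for n
    proof -
      have "(2::real) ^ N \<le> 2 ^ n" using that by (simp add: power_increasing)
      with N have "1 / g x < 2 ^ n" by linarith
      then show ?thesis using \<open>x \<in> G\<close> by (simp add: u_def G_def field_simps)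
    qed
    then show ?thesis by (intro tendsto_eventually) (auto simp: eventually_sequentially)
  qed
  have "incseq (\<lambda>n. l (u n))" by (intro incseq_SucI mono uV u_Suc)
  moreover have "l (u n) \<le> l (\<lambda>x. 1)" for n by (intro mono uV one u01)
  ultimately obtain L where L: "(\<lambda>n. l (u n)) \<longlonglongrightarrow> L"
    using incseq_convergent[of "\<lambda>n. l (u n)"] by metis
  have rest: "outer (G \<inter> {x. u (Suc n) x < 1}) \<le> ennreal (2 * (L - l (u n)))" for n
  proof -
    define h where "h = (\<lambda>j x. 2 * (u (Suc j + n) x - u (j + n) x))"
    have hV: "h j \<in> V" for j unfolding h_def by (intro scale diff uV)
    have h0: "0 \<le> h j x" for j x using u_Suc[of "j + n" x] by (simp add: h_def)
    have "cover (G \<inter> {x. u (Suc n) x < 1}) h"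
      unfolding cover_def
    proof (intro conjI allI ballI hV h0)
      fix x assume x: "x \<in> G \<inter> {x. u (Suc n) x < 1}"
      have "(\<lambda>j. u (j + n) x) \<longlonglongrightarrow> 1"
        using u_lim x by (intro LIMSEQ_ignore_initial_segment) auto
      from sums_mult[OF telescope_sums[OF this], of 2]
      have "(\<lambda>j. h j x) sums (2 * (1 - u n x))" by (simp add: h_def)
      then have eq: "(\<Sum>j. ennreal (h j x)) = ennreal (2 * (1 - u n x))"
        using h0 by (intro suminf_ennreal_eq)
      have "u n x \<le> 1 / 2"
        using x by (auto simp: u_def G_def min_def max_def split: if_splits)
      then show "1 \<le> (\<Sum>j. ennreal (h j x))" unfolding eq by simp
    qed
    then have "outer (G \<inter> {x. u (Suc n) x < 1}) \<le> (\<Sum>j. ennreal (l (h j)))"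
      by (rule outer_le_cover)
    also have "\<dots> = ennreal (2 * (L - l (u n)))"
    proof (rule suminf_ennreal_eq)
      show "0 \<le> l (h j)" for j by (intro nonneg hV h0)
      have "(\<lambda>j. l (u (j + n))) \<longlonglongrightarrow> L" using L by (rule LIMSEQ_ignore_initial_segment)
      from sums_mult[OF telescope_sums[OF this], of 2]
      show "(\<lambda>j. l (h j)) sums (2 * (L - l (u n)))"
        unfolding h_def l_simps(2)[OF diff[OF uV uV]] l_simps(4)[OF uV uV] by simp
    qed
    finally show ?thesis .
  qed
  have "outer (S \<inter> G) + outer (S - G) = outer S" for S
  proof (rule antisym)
    show "outer S \<le> outer (S \<inter> G) + outer (S - G)"
      using outer_Un[of "S \<inter> G" "S - G"] by (simp add: Int_Diff_Un)
    have "outer (S \<inter> G) + outer (S - G) \<le> outer S + ennreal (2 * (L - l (u n)))" for n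
    proof -
      have SG: "S \<inter> {x. u (Suc n) x = 0} = S - G"
        by (auto simp: G_def u_def min_def max_def not_less)
      \<comment> \<open>The split lemma sees only the levels 1 and 0 of \<open>u (Suc n)\<close>.
        Level 0 is exactly the complement of \<open>G\<close>; the intermediate values inside
        \<open>G\<close> form the remainder estimated by \<open>rest\<close>.\<close>
      have "outer (S \<inter> G) \<le> outer ((S \<inter> {x. u (Suc n) x = 1}) \<union> (G \<inter> {x. u (Suc n) x < 1}))"
        using u01[of "Suc n"] by (intro outer_mono) (auto simp: order.order_iff_strict)
      also have "\<dots> \<le> outer (S \<inter> {x. u (Suc n) x = 1}) + ennreal (2 * (L - l (u n)))"
        by (rule order_trans[OF outer_Un]) (intro add_left_mono rest)
      finally have "outer (S \<inter> G) + outer (S - G)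
        \<le> outer (S \<inter> {x. u (Suc n) x = 1}) + ennreal (2 * (L - l (u n))) + outer (S - G)"
        by (rule add_right_mono)
      also have "\<dots> = outer (S \<inter> {x. u (Suc n) x = 1}) + outer (S - G) + ennreal (2 * (L - l (u n)))"
        by (simp add: ac_simps)
      also have "\<dots> \<le> outer S + ennreal (2 * (L - l (u n)))"
        using outer_split_le[OF uV u01, of S "Suc n"] unfolding SG by (rule add_right_mono)
      finally show ?thesis .
    qed
    moreover have "(\<lambda>n. outer S + ennreal (2 * (L - l (u n)))) \<longlonglongrightarrow> outer S + ennreal (2 * (L - L))"
      by (intro tendsto_intros tendsto_ennrealI L)
    ultimately have "outer (S \<inter> G) + outer (S - G) \<le> outer S + ennreal (2 * (L - L))"
      by (intro LIMSEQ_le_const) auto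
    then show "outer (S \<inter> G) + outer (S - G) \<le> outer S" by simp
  qed
  then show ?thesis
    unfolding G_def[symmetric] algebra.lambda_system_eq[OF algebra_Pow] by simp
qed

text \<open>A discrete layer-cake decomposition: cutting \<open>y\<close> at the heights
  \<open>k * d\<close> loses nothing below \<open>m * d\<close>, and replacing each slice by the
  full step of height \<open>d\<close> overshoots \<open>y\<close> by at most one step.\<close>

lemma slices:
  fixes y d :: real
  assumes "0 \<le> y" "0 \<le> d"
  shows "(\<Sum>k<m. min d (max 0 (y - real k * d))) = min (real m * d) y"
    and "(\<Sum>k<m. d * (if real k * d < y then 1 else 0)) \<le> min (real m * d) (y + d)"
proof -
  show "(\<Sum>k<m. min d (max 0 (y - real k * d))) = min (real m * d) y"
    using assms by (induction m) (auto simp: min_def max_def algebra_simps)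
  show "(\<Sum>k<m. d * (if real k * d < y then 1 else 0)) \<le> min (real m * d) (y + d)"
  proof (induction m)
    case (Suc m)
    then show ?case using assms(2)
      by (cases "real m * d < y") (auto simp: algebra_simps)
  qed (use assms in simp)
qed

text \<open>Only \<open>l f \<le> \<integral> f dM\<close> for \<open>0 \<le> f \<le> 1\<close>
  needs the layers. The total masses agree, so applying it to \<open>1 - f\<close> gives the reverse
  inequality, and a bounded \<open>f\<close> is rescaled affinely into the unit interval.\<close>

theorem daniell_representation:
  obtains M where "space M = UNIV" "sets M = sigma_sets UNIV {{x. 0 < f x} |f. f \<in> V}"
    "finite_measure M" "\<And>f. f \<in> V \<Longrightarrow> integrable M f \<and> (\<integral>x. f x \<partial>M) = l f"
proof -
  define E where "E = {{x. 0 < f x} |f. f \<in> V}"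
  \<comment> \<open>The outer measure is restricted to the generated sigma-algebra and not to its
    whole lambda system, because later \<open>sets M\<close> has to be exactly the product
    sigma-algebra.\<close>
  define M where "M = measure_of UNIV (sigma_sets UNIV E) outer"
  have ms: "measure_space UNIV (lambda_system UNIV (Pow UNIV) outer) outer"
    using sigma_algebra.caratheodory_lemma[OF sigma_algebra_Pow outer_measure_space_outer] .
  have sa: "sigma_algebra UNIV (sigma_sets UNIV E)" by (rule sigma_algebra_sigma_sets) simp
  have "sigma_sets UNIV E \<subseteq> lambda_system UNIV (Pow UNIV) outer"
    using ms positivity_set_lambda_system unfolding measure_space_def E_def
    by (intro sigma_algebra.sigma_sets_subset) auto
  then have "measure_space UNIV (sigma_sets UNIV E) outer"
    by (rule measure_down[OF ms sa])
  then have em: "emeasure M A = outer A" if "A \<in> sigma_sets UNIV E" for A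
    unfolding M_def measure_space_def using that by (intro emeasure_measure_of_sigma) auto
  have sets_M: "sets M = sigma_sets UNIV E"
    unfolding M_def by (rule sigma_algebra.sets_measure_of_eq[OF sa])
  have space_M: "space M = UNIV" unfolding M_def by (simp add: space_measure_of_conv)
  have UNIV_in: "UNIV \<in> sigma_sets UNIV E" by (metis sigma_sets_top)
  have fin: "finite_measure M"
    using em[OF UNIV_in] outer_finite by (intro finite_measureI) (simp add: space_M)
  interpret finite_measure M by (rule fin)
  have meas: "f \<in> borel_measurable M" if "f \<in> V" for f
  proof (rule borel_measurableI_greater)
    fix c
    have "(\<lambda>x. f x - c) \<in> V" by (rule diff[OF that const])
    then have "{x. 0 < f x - c} \<in> E"
      unfolding E_def by (intro CollectI exI[of _ "\<lambda>x. f x - c"]) simp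
    then show "{x \<in> space M. c < f x} \<in> sets M" by (auto simp: sets_M space_M)
  qed
  have int: "integrable M f" if f: "f \<in> V" for f
  proof -
    obtain B where "\<forall>x. \<bar>f x\<bar> \<le> B" using bounded[OF f] by blast
    then show ?thesis by (intro integrable_const_bound[of _ B] meas f) auto
  qed
  have "emeasure M UNIV = ennreal (l (\<lambda>x. 1))"
    unfolding em[OF UNIV_in] by (intro antisym outer_le le_outer one) auto
  then have mass: "measure M UNIV = l (\<lambda>x. 1)"
    using nonneg[OF one] by (simp add: measure_def)
  have le: "l f \<le> (\<integral>x. f x \<partial>M)" if f: "f \<in> V" and f01: "\<And>x. 0 \<le> f x" "\<And>x. f x \<le> 1" for f
  proof -
    have "l f \<le> (\<integral>x. f x \<partial>M) + measure M UNIV / real (Suc n)" for n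
    proof -
      define d where "d = 1 / real (Suc n)"
      have d: "d > 0" "real (Suc n) * d = 1" by (auto simp: d_def)
      define s where "s = (\<lambda>k x. min d (max 0 (f x - real k * d)))"
      define A where "A = (\<lambda>k. {x. real k * d < f x})"
      have sV: "s k \<in> V" for k unfolding s_def by (intro min pos diff const f)
      have A: "A k \<in> sets M" for k
        using measurable_sets[OF meas[OF f], of "{real k * d<..}"]
        by (simp add: A_def space_M vimage_def)
      have slice: "l (s k) \<le> d * measure M (A k)" for k
      proof -
        \<comment> \<open>The rescaled slice \<open>s k / d\<close> lies below the indicator of
          \<open>A k\<close>, as \<open>le_outer\<close> demands.\<close>
        have "ennreal (l (\<lambda>x. (1 / d) * s k x)) \<le> outer (A k)"
          by (intro le_outer scale sV) (use d in \<open>auto simp: s_def A_def indicator_def field_simps\<close>)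
        also have "\<dots> = ennreal (measure M (A k))"
          using em A by (simp add: sets_M emeasure_eq_measure flip: em)
        finally have "l (\<lambda>x. (1 / d) * s k x) \<le> measure M (A k)"
          by (simp add: ennreal_le_iff)
        then show ?thesis using d unfolding l_simps(2)[OF sV] by (simp add: field_simps)
      qed
      have "f = (\<lambda>x. \<Sum>k<Suc n. s k x)"
        unfolding s_def using slices(1)[OF f01(1) less_imp_le[OF d(1)], of _ "Suc n"] d(2) f01(2)
        by (intro ext) (simp only:, simp add: min_absorb2)
      then have "l f = (\<Sum>k<Suc n. l (s k))"
        using linear_functional_sum[OF linear, of "{..<Suc n}" s] sV by simp
      also have "\<dots> \<le> (\<Sum>k<Suc n. d * measure M (A k))"
        by (intro sum_mono slice)
      also have "\<dots> = (\<integral>x. (\<Sum>k<Suc n. d * indicator (A k) x) \<partial>M)"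
        using A by (subst Bochner_Integration.integral_sum) (auto simp: emeasure_eq_measure)
      also have "\<dots> \<le> (\<integral>x. f x + d \<partial>M)"
      proof (rule integral_mono)
        show "integrable M (\<lambda>x. \<Sum>k<Suc n. d * indicator (A k) x)"
          using A by (intro Bochner_Integration.integrable_sum) (auto simp: emeasure_eq_measure)
        show "integrable M (\<lambda>x. f x + d)" using int[OF f] by simp
        show "(\<Sum>k<Suc n. d * indicator (A k) x) \<le> f x + d" for x
          using slices(2)[OF f01(1) less_imp_le[OF d(1)], of x "Suc n"]
          by (simp add: A_def indicator_def of_bool_def)
      qed
      also have "\<dots> = (\<integral>x. f x \<partial>M) + measure M UNIV / real (Suc n)"
        using int[OF f] by (simp add: space_M d_def)
      finally show ?thesis .
    qed
    moreover have "(\<lambda>n. (\<integral>x. f x \<partial>M) + measure M UNIV / real (Suc n)) \<longlonglongrightarrow> (\<integral>x. f x \<partial>M) + 0"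
      by (intro tendsto_intros LIMSEQ_Suc lim_const_over_n)
    ultimately have "l f \<le> (\<integral>x. f x \<partial>M) + 0"
      by (intro LIMSEQ_le_const) auto
    then show ?thesis by simp
  qed
  have eq01: "(\<integral>x. f x \<partial>M) = l f" if f: "f \<in> V" and f01: "\<And>x. 0 \<le> f x" "\<And>x. f x \<le> 1" for f
  proof (rule antisym)
    have "l (\<lambda>x. 1 - f x) \<le> (\<integral>x. 1 - f x \<partial>M)"
      using f01 by (intro le diff one f) auto
    then show "(\<integral>x. f x \<partial>M) \<le> l f"
      using int[OF f] f one by (simp add: l_simps(4) mass space_M)
  qed (rule le[OF f f01])
  have "(\<integral>x. f x \<partial>M) = l f" if f: "f \<in> V" for f
  proof -
    obtain B0 where B0: "\<forall>x. \<bar>f x\<bar> \<le> B0" using bounded[OF f] by blast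
    \<comment> \<open>The extra 1 keeps \<open>B\<close> positive for the division by
      \<open>2 * B\<close>, also when \<open>f\<close> vanishes.\<close>
    define B where "B = B0 + 1"
    have B: "B > 0" "\<And>x. \<bar>f x\<bar> \<le> B"
      using B0 unfolding B_def by (auto intro: add_nonneg_pos add_increasing2 order_trans[OF abs_ge_zero])
    have "(\<integral>x. (1 / (2 * B)) * (f x + B) \<partial>M) = l (\<lambda>x. (1 / (2 * B)) * (f x + B))"
    proof (rule eq01)
      fix x show "0 \<le> 1 / (2 * B) * (f x + B)" "1 / (2 * B) * (f x + B) \<le> 1"
        using B(1) B(2)[of x] by (auto simp: field_simps)
    qed (intro scale add f const)
    also have "\<dots> = (1 / (2 * B)) * (l f + B * l (\<lambda>x. 1))"
      using f const[of B] add[OF f const] l_simps(2)[OF one, of B]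
      by (simp only: l_simps(1) l_simps(2)) simp
    also have "(\<integral>x. (1 / (2 * B)) * (f x + B) \<partial>M) = (1 / (2 * B)) * ((\<integral>x. f x \<partial>M) + B * l (\<lambda>x. 1))"
      using int[OF f] by (simp add: space_M mass)
    finally show ?thesis using B(1) by simp
  qed
  then show thesis
    using that[of M] space_M sets_M fin int unfolding E_def by blast
qed

end

section \<open>Compact random dynamical systems\<close>

lemma compact_UNIV_countable_dense:
  assumes "compact (UNIV :: 'a::metric_space set)"
  shows "\<exists>D :: 'a set. countable D \<and> D \<noteq> {} \<and> (\<forall>x. \<forall>e>0. \<exists>d\<in>D. dist d x < e)"
proof -
  have "\<exists>k. finite k \<and> (UNIV :: 'a set) \<subseteq> (\<Union>x\<in>k. ball x (1 / real (Suc n)))" for n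
    using assms unfolding compact_eq_totally_bounded by auto
  then obtain k where k: "\<And>n. finite (k n)" "\<And>n. (UNIV :: 'a set) \<subseteq> (\<Union>x\<in>k n. ball x (1 / real (Suc n)))"
    by metis
  have dense: "\<exists>d\<in>(\<Union>n. k n). dist d x < e" if e: "e > 0" for x :: 'a and e
  proof -
    obtain n where n: "inverse (real (Suc n)) < e" using reals_Archimedean[OF e] by blast
    have "x \<in> (\<Union>x\<in>k n. ball x (1 / real (Suc n)))" using k(2) by blast
    then obtain d where "d \<in> k n" "dist d x < 1 / real (Suc n)" by (auto simp del: of_nat_Suc)
    then have "d \<in> (\<Union>n. k n)" "dist d x < e" using n by (auto simp: inverse_eq_divide)
    then show ?thesis by blast
  qed
  moreover have "countable (\<Union>n. k n)" using k(1) by (simp add: countable_finite)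
  moreover have "(\<Union>n. k n) \<noteq> {}" using dense[of 1 undefined] by auto
  ultimately show ?thesis by blast
qed

text \<open>Finite separated sets of any cardinality will be encoded as sequences, so that a single
  compact metric space contains all candidates.\<close>

lemma compact_UNIV_fun:
  assumes "compact (UNIV :: 'a::metric_space set)"
  shows "compact (UNIV :: (nat \<Rightarrow> 'a) set)"
  using assms compact_space_product_topology[of "\<lambda>i::nat. euclidean :: 'a topology" UNIV]
  by (simp add: euclidean_product_topology compact_space_def)

lemma dense_approx:
  fixes g :: "'a::metric_space \<Rightarrow> real"
  assumes D: "\<forall>x. \<forall>e>0. \<exists>d\<in>D. dist d x < e"
    and g: "continuous_on UNIV g" and e: "e > 0"
  shows "\<exists>d\<in>D. \<bar>g d - g x\<bar> < e"
proof -
  obtain \<delta> where \<delta>: "\<delta> > 0" "\<And>y. dist y x < \<delta> \<Longrightarrow> dist (g y) (g x) < e"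
    using g e unfolding continuous_on_iff by blast
  obtain d where "d \<in> D" "dist d x < \<delta>" using D \<delta>(1) by blast
  then show ?thesis using \<delta>(2)[of d] by (auto simp: dist_real_def)
qed

text \<open>A projection theorem for zero sets of Caratheodory functions. Compactness lets the
  existence of a zero be tested by approximate zeros in a countable dense set.\<close>

lemma sets_Collect_ex_zero:
  fixes \<phi> :: "'w \<Rightarrow> 'y::metric_space \<Rightarrow> real"
  assumes K: "compact (UNIV :: 'y set)"
    and cont: "\<And>\<omega>. \<omega> \<in> space M \<Longrightarrow> continuous_on UNIV (\<phi> \<omega>)"
    and meas: "\<And>y. (\<lambda>\<omega>. \<phi> \<omega> y) \<in> borel_measurable M"
    and nonneg: "\<And>\<omega> y. 0 \<le> \<phi> \<omega> y"
  shows "{\<omega>\<in>space M. \<exists>y. \<phi> \<omega> y = 0} \<in> sets M"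
proof -
  obtain D :: "'y set" where D: "countable D" "D \<noteq> {}" "\<forall>x. \<forall>e>0. \<exists>d\<in>D. dist d x < e"
    using compact_UNIV_countable_dense[OF K] by blast
  have "(\<exists>y. \<phi> \<omega> y = 0) \<longleftrightarrow> (\<forall>n. \<exists>d\<in>D. \<phi> \<omega> d < 1 / real (Suc n))" if \<omega>: "\<omega> \<in> space M" for \<omega>
  proof
    assume "\<exists>y. \<phi> \<omega> y = 0"
    then obtain y where "\<phi> \<omega> y = 0" by blast
    show "\<forall>n. \<exists>d\<in>D. \<phi> \<omega> d < 1 / real (Suc n)"
    proof
      fix n
      obtain d where "d \<in> D" "\<bar>\<phi> \<omega> d - \<phi> \<omega> y\<bar> < 1 / real (Suc n)"
        using dense_approx[where e = "1 / real (Suc n)" and x = y, OF D(3) cont[OF \<omega>]] by auto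
      then show "\<exists>d\<in>D. \<phi> \<omega> d < 1 / real (Suc n)"
        using \<open>\<phi> \<omega> y = 0\<close> by (intro bexI[of _ d]) linarith+
    qed
  next
    assume approx: "\<forall>n. \<exists>d\<in>D. \<phi> \<omega> d < 1 / real (Suc n)"
    obtain y where y: "\<And>z. \<phi> \<omega> y \<le> \<phi> \<omega> z"
      using continuous_attains_inf[OF K UNIV_not_empty cont[OF \<omega>]] by blast
    have "\<phi> \<omega> y \<le> 0"
    proof (rule ccontr)
      assume "\<not> \<phi> \<omega> y \<le> 0"
      then obtain n where n: "inverse (real (Suc n)) < \<phi> \<omega> y"
        using reals_Archimedean[of "\<phi> \<omega> y"] by (auto simp: not_le)
      obtain d where "\<phi> \<omega> d < 1 / real (Suc n)" using approx by blast
      then show False using n y[of d] unfolding inverse_eq_divide by linarith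
    qed
    then show "\<exists>y. \<phi> \<omega> y = 0" using nonneg[of \<omega> y] by (intro exI[of _ y]) simp
  qed
  then have "{\<omega>\<in>space M. \<exists>y. \<phi> \<omega> y = 0} = (\<Inter>n. \<Union>d\<in>D. {\<omega>\<in>space M. \<phi> \<omega> d < 1 / real (Suc n)})"
    by auto
  also have "\<dots> \<in> sets M"
  proof (intro sets.countable_INT sets.countable_UN' D(1) image_subsetI)
    fix n d
    show "{\<omega>\<in>space M. \<phi> \<omega> d < 1 / real (Suc n)} \<in> sets M"
      using meas[of d] by measurable
  qed simp
  finally show ?thesis .
qed

text \<open>By the triangle inequality \<open>dist x y\<close> is the supremum of
  \<open>dist d x - dist d y\<close> over a countable dense set of points \<open>d\<close>, and each
  of these differences involves one argument at a time.\<close>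

lemma borel_measurable_dist_compact:
  fixes f g :: "'w \<Rightarrow> 'a::metric_space"
  assumes K: "compact (UNIV :: 'a set)"
    and f: "f \<in> borel_measurable M" and g: "g \<in> borel_measurable M"
  shows "(\<lambda>\<omega>. dist (f \<omega>) (g \<omega>)) \<in> borel_measurable M"
proof -
  obtain D :: "'a set" where D: "countable D" "D \<noteq> {}" "\<forall>x. \<forall>e>0. \<exists>d\<in>D. dist d x < e"
    using compact_UNIV_countable_dense[OF K] by blast
  have meas: "(\<lambda>\<omega>. dist d (h \<omega>)) \<in> borel_measurable M" if "h \<in> borel_measurable M" for d h
    by (rule borel_measurable_continuous_on[OF _ that]) (intro continuous_intros)
  show ?thesis
  proof (rule borel_measurableI_greater)
    fix c
    have "c < dist x y \<longleftrightarrow> (\<exists>d\<in>D. c < dist d x - dist d y)" for x y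
    proof
      assume "c < dist x y"
      then obtain d where "d \<in> D" "dist d y < (dist x y - c) / 2"
        using D(3)[rule_format, of "(dist x y - c) / 2" y] by auto
      moreover have "dist x y \<le> dist d x + dist d y" by (rule dist_triangle3)
      ultimately show "\<exists>d\<in>D. c < dist d x - dist d y"
        by (intro bexI[of _ d]) (auto simp: field_simps)
    next
      assume "\<exists>d\<in>D. c < dist d x - dist d y"
      then obtain d where "c < dist d x - dist d y" by blast
      moreover have "dist d x \<le> dist d y + dist x y"
        by (metis dist_commute dist_triangle)
      ultimately show "c < dist x y" by simp
    qed
    then have "{\<omega> \<in> space M. c < dist (f \<omega>) (g \<omega>)}
        = (\<Union>d\<in>D. {\<omega> \<in> space M. c < dist d (f \<omega>) - dist d (g \<omega>)})" by auto
    also have "\<dots> \<in> sets M"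
    proof (intro sets.countable_UN' D(1) image_subsetI)
      fix d
      show "{\<omega> \<in> space M. c < dist d (f \<omega>) - dist d (g \<omega>)} \<in> sets M"
        using meas[OF f, of d] meas[OF g, of d] by measurable
    qed
    finally show "{\<omega> \<in> space M. c < dist (f \<omega>) (g \<omega>)} \<in> sets M" .
  qed
qed

locale compact_rds = random_dynamical_system P \<theta> T
  for P :: "'w measure" and \<theta> and T :: "'w \<Rightarrow> 'x::metric_space \<Rightarrow> 'x" +
  assumes compact_fibre: "compact (UNIV :: 'x set)"
    and space_UNIV: "space P = UNIV"
begin

abbreviation "iter \<equiv> rds_iter \<theta> T"
abbreviation "L1 \<equiv> L1_fibre_continuous P :: ('w \<times> 'x \<Rightarrow> real) set"

section \<open>Iterates and invariance of the base measure\<close>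

lemma theta_pow_measurable [measurable]: "\<theta> ^^ n \<in> P \<rightarrow>\<^sub>M P"
proof (induction n)
  case (Suc n)
  then show ?case using measurable_comp[OF Suc base_measurable] by (simp add: comp_def)
qed (simp add: id_def)

lemma distr_theta_pow: "distr P P (\<theta> ^^ n) = P"
proof (induction n)
  case (Suc n)
  have "distr P P (\<theta> ^^ Suc n) = distr (distr P P (\<theta> ^^ n)) P \<theta>"
    by (simp add: distr_distr base_measurable)
  then show ?case using Suc base_preserving by (simp add: comp_def)
qed (simp add: distr_id2 id_def)

lemma integral_theta_pow:
  fixes g :: "'w \<Rightarrow> real"
  assumes "integrable P g"
  shows "integrable P (\<lambda>\<omega>. g ((\<theta> ^^ n) \<omega>))" "(\<integral>\<omega>. g ((\<theta> ^^ n) \<omega>) \<partial>P) = (\<integral>\<omega>. g \<omega> \<partial>P)"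
proof -
  have g: "g \<in> borel_measurable P" using assms by simp
  show "integrable P (\<lambda>\<omega>. g ((\<theta> ^^ n) \<omega>))"
    using integrable_distr_eq[OF theta_pow_measurable g, of n] assms distr_theta_pow by simp
  show "(\<integral>\<omega>. g ((\<theta> ^^ n) \<omega>) \<partial>P) = (\<integral>\<omega>. g \<omega> \<partial>P)"
    using integral_distr[OF theta_pow_measurable g, of n] distr_theta_pow by simp
qed

lemma iter_measurable:
  assumes [measurable]: "f \<in> N \<rightarrow>\<^sub>M P" "g \<in> N \<rightarrow>\<^sub>M borel"
  shows "(\<lambda>z. iter n (f z) (g z)) \<in> N \<rightarrow>\<^sub>M borel"
proof (induction n)
  case (Suc n)
  have "(\<lambda>z. ((\<theta> ^^ n) (f z), iter n (f z) (g z))) \<in> N \<rightarrow>\<^sub>M P \<Otimes>\<^sub>M borel"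
    using Suc by measurable
  from measurable_compose[OF this fibre_measurable] show ?case by simp
qed simp

lemma iter_continuous: "continuous_on UNIV (iter n \<omega>)"
proof (induction n)
  case (Suc n)
  have "continuous_on UNIV (T ((\<theta> ^^ n) \<omega>))" by (rule fibre_continuous) (simp add: space_UNIV)
  from continuous_on_compose2[OF this Suc] show ?case by (simp add: comp_def)
qed simp

lemma iter_continuous_compose [continuous_intros]:
  "continuous_on A g \<Longrightarrow> continuous_on A (\<lambda>y. iter n \<omega> (g y))"
  by (rule continuous_on_compose2[OF iter_continuous]) auto

section \<open>Potentials and their fibre norms\<close>

lemma L1_measurable: "f \<in> L1 \<Longrightarrow> f \<in> borel_measurable (P \<Otimes>\<^sub>M borel)"
  by (simp add: L1_fibre_continuous_def)

lemma L1_continuous: "f \<in> L1 \<Longrightarrow> continuous_on UNIV (\<lambda>x. f (\<omega>, x))"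
  by (simp add: L1_fibre_continuous_def space_UNIV)

definition fibre_norm :: "('w \<times> 'x \<Rightarrow> real) \<Rightarrow> 'w \<Rightarrow> real" where
  "fibre_norm f \<omega> = (SUP x. \<bar>f (\<omega>, x)\<bar>)"

lemma bdd_above_fibre:
  assumes "continuous_on UNIV (\<lambda>x :: 'x. f (\<omega>, x) :: real)"
  shows "bdd_above (range (\<lambda>x. \<bar>f (\<omega>, x)\<bar>))"
  using compact_continuous_image[OF continuous_on_rabs[OF assms] compact_fibre]
  by (intro bounded_imp_bdd_above compact_imp_bounded)

text \<open>By continuity the supremum exceeds \<open>c\<close> as soon as the function does so at a
  point of a countable dense set.\<close>

lemma fibre_norm_measurable:
  assumes f: "f \<in> borel_measurable (P \<Otimes>\<^sub>M borel)"
    and cont: "\<And>\<omega>. continuous_on UNIV (\<lambda>x :: 'x. f (\<omega>, x))"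
  shows "fibre_norm f \<in> borel_measurable P"
proof (rule borel_measurableI_greater)
  fix c
  obtain D :: "'x set" where D: "countable D" "D \<noteq> {}" "\<forall>x. \<forall>e>0. \<exists>d\<in>D. dist d x < e"
    using compact_UNIV_countable_dense[OF compact_fibre] by blast
  have "c < fibre_norm f \<omega> \<longleftrightarrow> (\<exists>d\<in>D. c < \<bar>f (\<omega>, d)\<bar>)" for \<omega>
  proof -
    have "c < fibre_norm f \<omega> \<longleftrightarrow> (\<exists>x. c < \<bar>f (\<omega>, x)\<bar>)"
      unfolding fibre_norm_def by (subst less_cSUP_iff) (use bdd_above_fibre[OF cont] in auto)
    also have "\<dots> \<longleftrightarrow> (\<exists>d\<in>D. c < \<bar>f (\<omega>, d)\<bar>)"
    proof
      assume "\<exists>x. c < \<bar>f (\<omega>, x)\<bar>"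
      then obtain x where x: "c < \<bar>f (\<omega>, x)\<bar>" by blast
      obtain d where "d \<in> D" "\<bar>\<bar>f (\<omega>, d)\<bar> - \<bar>f (\<omega>, x)\<bar>\<bar> < \<bar>f (\<omega>, x)\<bar> - c"
        using dense_approx[where e = "\<bar>f (\<omega>, x)\<bar> - c" and x = x, OF D(3) continuous_on_rabs[OF cont]] x
        by auto
      then show "\<exists>d\<in>D. c < \<bar>f (\<omega>, d)\<bar>" by (intro bexI[of _ d]) auto
    qed blast
    finally show ?thesis .
  qed
  then have "{\<omega> \<in> space P. c < fibre_norm f \<omega>} = (\<Union>d\<in>D. {\<omega> \<in> space P. c < \<bar>f (\<omega>, d)\<bar>})" by auto
  also have "\<dots> \<in> sets P"
  proof (intro sets.countable_UN' D(1) image_subsetI)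
    fix d
    have "(\<lambda>\<omega>. f (\<omega>, d)) \<in> borel_measurable P"
      using measurable_compose[OF _ f, of "\<lambda>\<omega>. (\<omega>, d)" P] by simp
    then show "{\<omega> \<in> space P. c < \<bar>f (\<omega>, d)\<bar>} \<in> sets P" by measurable
  qed
  finally show "{\<omega> \<in> space P. c < fibre_norm f \<omega>} \<in> sets P" .
qed

lemma ennreal_fibre_norm:
  assumes "continuous_on UNIV (\<lambda>x :: 'x. f (\<omega>, x))"
  shows "ennreal (fibre_norm f \<omega>) = (SUP x. ennreal \<bar>f (\<omega>, x)\<bar>)"
proof (rule antisym)
  obtain x where x: "\<And>y. \<bar>f (\<omega>, y)\<bar> \<le> \<bar>f (\<omega>, x)\<bar>"
    using continuous_attains_sup[OF compact_fibre _ continuous_on_rabs[OF assms]] by auto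
  then have "fibre_norm f \<omega> \<le> \<bar>f (\<omega>, x)\<bar>"
    unfolding fibre_norm_def by (intro cSUP_least) auto
  then show "ennreal (fibre_norm f \<omega>) \<le> (SUP x. ennreal \<bar>f (\<omega>, x)\<bar>)"
    by (intro SUP_upper2[of x]) (auto intro: ennreal_leI)
  show "(SUP x. ennreal \<bar>f (\<omega>, x)\<bar>) \<le> ennreal (fibre_norm f \<omega>)"
    unfolding fibre_norm_def
    by (intro SUP_least ennreal_leI cSUP_upper bdd_above_fibre assms) simp
qed

lemma fibre_norm_upper:
  "f \<in> L1 \<Longrightarrow> \<bar>f (\<omega>, x)\<bar> \<le> fibre_norm f \<omega>"
  unfolding fibre_norm_def by (intro cSUP_upper bdd_above_fibre L1_continuous) auto

lemma fibre_norm_nonneg: "f \<in> L1 \<Longrightarrow> 0 \<le> fibre_norm f \<omega>"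
  using fibre_norm_upper[of f \<omega> undefined] by linarith

lemma fibre_norm_integrable:
  assumes "f \<in> L1" shows "integrable P (fibre_norm f)"
proof -
  have "(\<integral>\<^sup>+\<omega>. ennreal (fibre_norm f \<omega>) \<partial>P) < \<infinity>"
    using assms by (simp add: ennreal_fibre_norm L1_continuous) (simp add: L1_fibre_continuous_def)
  then show ?thesis
    using fibre_norm_measurable[OF L1_measurable[OF assms] L1_continuous[OF assms]]
      fibre_norm_nonneg[OF assms]
    by (intro integrableI_bounded) auto
qed

lemma L1I:
  assumes f: "f \<in> borel_measurable (P \<Otimes>\<^sub>M borel)"
    and cont: "\<And>\<omega>. continuous_on UNIV (\<lambda>x :: 'x. f (\<omega>, x))"
    and h: "integrable P h" "\<And>\<omega> x. \<bar>f (\<omega>, x)\<bar> \<le> h \<omega>"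
  shows "f \<in> L1"
proof -
  have "(\<integral>\<^sup>+\<omega>. (SUP x. ennreal \<bar>f (\<omega>, x)\<bar>) \<partial>P) \<le> (\<integral>\<^sup>+\<omega>. ennreal (norm (h \<omega>)) \<partial>P)"
    by (intro nn_integral_mono SUP_least ennreal_leI) (simp add: order_trans[OF h(2) abs_ge_self])
  also have "\<dots> < \<infinity>" using h(1) by (simp add: integrable_iff_bounded)
  finally show ?thesis using f cont by (simp add: L1_fibre_continuous_def)
qed

lemma L1_add:
  assumes f: "f \<in> L1" and g: "g \<in> L1"
  shows "(\<lambda>z. f z + g z) \<in> L1"
proof (rule L1I)
  show "(\<lambda>z. f z + g z) \<in> borel_measurable (P \<Otimes>\<^sub>M borel)"
    by (intro borel_measurable_add L1_measurable f g)
  show "continuous_on UNIV (\<lambda>x. f (\<omega>, x) + g (\<omega>, x))" for \<omega>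
    by (intro continuous_on_add L1_continuous f g)
  show "integrable P (\<lambda>\<omega>. fibre_norm f \<omega> + fibre_norm g \<omega>)"
    by (intro Bochner_Integration.integrable_add fibre_norm_integrable f g)
  show "\<bar>f (\<omega>, x) + g (\<omega>, x)\<bar> \<le> fibre_norm f \<omega> + fibre_norm g \<omega>" for \<omega> x
    using fibre_norm_upper[OF f, of \<omega> x] fibre_norm_upper[OF g, of \<omega> x] by linarith
qed

lemma L1_scale:
  assumes f: "f \<in> L1"
  shows "(\<lambda>z. c * f z) \<in> L1"
proof (rule L1I)
  show "(\<lambda>z. c * f z) \<in> borel_measurable (P \<Otimes>\<^sub>M borel)"
    by (intro borel_measurable_times borel_measurable_const L1_measurable f)
  show "continuous_on UNIV (\<lambda>x. c * f (\<omega>, x))" for \<omega>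
    by (intro continuous_on_mult continuous_on_const L1_continuous f)
  show "integrable P (\<lambda>\<omega>. \<bar>c\<bar> * fibre_norm f \<omega>)"
    by (intro integrable_mult_right fibre_norm_integrable f)
  show "\<bar>c * f (\<omega>, x)\<bar> \<le> \<bar>c\<bar> * fibre_norm f \<omega>" for \<omega> x
    by (simp add: abs_mult mult_left_mono fibre_norm_upper f)
qed

lemma L1_base:
  assumes "integrable P h" shows "(\<lambda>z. h (fst z)) \<in> L1"
  using assms by (intro L1I[of _ "\<lambda>\<omega>. \<bar>h \<omega>\<bar>"]) auto

lemma L1_zero: "(\<lambda>z. 0) \<in> L1"
  using L1_base[of "\<lambda>\<omega>. 0"] by simp

lemma L1_skew_product:
  assumes f: "f \<in> L1" shows "(\<lambda>z. f (skew_product \<theta> T z)) \<in> L1"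
proof (rule L1I)
  have "skew_product \<theta> T \<in> P \<Otimes>\<^sub>M borel \<rightarrow>\<^sub>M P \<Otimes>\<^sub>M borel"
    unfolding skew_product_def using base_measurable fibre_measurable by measurable
  from measurable_compose[OF this L1_measurable[OF f]]
  show "(\<lambda>z. f (skew_product \<theta> T z)) \<in> borel_measurable (P \<Otimes>\<^sub>M borel)" .
  show "continuous_on UNIV (\<lambda>x. f (skew_product \<theta> T (\<omega>, x)))" for \<omega>
    using continuous_on_compose2[OF L1_continuous[OF f, of "\<theta> \<omega>"] fibre_continuous[of \<omega>]]
    by (simp add: skew_product_def space_UNIV)
  show "integrable P (\<lambda>\<omega>. fibre_norm f (\<theta> \<omega>))"
    using integral_theta_pow(1)[OF fibre_norm_integrable[OF f], of 1] by simp
  show "\<bar>f (skew_product \<theta> T (\<omega>, x))\<bar> \<le> fibre_norm f (\<theta> \<omega>)" for \<omega> x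
    using fibre_norm_upper[OF f] by (simp add: skew_product_def)
qed

end

section \<open>Separated sums over preimages\<close>

lemma eintegral_eq_integral:
  assumes g: "integrable M g" and u: "AE \<omega> in M. u \<omega> = ereal (g \<omega>)"
  shows "eintegral M u = ereal (\<integral>\<omega>. g \<omega> \<partial>M)"
proof -
  have "(\<integral>\<^sup>+\<omega>. e2ennreal (u \<omega>) \<partial>M) = (\<integral>\<^sup>+\<omega>. ennreal (g \<omega>) \<partial>M)"
    by (rule nn_integral_cong_AE) (use u in eventually_elim, simp)
  moreover have "(\<integral>\<^sup>+\<omega>. e2ennreal (- u \<omega>) \<partial>M) = (\<integral>\<^sup>+\<omega>. ennreal (- g \<omega>) \<partial>M)"
    by (rule nn_integral_cong_AE) (use u in eventually_elim, simp)
  moreover obtain p where "0 \<le> p" "(\<integral>\<^sup>+\<omega>. ennreal (g \<omega>) \<partial>M) = ennreal p"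
    using integrableD(2)[OF g] by (cases "\<integral>\<^sup>+\<omega>. ennreal (g \<omega>) \<partial>M") auto
  moreover obtain q where "0 \<le> q" "(\<integral>\<^sup>+\<omega>. ennreal (- g \<omega>) \<partial>M) = ennreal q"
    using integrableD(3)[OF g] by (cases "\<integral>\<^sup>+\<omega>. ennreal (- g \<omega>) \<partial>M") auto
  ultimately show ?thesis
    using real_lebesgue_integral_def[OF g] by (simp add: eintegral_def enn2ereal_ennreal)
qed

text \<open>The integrable bound \<open>h\<close> keeps the positive part finite, so the infinite
  negative part caused by \<open>A\<close> decides the difference.\<close>

lemma eintegral_eq_minus_infinity:
  assumes h: "integrable M h" and u: "\<And>\<omega>. \<omega> \<in> space M \<Longrightarrow> u \<omega> \<le> ereal (h \<omega>)"
    and A: "A \<in> sets M" "emeasure M A > 0" "\<And>\<omega>. \<omega> \<in> A \<Longrightarrow> u \<omega> = -\<infinity>"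
  shows "eintegral M u = -\<infinity>"
proof -
  have "(\<integral>\<^sup>+\<omega>. e2ennreal (u \<omega>) \<partial>M) \<le> (\<integral>\<^sup>+\<omega>. ennreal (h \<omega>) \<partial>M)"
    using u by (intro nn_integral_mono) (metis e2ennreal_ereal e2ennreal_mono)
  also have "\<dots> < \<infinity>" using integrableD(2)[OF h] by (simp add: less_top)
  finally obtain p where "0 \<le> p" "(\<integral>\<^sup>+\<omega>. e2ennreal (u \<omega>) \<partial>M) = ennreal p"
    by (cases "\<integral>\<^sup>+\<omega>. e2ennreal (u \<omega>) \<partial>M") auto
  moreover have "(\<integral>\<^sup>+\<omega>. e2ennreal (- u \<omega>) \<partial>M) = \<infinity>"
  proof -
    have "\<infinity> = (\<integral>\<^sup>+\<omega>. \<infinity> * indicator A \<omega> \<partial>M)"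
      using A by (subst nn_integral_cmult_indicator) (auto simp: ennreal_top_mult)
    also have "\<dots> \<le> (\<integral>\<^sup>+\<omega>. e2ennreal (- u \<omega>) \<partial>M)"
      using A(3) by (intro nn_integral_mono) (auto simp: indicator_def e2ennreal_infty)
    finally show ?thesis by (simp add: top_unique)
  qed
  ultimately show ?thesis by (simp add: eintegral_def enn2ereal_ennreal)
qed

lemma eintegral_mono:
  assumes "\<And>\<omega>. u \<omega> \<le> v \<omega>"
  shows "eintegral M u \<le> eintegral M v"
  unfolding eintegral_def
  by (intro ereal_minus_mono)
    (auto simp: less_eq_ennreal.rep_eq[symmetric] intro!: nn_integral_mono e2ennreal_mono assms)

lemma elog_mono:
  assumes "a \<le> b" shows "elog a \<le> elog b"
proof (cases "a = 0 \<or> b = \<infinity>")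
  case False
  then have "a \<noteq> \<infinity>" "b \<noteq> 0" using assms by (auto simp: top_unique)
  moreover have "0 < enn2real a" "enn2real a \<le> enn2real b"
    using False assms by (auto simp: enn2real_positive_iff less_top zero_less_iff_neq_zero intro: enn2real_mono)
  ultimately show ?thesis using False by (simp add: elog_def)
qed (auto simp: elog_def)

lemma mdim_of_mono:
  assumes "\<And>f \<epsilon>. Q f \<epsilon> \<le> Q' f \<epsilon>"
  shows "mdim_of Q f \<le> mdim_of Q' f"
  unfolding mdim_of_def
proof (rule Limsup_mono)
  have "\<forall>\<^sub>F \<epsilon> in at_right 0. \<epsilon> \<in> {0<..<1::real}" by (rule eventually_at_right_real) simp
  then show "\<forall>\<^sub>F \<epsilon> in at_right 0. Q (\<lambda>z. f z * ln (1 / \<epsilon>)) \<epsilon> / ereal (ln (1 / \<epsilon>))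
      \<le> Q' (\<lambda>z. f z * ln (1 / \<epsilon>)) \<epsilon> / ereal (ln (1 / \<epsilon>))"
    by eventually_elim (intro ereal_divide_right_mono assms, simp)
qed

context compact_rds
begin

lemma less_bowen_dist_iff:
  "n \<ge> 1 \<Longrightarrow> \<epsilon> < bowen_dist \<theta> T \<omega> n x y \<longleftrightarrow> (\<exists>p<n. \<epsilon> < dist (iter p \<omega> x) (iter p \<omega> y))"
  unfolding bowen_dist_def by (subst Max_gr_iff) (auto simp: lessThan_empty_iff)

text \<open>Points are coded by itineraries through an \<epsilon>/2-net: equal codes of length n
  force all n distances below \<epsilon>, so the code is injective on a separated set. The net is
  chosen before \<omega>, which makes the exponential rate uniform.\<close>

lemma card_separated:
  assumes "\<epsilon> > 0"
  obtains N :: nat where "N \<ge> 1"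
    "\<And>\<omega> n E F. n \<ge> 1 \<Longrightarrow> F \<in> separated_subsets \<theta> T \<omega> n \<epsilon> E \<Longrightarrow> finite F \<and> card F \<le> N ^ n"
proof -
  obtain C where C: "finite C" "(UNIV :: 'x set) \<subseteq> (\<Union>x\<in>C. ball x (\<epsilon> / 2))"
    using compact_fibre assms unfolding compact_eq_totally_bounded by (meson half_gt_zero)
  then have "\<forall>x. \<exists>c. c \<in> C \<and> dist c x < \<epsilon> / 2" by fastforce
  then obtain c where c: "\<And>x. c x \<in> C" "\<And>x. dist (c x) x < \<epsilon> / 2" by metis
  show thesis
  proof (rule that[of "card C"])
    show "card C \<ge> 1" using C(1) c(1) by (metis One_nat_def Suc_leI card_gt_0_iff empty_iff)
    fix \<omega> n E F
    assume n: "n \<ge> (1 :: nat)" and F: "F \<in> separated_subsets \<theta> T \<omega> n \<epsilon> E"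
    define code where "code = (\<lambda>y. \<lambda>p\<in>{..<n}. c (iter p \<omega> y))"
    have "inj_on code F"
    proof (rule inj_onI, rule ccontr)
      fix y z assume yz: "y \<in> F" "z \<in> F" "code y = code z" "y \<noteq> z"
      then obtain p where p: "p < n" "\<epsilon> < dist (iter p \<omega> y) (iter p \<omega> z)"
        using F less_bowen_dist_iff[OF n] unfolding separated_subsets_def by blast
      have "c (iter p \<omega> y) = c (iter p \<omega> z)"
        using fun_cong[OF yz(3), of p] p(1) by (simp add: code_def)
      then have "dist (iter p \<omega> y) (iter p \<omega> z) < \<epsilon>"
        using c(2)[of "iter p \<omega> y"] c(2)[of "iter p \<omega> z"] dist_triangle3[of "iter p \<omega> y" "iter p \<omega> z" "c (iter p \<omega> z)"]
        by simp
      then show False using p(2) by simp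
    qed
    moreover have "code ` F \<subseteq> (\<Pi>\<^sub>E p\<in>{..<n}. C)"
      unfolding code_def using c(1) by (simp add: image_subset_iff restrict_PiE_iff)
    moreover have "finite (\<Pi>\<^sub>E p\<in>{..<n}. C)" using C(1) by (simp add: finite_PiE)
    moreover have "card (\<Pi>\<^sub>E p\<in>{..<n}. C) = card C ^ n" by (simp add: card_PiE)
    ultimately show "finite F \<and> card F \<le> card C ^ n"
      by (metis card_inj_on_le inj_on_finite)
  qed
qed

abbreviation "bsum \<equiv> birkhoff_sum \<theta> T"

definition norm_sum :: "('w \<times> 'x \<Rightarrow> real) \<Rightarrow> nat \<Rightarrow> 'w \<Rightarrow> real" where
  "norm_sum f n \<omega> = (\<Sum>j<n. fibre_norm f ((\<theta> ^^ j) \<omega>))"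

lemma norm_sum_integrable: "f \<in> L1 \<Longrightarrow> integrable P (norm_sum f n)"
  unfolding norm_sum_def by (intro Bochner_Integration.integrable_sum integral_theta_pow fibre_norm_integrable)

lemma abs_bsum_le:
  assumes "f \<in> L1" shows "\<bar>bsum f n \<omega> y\<bar> \<le> norm_sum f n \<omega>"
  unfolding birkhoff_sum_def norm_sum_def
  by (rule order_trans[OF sum_abs]) (intro sum_mono fibre_norm_upper assms)

lemma bsum_measurable: "f \<in> L1 \<Longrightarrow> (\<lambda>\<omega>. bsum f n \<omega> y) \<in> borel_measurable P"
  unfolding birkhoff_sum_def
  by (intro borel_measurable_sum measurable_compose[OF _ L1_measurable] measurable_Pair
      theta_pow_measurable iter_measurable measurable_ident_sets measurable_const) auto

lemma bsum_continuous: "f \<in> L1 \<Longrightarrow> continuous_on UNIV (bsum f n \<omega>)"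
  unfolding birkhoff_sum_def
  by (intro continuous_on_sum continuous_on_compose2[OF L1_continuous iter_continuous]) auto

text \<open>A set of targets serves all variants: \<open>UNIV\<close> puts the supremum over x under
  the logarithm, and a singleton fixes x.\<close>

definition target_sum :: "'x set \<Rightarrow> ('w \<times> 'x \<Rightarrow> real) \<Rightarrow> nat \<Rightarrow> real \<Rightarrow> nat \<Rightarrow> 'w \<Rightarrow> ennreal" where
  "target_sum Y f n \<epsilon> k \<omega> = (SUP x\<in>Y. fibre_sum \<theta> T f \<omega> n \<epsilon> k x)"

lemma target_sum_leI:
  assumes "n \<ge> 1" "\<epsilon> > 0"
    and "\<And>x F. x \<in> Y \<Longrightarrow> finite F \<Longrightarrow> F \<in> separated_subsets \<theta> T \<omega> n \<epsilon> (iter k \<omega> -` {x}) \<Longrightarrow>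
      (\<Sum>y\<in>F. exp (bsum f n \<omega> y)) \<le> c"
  shows "target_sum Y f n \<epsilon> k \<omega> \<le> ennreal c"
  unfolding target_sum_def fibre_sum_def
proof (intro SUP_least)
  fix x F assume "x \<in> Y" and F: "F \<in> separated_subsets \<theta> T \<omega> n \<epsilon> (iter k \<omega> -` {x})"
  have "finite F" using card_separated[OF assms(2)] assms(1) F by metis
  then show "(\<Sum>y\<in>F. ennreal (exp (bsum f n \<omega> y))) \<le> ennreal c"
    using assms(3)[OF \<open>x \<in> Y\<close> _ F] by (simp add: sum_ennreal ennreal_leI)
qed

lemma target_sum_upper:
  assumes "x \<in> Y" "F \<in> separated_subsets \<theta> T \<omega> n \<epsilon> (iter k \<omega> -` {x})"
  shows "ennreal (\<Sum>y\<in>F. exp (bsum f n \<omega> y)) \<le> target_sum Y f n \<epsilon> k \<omega>"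
proof -
  have "ennreal (\<Sum>y\<in>F. exp (bsum f n \<omega> y)) = (\<Sum>y\<in>F. ennreal (exp (bsum f n \<omega> y)))"
    by (simp add: sum_ennreal)
  also have "\<dots> \<le> target_sum Y f n \<epsilon> k \<omega>"
    unfolding target_sum_def fibre_sum_def by (intro SUP_upper2[OF assms(1)] SUP_upper2[OF assms(2)]) simp
  finally show ?thesis .
qed

lemma target_sum_le:
  assumes \<epsilon>: "\<epsilon> > 0"
  obtains N :: nat where "N \<ge> 1"
    "\<And>f n Y k \<omega>. f \<in> L1 \<Longrightarrow> n \<ge> 1 \<Longrightarrow> target_sum Y f n \<epsilon> k \<omega> \<le> ennreal (real N ^ n * exp (norm_sum f n \<omega>))"
proof -
  obtain N :: nat where N: "N \<ge> 1"
    "\<And>\<omega> n E F. n \<ge> 1 \<Longrightarrow> F \<in> separated_subsets \<theta> T \<omega> n \<epsilon> E \<Longrightarrow> finite F \<and> card F \<le> N ^ n"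
    using card_separated[OF \<epsilon>] by metis
  show thesis
  proof (rule that[OF N(1)])
    fix f n Y k \<omega> assume f: "f \<in> L1" and n: "n \<ge> (1 :: nat)"
    show "target_sum Y f n \<epsilon> k \<omega> \<le> ennreal (real N ^ n * exp (norm_sum f n \<omega>))"
    proof (rule target_sum_leI[OF n \<epsilon>])
      fix x F assume "F \<in> separated_subsets \<theta> T \<omega> n \<epsilon> (iter k \<omega> -` {x})"
      then have card: "real (card F) \<le> real N ^ n"
        using N(2)[OF n] by (metis of_nat_le_iff of_nat_power)
      have "(\<Sum>y\<in>F. exp (bsum f n \<omega> y)) \<le> (\<Sum>y\<in>F. exp (norm_sum f n \<omega>))"
        using abs_bsum_le[OF f, of n \<omega>] by (intro sum_mono) (auto dest: abs_le_D1)
      also have "\<dots> = real (card F) * exp (norm_sum f n \<omega>)" by simp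
      also have "\<dots> \<le> real N ^ n * exp (norm_sum f n \<omega>)" by (intro mult_right_mono card) simp
      finally show "(\<Sum>y\<in>F. exp (bsum f n \<omega> y)) \<le> real N ^ n * exp (norm_sum f n \<omega>)" .
    qed
  qed
qed

lemma target_sum_ge:
  assumes "iter k \<omega> y \<in> Y"
  shows "ennreal (exp (bsum f n \<omega> y)) \<le> target_sum Y f n \<epsilon> k \<omega>"
  using target_sum_upper[OF assms, of "{y}" \<omega> n \<epsilon> k f] by (simp add: separated_subsets_def)

lemma target_sum_empty:
  assumes "\<And>y. iter k \<omega> y \<notin> Y"
  shows "target_sum Y f n \<epsilon> k \<omega> = 0"
proof -
  have "F = {}" if "x \<in> Y" "F \<in> separated_subsets \<theta> T \<omega> n \<epsilon> (iter k \<omega> -` {x})" for x F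
    using assms that by (auto simp: separated_subsets_def)
  then have "target_sum Y f n \<epsilon> k \<omega> \<le> 0"
    unfolding target_sum_def fibre_sum_def by (intro SUP_least) fastforce
  then show ?thesis by simp
qed

text \<open>Real-valued, so that Bochner integrals apply. The value is meaningful only where some
  k-th iterate lies in \<open>Y\<close>; elsewhere the logarithm is -\<infinity>.\<close>

definition log_sum :: "'x set \<Rightarrow> ('w \<times> 'x \<Rightarrow> real) \<Rightarrow> nat \<Rightarrow> real \<Rightarrow> nat \<Rightarrow> 'w \<Rightarrow> real" where
  "log_sum Y f n \<epsilon> k \<omega> = ln (enn2real (target_sum Y f n \<epsilon> k \<omega>))"

lemma target_sum_eq_exp:
  assumes "f \<in> L1" "n \<ge> 1" "\<epsilon> > 0" "iter k \<omega> y \<in> Y"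
  shows "target_sum Y f n \<epsilon> k \<omega> = ennreal (exp (log_sum Y f n \<epsilon> k \<omega>))"
    and "elog (target_sum Y f n \<epsilon> k \<omega>) = ereal (log_sum Y f n \<epsilon> k \<omega>)"
proof -
  obtain N :: nat where "target_sum Y f n \<epsilon> k \<omega> \<le> ennreal (real N ^ n * exp (norm_sum f n \<omega>))"
    using target_sum_le[OF assms(3)] assms(1,2) by metis
  then have fin: "target_sum Y f n \<epsilon> k \<omega> < \<infinity>" by (rule le_less_trans) simp
  have pos: "0 < target_sum Y f n \<epsilon> k \<omega>"
    using target_sum_ge[OF assms(4)] by (rule less_le_trans[rotated]) simp
  then have "0 < enn2real (target_sum Y f n \<epsilon> k \<omega>)" using fin by (simp add: enn2real_positive_iff)
  then show "target_sum Y f n \<epsilon> k \<omega> = ennreal (exp (log_sum Y f n \<epsilon> k \<omega>))"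
    using fin by (simp add: log_sum_def)
  show "elog (target_sum Y f n \<epsilon> k \<omega>) = ereal (log_sum Y f n \<epsilon> k \<omega>)"
    using fin pos by (auto simp: elog_def log_sum_def)
qed

lemma elog_target_sum_empty:
  "(\<And>y. iter k \<omega> y \<notin> Y) \<Longrightarrow> elog (target_sum Y f n \<epsilon> k \<omega>) = -\<infinity>"
  by (simp add: target_sum_empty elog_def)

text \<open>Counting itineraries bounds the sum from above, and the one-point separated set
  \<open>{y}\<close> bounds it from below. Since \<open>N\<close> depends on \<epsilon> only, the
  right-hand side is an integrable majorant.\<close>

lemma log_sum_bounds:
  assumes "\<epsilon> > 0"
  obtains N :: nat where "N \<ge> 1"
    "\<And>f n Y k \<omega> y. f \<in> L1 \<Longrightarrow> n \<ge> 1 \<Longrightarrow> iter k \<omega> y \<in> Y \<Longrightarrow>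
      \<bar>log_sum Y f n \<epsilon> k \<omega>\<bar> \<le> real n * ln (real N) + norm_sum f n \<omega>"
proof -
  obtain N :: nat where N: "N \<ge> 1"
    "\<And>f n Y k \<omega>. f \<in> L1 \<Longrightarrow> n \<ge> 1 \<Longrightarrow> target_sum Y f n \<epsilon> k \<omega> \<le> ennreal (real N ^ n * exp (norm_sum f n \<omega>))"
    using target_sum_le[OF assms] by metis
  show thesis
  proof (rule that[OF N(1)])
    fix f n Y k \<omega> y assume a: "f \<in> L1" "n \<ge> (1 :: nat)" "iter k \<omega> y \<in> Y"
    note eq = target_sum_eq_exp(1)[OF a(1,2) assms a(3)]
    have "ennreal (exp (log_sum Y f n \<epsilon> k \<omega>)) \<le> ennreal (exp (real n * ln (real N) + norm_sum f n \<omega>))"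
      using N(2)[OF a(1,2), of Y k \<omega>] N(1) unfolding eq
      by (simp add: exp_add exp_of_nat_mult)
    moreover have "ennreal (exp (bsum f n \<omega> y)) \<le> ennreal (exp (log_sum Y f n \<epsilon> k \<omega>))"
      using target_sum_ge[OF a(3), of f n \<epsilon>] unfolding eq .
    moreover have "0 \<le> real n * ln (real N)" using N(1) by simp
    ultimately show "\<bar>log_sum Y f n \<epsilon> k \<omega>\<bar> \<le> real n * ln (real N) + norm_sum f n \<omega>"
      using abs_bsum_le[OF a(1), of n \<omega> y] by (simp add: ennreal_le_iff)
  qed
qed

text \<open>After normalisation by \<open>\<alpha> = ln \<Sum> exp (S\<^sub>n f)\<close> and \<open>\<beta> = ln \<Sum> exp (S\<^sub>n g)\<close>, Hoelder's
  inequality reduces to convexity of \<open>exp\<close> in each summand.\<close>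

lemma log_sum_convex:
  assumes fgh: "f \<in> L1" "g \<in> L1" "h \<in> L1" and n: "n \<ge> 1" and \<epsilon>: "\<epsilon> > 0" and y0: "iter k \<omega> y0 \<in> Y"
    and ts: "0 \<le> t" "0 \<le> s" "t + s = 1"
    and le: "\<And>y. bsum h n \<omega> y \<le> t * bsum f n \<omega> y + s * bsum g n \<omega> y + H"
  shows "log_sum Y h n \<epsilon> k \<omega> \<le> t * log_sum Y f n \<epsilon> k \<omega> + s * log_sum Y g n \<epsilon> k \<omega> + H"
proof -
  have t_eq: "t = 1 - s" using ts(3) by simp
  define \<alpha> \<beta> where "\<alpha> = log_sum Y f n \<epsilon> k \<omega>" and "\<beta> = log_sum Y g n \<epsilon> k \<omega>"
  note eq = target_sum_eq_exp(1)[OF _ n \<epsilon> y0]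
  have "target_sum Y h n \<epsilon> k \<omega> \<le> ennreal (exp (t * \<alpha> + s * \<beta> + H))"
  proof (rule target_sum_leI[OF n \<epsilon>])
    fix x F assume x: "x \<in> Y" and F: "F \<in> separated_subsets \<theta> T \<omega> n \<epsilon> (iter k \<omega> -` {x})"
    have A: "(\<Sum>y\<in>F. exp (bsum f n \<omega> y)) \<le> exp \<alpha>"
      using target_sum_upper[OF x F, of f] unfolding eq[OF fgh(1)] \<alpha>_def
      by (simp add: ennreal_le_iff)
    have B: "(\<Sum>y\<in>F. exp (bsum g n \<omega> y)) \<le> exp \<beta>"
      using target_sum_upper[OF x F, of g] unfolding eq[OF fgh(2)] \<beta>_def
      by (simp add: ennreal_le_iff)
    have "exp (bsum h n \<omega> y) \<le> exp (t * \<alpha> + s * \<beta> + H) *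
        (t * (exp (bsum f n \<omega> y) / exp \<alpha>) + s * (exp (bsum g n \<omega> y) / exp \<beta>))" for y
    proof -
      have "exp (bsum h n \<omega> y) \<le> exp ((t * \<alpha> + s * \<beta> + H) + (t * (bsum f n \<omega> y - \<alpha>) + s * (bsum g n \<omega> y - \<beta>)))"
        using le[of y] by (simp add: algebra_simps)
      also have "\<dots> = exp (t * \<alpha> + s * \<beta> + H) * exp (t * (bsum f n \<omega> y - \<alpha>) + s * (bsum g n \<omega> y - \<beta>))"
        by (rule exp_add)
      also have "exp (t * (bsum f n \<omega> y - \<alpha>) + s * (bsum g n \<omega> y - \<beta>))
          \<le> t * exp (bsum f n \<omega> y - \<alpha>) + s * exp (bsum g n \<omega> y - \<beta>)"
        using convex_onD[OF exp_convex, of s "bsum f n \<omega> y - \<alpha>" "bsum g n \<omega> y - \<beta>"] ts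
        unfolding t_eq by simp
      finally show ?thesis by (simp add: exp_diff)
    qed
    then have "(\<Sum>y\<in>F. exp (bsum h n \<omega> y)) \<le> (\<Sum>y\<in>F. exp (t * \<alpha> + s * \<beta> + H) *
        (t * (exp (bsum f n \<omega> y) / exp \<alpha>) + s * (exp (bsum g n \<omega> y) / exp \<beta>)))"
      by (rule sum_mono)
    also have "\<dots> = exp (t * \<alpha> + s * \<beta> + H) *
        (t * ((\<Sum>y\<in>F. exp (bsum f n \<omega> y)) / exp \<alpha>) + s * ((\<Sum>y\<in>F. exp (bsum g n \<omega> y)) / exp \<beta>))"
      by (simp add: sum_distrib_left sum.distrib sum_divide_distrib distrib_left)
    also have "\<dots> \<le> exp (t * \<alpha> + s * \<beta> + H) * (t * 1 + s * 1)"
      using A B ts by (intro mult_left_mono add_mono) (auto simp: divide_le_eq)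
    finally show "(\<Sum>y\<in>F. exp (bsum h n \<omega> y)) \<le> exp (t * \<alpha> + s * \<beta> + H)"
      using ts by simp
  qed
  then show ?thesis
    unfolding eq[OF fgh(3)] \<alpha>_def \<beta>_def by (simp add: ennreal_le_iff)
qed

section \<open>Measurability of the separated sums\<close>

definition separation_excess :: "nat \<Rightarrow> real \<Rightarrow> 'w \<Rightarrow> 'x \<Rightarrow> 'x \<Rightarrow> real" where
  "separation_excess n \<epsilon> \<omega> x y = (\<Sum>p<n. max 0 (dist (iter p \<omega> x) (iter p \<omega> y) - \<epsilon>))"

text \<open>Replaces the maximum in the Bowen distance by a sum of continuous nonnegative terms; its
  positive lower bounds turn strict separation into closed conditions.\<close>

lemma separation_excess_pos_iff:
  "n \<ge> 1 \<Longrightarrow> 0 < separation_excess n \<epsilon> \<omega> x y \<longleftrightarrow> \<epsilon> < bowen_dist \<theta> T \<omega> n x y"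
  unfolding separation_excess_def less_bowen_dist_iff
  by (subst less_le, subst eq_commute, subst sum_nonneg_eq_0_iff)
    (auto intro!: sum_nonneg simp: max_def not_le)

text \<open>\<open>\<phi>\<close> vanishes at \<open>y\<close> iff \<open>y m \<in> Y\<close>, the points \<open>y 0, \<dots>, y (m - 1)\<close> are \<open>k\<close>-th preimages of
  \<open>y m\<close>, and they satisfy the two strict conditions (separation, sum above \<open>a\<close>) with margin \<open>r\<close>.\<close>

lemma sets_Collect_witness:
  assumes f: "f \<in> L1" and Y: "closed Y"
  shows "{\<omega>\<in>space P. \<exists>y :: nat \<Rightarrow> 'x. (\<forall>i<m. iter k \<omega> (y i) = y m) \<and> infdist (y m) Y = 0 \<and>
    (\<forall>i<m. \<forall>j<m. i \<noteq> j \<longrightarrow> r \<le> separation_excess n \<epsilon> \<omega> (y i) (y j)) \<and>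
    a + r \<le> (\<Sum>i<m. exp (bsum f n \<omega> (y i)))} \<in> sets P"
proof -
  define \<phi> where "\<phi> = (\<lambda>\<omega> (y :: nat \<Rightarrow> 'x). (\<Sum>i<m. dist (iter k \<omega> (y i)) (y m)) + infdist (y m) Y
    + (\<Sum>i<m. \<Sum>j\<in>{..<m} - {i}. max 0 (r - separation_excess n \<epsilon> \<omega> (y i) (y j)))
    + max 0 (a + r - (\<Sum>i<m. exp (bsum f n \<omega> (y i)))))"
  have coord: "continuous_on UNIV (\<lambda>y :: nat \<Rightarrow> 'x. y i)" for i by simp
  have b_cont: "continuous_on UNIV (\<lambda>y :: nat \<Rightarrow> 'x. bsum f n \<omega> (y i))" for \<omega> i
    by (rule continuous_on_compose2[OF bsum_continuous[OF f] coord]) simp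
  have i_meas: "(\<lambda>\<omega>. iter p \<omega> x) \<in> P \<rightarrow>\<^sub>M borel" for p x
    by (rule iter_measurable) auto
  have d_meas: "(\<lambda>\<omega>. dist (iter p \<omega> x) (iter q \<omega> z)) \<in> borel_measurable P"
    "(\<lambda>\<omega>. dist (iter p \<omega> x) z) \<in> borel_measurable P" for p x q z
    by (intro borel_measurable_dist_compact[OF compact_fibre] i_meas borel_measurable_const)+
  have "{\<omega>\<in>space P. \<exists>y. \<phi> \<omega> y = 0} \<in> sets P"
  proof (rule sets_Collect_ex_zero[OF compact_UNIV_fun[OF compact_fibre]])
    show "continuous_on UNIV (\<phi> \<omega>)" for \<omega>
      unfolding \<phi>_def separation_excess_def
      by (intro continuous_intros coord b_cont iter_continuous_compose)
    show "(\<lambda>\<omega>. \<phi> \<omega> y) \<in> borel_measurable P" for y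
      unfolding \<phi>_def separation_excess_def
      by (intro borel_measurable_add borel_measurable_sum borel_measurable_max borel_measurable_diff
          borel_measurable_const d_meas borel_measurable_exp measurable_compose[OF bsum_measurable[OF f]])
    show "0 \<le> \<phi> \<omega> y" for \<omega> y
      unfolding \<phi>_def by (intro add_nonneg_nonneg sum_nonneg) (auto simp: infdist_nonneg)
  qed
  moreover have "\<phi> \<omega> y = 0 \<longleftrightarrow> (\<forall>i<m. iter k \<omega> (y i) = y m) \<and> infdist (y m) Y = 0 \<and>
    (\<forall>i<m. \<forall>j<m. i \<noteq> j \<longrightarrow> r \<le> separation_excess n \<epsilon> \<omega> (y i) (y j)) \<and>
    a + r \<le> (\<Sum>i<m. exp (bsum f n \<omega> (y i)))" for \<omega> y
  proof -
    have max0: "max 0 c = 0 \<longleftrightarrow> c \<le> 0" for c :: real by auto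
    have A: "(\<Sum>i<m. dist (iter k \<omega> (y i)) (y m)) = 0 \<longleftrightarrow> (\<forall>i<m. iter k \<omega> (y i) = y m)"
      by (subst sum_nonneg_eq_0_iff) auto
    have "(\<Sum>i<m. \<Sum>j\<in>{..<m} - {i}. max 0 (r - separation_excess n \<epsilon> \<omega> (y i) (y j))) = 0 \<longleftrightarrow>
      (\<forall>i\<in>{..<m}. (\<Sum>j\<in>{..<m} - {i}. max 0 (r - separation_excess n \<epsilon> \<omega> (y i) (y j))) = 0)"
      by (subst sum_nonneg_eq_0_iff) (auto intro!: sum_nonneg)
    also have "\<dots> \<longleftrightarrow> (\<forall>i\<in>{..<m}. \<forall>j\<in>{..<m} - {i}. max 0 (r - separation_excess n \<epsilon> \<omega> (y i) (y j)) = 0)"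
      by (intro ball_cong refl sum_nonneg_eq_0_iff) auto
    also have "\<dots> \<longleftrightarrow> (\<forall>i<m. \<forall>j<m. i \<noteq> j \<longrightarrow> r \<le> separation_excess n \<epsilon> \<omega> (y i) (y j))"
      unfolding max0 by auto
    finally have B: "(\<Sum>i<m. \<Sum>j\<in>{..<m} - {i}. max 0 (r - separation_excess n \<epsilon> \<omega> (y i) (y j))) = 0 \<longleftrightarrow>
      (\<forall>i<m. \<forall>j<m. i \<noteq> j \<longrightarrow> r \<le> separation_excess n \<epsilon> \<omega> (y i) (y j))" .
    have C: "max 0 (a + r - (\<Sum>i<m. exp (bsum f n \<omega> (y i)))) = 0 \<longleftrightarrow> a + r \<le> (\<Sum>i<m. exp (bsum f n \<omega> (y i)))"
      unfolding max0 by simp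
    have split: "w + x + z + v = 0 \<longleftrightarrow> w = 0 \<and> x = 0 \<and> z = 0 \<and> v = 0"
      if "0 \<le> w" "0 \<le> x" "0 \<le> z" "0 \<le> v" for w x z v :: real
      using that by linarith
    have "\<phi> \<omega> y = 0 \<longleftrightarrow> (\<Sum>i<m. dist (iter k \<omega> (y i)) (y m)) = 0 \<and> infdist (y m) Y = 0 \<and>
      (\<Sum>i<m. \<Sum>j\<in>{..<m} - {i}. max 0 (r - separation_excess n \<epsilon> \<omega> (y i) (y j))) = 0 \<and>
      max 0 (a + r - (\<Sum>i<m. exp (bsum f n \<omega> (y i)))) = 0"
      unfolding \<phi>_def by (rule split) (auto intro!: sum_nonneg simp: infdist_nonneg)
    then show ?thesis unfolding A B C .
  qed
  ultimately show ?thesis by simp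
qed

text \<open>Only finitely many strict inequalities are involved, so one margin
  \<open>1 / (q + 1)\<close> serves them all. With the margin fixed the conditions are closed, and
  \<omega> ranges over the sets of \<open>sets_Collect_witness\<close>, countably many in m and
  q.\<close>

lemma less_target_sum_iff:
  assumes n: "n \<ge> 1" and \<epsilon>: "\<epsilon> > 0" and Y: "closed Y" "Y \<noteq> {}" and a: "a \<ge> 0"
  shows "ennreal a < target_sum Y f n \<epsilon> k \<omega> \<longleftrightarrow>
    (\<exists>m q. \<exists>y :: nat \<Rightarrow> 'x. (\<forall>i<m. iter k \<omega> (y i) = y m) \<and> infdist (y m) Y = 0 \<and>
      (\<forall>i<m. \<forall>j<m. i \<noteq> j \<longrightarrow> inverse (real (Suc q)) \<le> separation_excess n \<epsilon> \<omega> (y i) (y j)) \<and>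
      a + inverse (real (Suc q)) \<le> (\<Sum>i<m. exp (bsum f n \<omega> (y i))))"
    (is "_ \<longleftrightarrow> (\<exists>m q y. ?W m q y)")
proof
  assume "ennreal a < target_sum Y f n \<epsilon> k \<omega>"
  then obtain x F where x: "x \<in> Y" and F: "F \<in> separated_subsets \<theta> T \<omega> n \<epsilon> (iter k \<omega> -` {x})"
    and less: "ennreal a < (\<Sum>y\<in>F. ennreal (exp (bsum f n \<omega> y)))"
    unfolding target_sum_def fibre_sum_def less_SUP_iff by blast
  have "finite F" using card_separated[OF \<epsilon>] n F by metis
  define m where "m = card F"
  obtain b where b: "bij_betw b {..<m} F"
    using ex_bij_betw_nat_finite[OF \<open>finite F\<close>] unfolding m_def lessThan_atLeast0 by blast
  \<comment> \<open>Coordinates below m enumerate \<open>F\<close>; coordinate m carries the target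
    point.\<close>
  define y where "y = (\<lambda>i. if i < m then b i else x)"
  have y: "y i \<in> F" if "i < m" for i using b that by (auto simp: y_def bij_betw_def)
  have "(\<Sum>y\<in>F. exp (bsum f n \<omega> y)) = (\<Sum>i<m. exp (bsum f n \<omega> (b i)))"
    using sum.reindex_bij_betw[OF b, of "\<lambda>z. exp (bsum f n \<omega> z)"] by simp
  also have "\<dots> = (\<Sum>i<m. exp (bsum f n \<omega> (y i)))" by (simp add: y_def)
  finally have "a < (\<Sum>i<m. exp (bsum f n \<omega> (y i)))"
    using less a by (simp add: sum_ennreal ennreal_less_iff)
  moreover have "0 < separation_excess n \<epsilon> \<omega> (y i) (y j)" if "i < m" "j < m" "i \<noteq> j" for i j
  proof -
    have "y i \<noteq> y j" using b that by (auto simp: y_def bij_betw_def inj_on_def)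
    then show ?thesis
      using F y that unfolding separation_excess_pos_iff[OF n] separated_subsets_def by blast
  qed
  moreover have small: "\<forall>\<^sub>F q in sequentially. inverse (real (Suc q)) \<le> c" if "0 < c" for c
    using order_tendstoD(2)[OF LIMSEQ_inverse_real_of_nat that] by eventually_elim simp
  ultimately have "\<forall>\<^sub>F q in sequentially. inverse (real (Suc q)) \<le> (\<Sum>i<m. exp (bsum f n \<omega> (y i))) - a \<and>
     (\<forall>i\<in>{..<m}. \<forall>j\<in>{..<m} - {i}. inverse (real (Suc q)) \<le> separation_excess n \<epsilon> \<omega> (y i) (y j))"
    by (intro eventually_conj eventually_ball_finite ballI small) auto
  then obtain q where "inverse (real (Suc q)) \<le> (\<Sum>i<m. exp (bsum f n \<omega> (y i))) - a"
     "\<forall>i\<in>{..<m}. \<forall>j\<in>{..<m} - {i}. inverse (real (Suc q)) \<le> separation_excess n \<epsilon> \<omega> (y i) (y j)"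
    by (auto simp: eventually_sequentially)
  moreover have "\<forall>i<m. iter k \<omega> (y i) = y m"
    using F y by (auto simp: separated_subsets_def y_def)
  moreover have "infdist (y m) Y = 0" using x by (simp add: y_def)
  ultimately have "?W m q y" by auto
  then show "\<exists>m q y. ?W m q y" by blast
next
  assume "\<exists>m q y. ?W m q y"
  then obtain m q y where W: "?W m q y" by blast
  have r: "0 < inverse (real (Suc q))" by simp
  have ym: "y m \<in> Y" using W in_closed_iff_infdist_zero[OF Y] by blast
  have sep: "\<epsilon> < bowen_dist \<theta> T \<omega> n (y i) (y j)" if "i < m" "j < m" "i \<noteq> j" for i j
    unfolding separation_excess_pos_iff[OF n, symmetric] using W that r by (meson less_le_trans)
  \<comment> \<open>A repeated point would have Bowen distance 0 to itself, contradicting separation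
    by \<epsilon> > 0; hence the sum over indices is the sum over the set.\<close>
  have inj: "inj_on y {..<m}"
  proof (rule inj_onI, rule ccontr)
    fix i j assume ij: "i \<in> {..<m}" "j \<in> {..<m}" "y i = y j" "i \<noteq> j"
    then have "\<epsilon> < bowen_dist \<theta> T \<omega> n (y i) (y i)" using sep[of i j] by simp
    then show False using \<epsilon> unfolding less_bowen_dist_iff[OF n] by auto
  qed
  have "y ` {..<m} \<in> separated_subsets \<theta> T \<omega> n \<epsilon> (iter k \<omega> -` {y m})"
    using W sep by (auto simp: separated_subsets_def)
  from target_sum_upper[OF ym this, of f]
  have "ennreal (\<Sum>i<m. exp (bsum f n \<omega> (y i))) \<le> target_sum Y f n \<epsilon> k \<omega>"
    by (simp add: sum.reindex[OF inj])
  moreover have "ennreal a < ennreal (\<Sum>i<m. exp (bsum f n \<omega> (y i)))"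
    using W r a by (subst ennreal_less_iff) linarith+
  ultimately show "ennreal a < target_sum Y f n \<epsilon> k \<omega>" by (rule less_le_trans[rotated])
qed

lemma target_sum_measurable:
  assumes f: "f \<in> L1" and n: "n \<ge> 1" and \<epsilon>: "\<epsilon> > 0" and Y: "closed Y" "Y \<noteq> {}"
  shows "target_sum Y f n \<epsilon> k \<in> borel_measurable P"
proof (rule borel_measurableI_greater)
  fix c :: ennreal
  show "{\<omega> \<in> space P. c < target_sum Y f n \<epsilon> k \<omega>} \<in> sets P"
  proof (cases c)
    case (real a)
    have "{\<omega> \<in> space P. c < target_sum Y f n \<epsilon> k \<omega>} = (\<Union>m q. {\<omega>\<in>space P. \<exists>y :: nat \<Rightarrow> 'x.
      (\<forall>i<m. iter k \<omega> (y i) = y m) \<and> infdist (y m) Y = 0 \<and>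
      (\<forall>i<m. \<forall>j<m. i \<noteq> j \<longrightarrow> inverse (real (Suc q)) \<le> separation_excess n \<epsilon> \<omega> (y i) (y j)) \<and>
      a + inverse (real (Suc q)) \<le> (\<Sum>i<m. exp (bsum f n \<omega> (y i)))})"
      unfolding real(2) less_target_sum_iff[OF n \<epsilon> Y real(1)] by blast
    also have "\<dots> \<in> sets P"
      by (intro sets.countable_UN image_subsetI sets_Collect_witness[OF f Y(1)])
    finally show ?thesis .
  qed (simp add: top_unique)
qed

section \<open>Integrated logarithms\<close>

definition mean_log :: "'x set \<Rightarrow> ('w \<times> 'x \<Rightarrow> real) \<Rightarrow> nat \<Rightarrow> real \<Rightarrow> nat \<Rightarrow> ereal" where
  "mean_log Y f n \<epsilon> k = eintegral P (\<lambda>\<omega>. elog (target_sum Y f n \<epsilon> k \<omega>))"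

text \<open>Almost sure hitting of \<open>Y\<close> gives integrability through the majorant of
  \<open>log_sum_bounds\<close>; in the other case \<open>mean_log_eq_minus_infinity\<close>
  applies. The alternative does not involve the potential, so in \<open>mean_log_convex\<close> all
  three potentials fall into the same case.\<close>

lemma mean_log_eq_integral:
  assumes f: "f \<in> L1" and n: "n \<ge> 1" and \<epsilon>: "\<epsilon> > 0" and Y: "closed Y" "Y \<noteq> {}"
    and hit: "AE \<omega> in P. \<exists>y. iter k \<omega> y \<in> Y"
  shows "integrable P (log_sum Y f n \<epsilon> k)"
    and "mean_log Y f n \<epsilon> k = ereal (\<integral>\<omega>. log_sum Y f n \<epsilon> k \<omega> \<partial>P)"
proof -
  obtain N :: nat where N: "N \<ge> 1"
    "\<And>\<omega> y. iter k \<omega> y \<in> Y \<Longrightarrow>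
      \<bar>log_sum Y f n \<epsilon> k \<omega>\<bar> \<le> real n * ln (real N) + norm_sum f n \<omega>"
    using log_sum_bounds[OF \<epsilon>] f n by metis
  show int: "integrable P (log_sum Y f n \<epsilon> k)"
  proof (rule Bochner_Integration.integrable_bound)
    show "integrable P (\<lambda>\<omega>. real n * ln (real N) + norm_sum f n \<omega>)"
      using norm_sum_integrable[OF f] by simp
    show "log_sum Y f n \<epsilon> k \<in> borel_measurable P"
      unfolding log_sum_def[abs_def] using target_sum_measurable[OF assms(1-5)] by measurable
    show "AE \<omega> in P. norm (log_sum Y f n \<epsilon> k \<omega>) \<le> norm (real n * ln (real N) + norm_sum f n \<omega>)"
      using hit by eventually_elim (use N(2) in \<open>force intro: order_trans[OF _ abs_ge_self]\<close>)
  qed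
  show "mean_log Y f n \<epsilon> k = ereal (\<integral>\<omega>. log_sum Y f n \<epsilon> k \<omega> \<partial>P)"
    unfolding mean_log_def
    by (rule eintegral_eq_integral[OF int])
      (use hit in eventually_elim, use target_sum_eq_exp(2)[OF f n \<epsilon>] in blast)
qed

lemma mean_log_eq_minus_infinity:
  assumes f: "f \<in> L1" and n: "n \<ge> 1" and \<epsilon>: "\<epsilon> > 0" and Y: "closed Y" "Y \<noteq> {}"
    and hit: "\<not> (AE \<omega> in P. \<exists>y. iter k \<omega> y \<in> Y)"
  shows "mean_log Y f n \<epsilon> k = -\<infinity>"
proof -
  obtain N :: nat where N: "N \<ge> 1"
    "\<And>\<omega> y. iter k \<omega> y \<in> Y \<Longrightarrow>
      \<bar>log_sum Y f n \<epsilon> k \<omega>\<bar> \<le> real n * ln (real N) + norm_sum f n \<omega>"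
    using log_sum_bounds[OF \<epsilon>] f n by metis
  \<comment> \<open>The set where \<open>Y\<close> is missed is the complement of a projection;
    describing it by vanishing of \<open>target_sum\<close> makes it measurable.\<close>
  define A where "A = {\<omega> \<in> space P. target_sum Y f n \<epsilon> k \<omega> = 0}"
  have A_iff: "\<omega> \<in> A \<longleftrightarrow> (\<forall>y. iter k \<omega> y \<notin> Y)" for \<omega>
    using target_sum_eq_exp(1)[OF f n \<epsilon>, of k \<omega> _ Y] target_sum_empty[of k \<omega> Y f n \<epsilon>]
    by (auto simp: A_def space_UNIV) (metis ennreal_eq_0_iff exp_gt_zero not_le)
  have A_sets: "A \<in> sets P"
    unfolding A_def using target_sum_measurable[OF assms(1-5)] by measurable
  show ?thesis
    unfolding mean_log_def
  proof (rule eintegral_eq_minus_infinity)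
    show "integrable P (\<lambda>\<omega>. real n * ln (real N) + norm_sum f n \<omega>)"
      using norm_sum_integrable[OF f] by simp
    show "elog (target_sum Y f n \<epsilon> k \<omega>) \<le> ereal (real n * ln (real N) + norm_sum f n \<omega>)" for \<omega>
    proof (cases "\<omega> \<in> A")
      case True
      then show ?thesis by (simp add: A_iff elog_target_sum_empty)
    next
      case False
      then obtain y where "iter k \<omega> y \<in> Y" using A_iff by blast
      then show ?thesis
        using target_sum_eq_exp(2)[OF f n \<epsilon>] N(2) by (simp add: abs_le_iff)
    qed
    show "A \<in> sets P" by (rule A_sets)
    have "emeasure P A \<noteq> 0"
    proof
      assume "emeasure P A = 0"
      then have "AE \<omega> in P. \<omega> \<notin> A" using A_sets by (intro AE_not_in) (simp add: null_sets_def)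
      then have "AE \<omega> in P. \<exists>y. iter k \<omega> y \<in> Y" by eventually_elim (simp add: A_iff)
      then show False using hit by blast
    qed
    then show "emeasure P A > 0" by (simp add: zero_less_iff_neq_zero)
    show "elog (target_sum Y f n \<epsilon> k \<omega>) = -\<infinity>" if "\<omega> \<in> A" for \<omega>
      using that by (simp add: A_iff elog_target_sum_empty)
  qed
qed

lemma mean_log_convex:
  assumes fgh: "f \<in> L1" "g \<in> L1" "h \<in> L1" and n: "n \<ge> 1" and \<epsilon>: "\<epsilon> > 0" and Y: "closed Y" "Y \<noteq> {}"
    and ts: "0 \<le> t" "0 \<le> s" "t + s = 1" and H: "integrable P H"
    and le: "\<And>\<omega> y. bsum h n \<omega> y \<le> t * bsum f n \<omega> y + s * bsum g n \<omega> y + H \<omega>"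
    and \<alpha>: "mean_log Y f n \<epsilon> k \<le> ereal \<alpha>" and \<beta>: "mean_log Y g n \<epsilon> k \<le> ereal \<beta>"
  shows "mean_log Y h n \<epsilon> k \<le> ereal (t * \<alpha> + s * \<beta> + (\<integral>\<omega>. H \<omega> \<partial>P))"
proof (cases "AE \<omega> in P. \<exists>y. iter k \<omega> y \<in> Y")
  case True
  note int = mean_log_eq_integral(1)[OF _ n \<epsilon> Y True] and eq = mean_log_eq_integral(2)[OF _ n \<epsilon> Y True]
  have "(\<integral>\<omega>. log_sum Y h n \<epsilon> k \<omega> \<partial>P)
      \<le> (\<integral>\<omega>. t * log_sum Y f n \<epsilon> k \<omega> + s * log_sum Y g n \<epsilon> k \<omega> + H \<omega> \<partial>P)"
  proof (rule integral_mono_AE)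
    show "AE \<omega> in P. log_sum Y h n \<epsilon> k \<omega> \<le> t * log_sum Y f n \<epsilon> k \<omega> + s * log_sum Y g n \<epsilon> k \<omega> + H \<omega>"
      using True by eventually_elim (use log_sum_convex[OF fgh n \<epsilon> _ ts le] in blast)
  qed (use int fgh H in simp_all)
  also have "\<dots> = t * (\<integral>\<omega>. log_sum Y f n \<epsilon> k \<omega> \<partial>P) + s * (\<integral>\<omega>. log_sum Y g n \<epsilon> k \<omega> \<partial>P) + (\<integral>\<omega>. H \<omega> \<partial>P)"
    using int fgh H by simp
  also have "\<dots> \<le> t * \<alpha> + s * \<beta> + (\<integral>\<omega>. H \<omega> \<partial>P)"
    using \<alpha> \<beta> ts unfolding eq[OF fgh(1)] eq[OF fgh(2)] by (intro add_mono mult_left_mono) auto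
  finally show ?thesis unfolding eq[OF fgh(3)] by simp
qed (simp add: mean_log_eq_minus_infinity[OF fgh(3) n \<epsilon> Y])

subsection \<open>Pressure and mean dimension\<close>

text \<open>The supremum over \<open>\<Y>\<close> stands outside the upper limit: singletons
  reproduce the pointwise pressure, while for \<open>{UNIV}\<close> it is trivial and the supremum
  over x remains inside \<open>target_sum\<close>. \<open>K n\<close> lists the admissible preimage
  depths.\<close>

definition pressure :: "'x set set \<Rightarrow> (nat \<Rightarrow> nat set) \<Rightarrow> ('w \<times> 'x \<Rightarrow> real) \<Rightarrow> real \<Rightarrow> ereal" where
  "pressure \<Y> K f \<epsilon> = (SUP Y\<in>\<Y>. limsup (\<lambda>n. (SUP k\<in>K n. mean_log Y f n \<epsilon> k) / ereal (real n)))"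

lemma P_pre_eq: "P_pre P \<theta> T = pressure {UNIV} atLeast"
  by (intro ext) (simp add: P_pre_def pressure_def mean_log_def target_sum_def)

lemma P_pre_m_eq: "P_pre_m P \<theta> T = pressure {UNIV} (\<lambda>n. {n})"
  by (intro ext) (simp add: P_pre_m_def pressure_def mean_log_def target_sum_def)

lemma P_pre_p_eq: "P_pre_p P \<theta> T = pressure (range (\<lambda>x. {x})) (\<lambda>n. {n})"
  by (intro ext) (simp add: P_pre_p_def pressure_def mean_log_def target_sum_def image_image)

text \<open>A common hypothesis for convexity (\<open>H = 0\<close>), monotonicity (\<open>s = 0\<close>) and insensitivity to
  coboundaries (\<open>c = 0\<close>): the error may grow in mean by \<open>c\<close> per step, up to a constant.\<close>

definition dominated :: "('w \<times> 'x \<Rightarrow> real) \<Rightarrow> real \<Rightarrow> ('w \<times> 'x \<Rightarrow> real) \<Rightarrow> real \<Rightarrow> ('w \<times> 'x \<Rightarrow> real) \<Rightarrow> real \<Rightarrow> bool" where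
  "dominated h t f s g c \<longleftrightarrow> h \<in> L1 \<and> f \<in> L1 \<and> g \<in> L1 \<and> 0 \<le> t \<and> 0 \<le> s \<and> t + s = 1 \<and>
     (\<exists>H C. (\<forall>n. integrable P (H n) \<and> (\<integral>\<omega>. H n \<omega> \<partial>P) \<le> real n * c + C) \<and>
       (\<forall>n \<omega> y. bsum h n \<omega> y \<le> t * bsum f n \<omega> y + s * bsum g n \<omega> y + H n \<omega>))"

lemma bsum_scale: "bsum (\<lambda>z. f z * a) n \<omega> y = a * bsum f n \<omega> y"
  by (simp add: birkhoff_sum_def sum_distrib_left mult.commute)

text \<open>The mean dimensions multiply the potential by \<open>ln (1 / \<epsilon>)\<close>. Both
  the rate \<open>c\<close> and the additive constant scale with it; for fixed \<epsilon> the latter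
  is lost in the limit over n.\<close>

lemma dominated_scale:
  assumes "dominated h t f s g c" and a: "a \<ge> 0"
  shows "dominated (\<lambda>z. h z * a) t (\<lambda>z. f z * a) s (\<lambda>z. g z * a) (a * c)"
proof -
  obtain H C where H: "\<And>n. integrable P (H n)" "\<And>n. (\<integral>\<omega>. H n \<omega> \<partial>P) \<le> real n * c + C"
    and le: "\<And>n \<omega> y. bsum h n \<omega> y \<le> t * bsum f n \<omega> y + s * bsum g n \<omega> y + H n \<omega>"
    and L: "h \<in> L1" "f \<in> L1" "g \<in> L1" and ts: "0 \<le> t" "0 \<le> s" "t + s = 1"
    using assms(1) unfolding dominated_def by blast
  have L': "(\<lambda>z. u z * a) \<in> L1" if "u \<in> L1" for u
    using L1_scale[OF that, of a] by (simp add: mult.commute)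
  have "integrable P (\<lambda>\<omega>. a * H n \<omega>) \<and> (\<integral>\<omega>. a * H n \<omega> \<partial>P) \<le> real n * (a * c) + a * C" for n
    using mult_left_mono[OF H(2)[of n] a] H(1)[of n] by (simp add: algebra_simps)
  moreover have "bsum (\<lambda>z. h z * a) n \<omega> y
      \<le> t * bsum (\<lambda>z. f z * a) n \<omega> y + s * bsum (\<lambda>z. g z * a) n \<omega> y + a * H n \<omega>" for n \<omega> y
    using mult_left_mono[OF le[of n \<omega> y] a] unfolding bsum_scale by (simp add: algebra_simps)
  ultimately have "\<exists>H C. (\<forall>n. integrable P (H n) \<and> (\<integral>\<omega>. H n \<omega> \<partial>P) \<le> real n * (a * c) + C) \<and>
       (\<forall>n \<omega> y. bsum (\<lambda>z. h z * a) n \<omega> y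
          \<le> t * bsum (\<lambda>z. f z * a) n \<omega> y + s * bsum (\<lambda>z. g z * a) n \<omega> y + H n \<omega>)"
    by (intro exI[of _ "\<lambda>n \<omega>. a * H n \<omega>"] exI[of _ "a * C"]) blast
  then show ?thesis unfolding dominated_def using L' L ts by blast
qed

text \<open>Strict real bounds \<alpha>, \<beta> stand in for the extended values, which avoids
  infinite sums and includes the value -\<infinity>. The error \<open>H n\<close> depends neither on
  k nor on \<open>Y\<close>, so the estimate passes to both suprema, and its constant part
  \<open>C / n\<close> vanishes.\<close>

lemma pressure_dominated:
  assumes Y: "\<And>Y. Y \<in> \<Y> \<Longrightarrow> closed Y \<and> Y \<noteq> {}" and \<epsilon>: "\<epsilon> > 0"
    and dom: "dominated h t f s g c"
    and \<alpha>: "pressure \<Y> K f \<epsilon> < ereal \<alpha>" and \<beta>: "pressure \<Y> K g \<epsilon> < ereal \<beta>"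
  shows "pressure \<Y> K h \<epsilon> \<le> ereal (t * \<alpha> + s * \<beta> + c)"
  unfolding pressure_def
proof (rule SUP_least)
  fix Y assume Y': "Y \<in> \<Y>"
  obtain H C where H: "\<And>n. integrable P (H n)" "\<And>n. (\<integral>\<omega>. H n \<omega> \<partial>P) \<le> real n * c + C"
    and le: "\<And>n \<omega> y. bsum h n \<omega> y \<le> t * bsum f n \<omega> y + s * bsum g n \<omega> y + H n \<omega>"
    and L: "h \<in> L1" "f \<in> L1" "g \<in> L1" and ts: "0 \<le> t" "0 \<le> s" "t + s = 1"
    using dom unfolding dominated_def by blast
  have ev: "\<forall>\<^sub>F n in sequentially. (SUP k\<in>K n. mean_log Y u n \<epsilon> k) / ereal (real n) < ereal x"
    if "pressure \<Y> K u \<epsilon> < ereal x" for u x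
    by (rule Limsup_lessD, rule le_less_trans[OF _ that]) (use Y' in \<open>auto simp: pressure_def intro: SUP_upper\<close>)
  have mean: "mean_log Y u n \<epsilon> k \<le> ereal (real n * x)"
    if "(SUP k\<in>K n. mean_log Y u n \<epsilon> k) / ereal (real n) < ereal x" "n \<ge> 1" "k \<in> K n" for u n x k
  proof -
    have "(SUP k\<in>K n. mean_log Y u n \<epsilon> k) < ereal (real n) * ereal x"
      using that(1,2) by (subst (asm) ereal_divide_less_pos) auto
    then show ?thesis using SUP_upper[OF that(3), of "\<lambda>k. mean_log Y u n \<epsilon> k"] by simp
  qed
  have "\<forall>\<^sub>F n in sequentially. (SUP k\<in>K n. mean_log Y h n \<epsilon> k) / ereal (real n)
      \<le> ereal (t * \<alpha> + s * \<beta> + c + C / real n)"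
    using ev[OF \<alpha>] ev[OF \<beta>] eventually_ge_at_top[of 1]
  proof eventually_elim
    case (elim n)
    have "(SUP k\<in>K n. mean_log Y h n \<epsilon> k) \<le> ereal (t * (real n * \<alpha>) + s * (real n * \<beta>) + (real n * c + C))"
    proof (rule SUP_least)
      fix k assume k: "k \<in> K n"
      have "mean_log Y h n \<epsilon> k \<le> ereal (t * (real n * \<alpha>) + s * (real n * \<beta>) + (\<integral>\<omega>. H n \<omega> \<partial>P))"
        using Y[OF Y'] elim k
        by (intro mean_log_convex[OF L(2,3,1) _ \<epsilon> _ _ ts H(1) le] mean) auto
      then show "mean_log Y h n \<epsilon> k \<le> ereal (t * (real n * \<alpha>) + s * (real n * \<beta>) + (real n * c + C))"
        by (rule order_trans) (use H(2) in simp)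
    qed
    also have "\<dots> = ereal (real n) * ereal (t * \<alpha> + s * \<beta> + c + C / real n)"
      using elim by (simp add: field_simps)
    finally show ?case using elim by (subst ereal_divide_le_pos) auto
  qed
  then have "limsup (\<lambda>n. (SUP k\<in>K n. mean_log Y h n \<epsilon> k) / ereal (real n))
      \<le> limsup (\<lambda>n. ereal (t * \<alpha> + s * \<beta> + c + C / real n))" by (rule Limsup_mono)
  also have "\<dots> = ereal (t * \<alpha> + s * \<beta> + c + 0)"
    by (intro lim_imp_Limsup tendsto_intros lim_const_over_n) simp
  finally show "limsup (\<lambda>n. (SUP k\<in>K n. mean_log Y h n \<epsilon> k) / ereal (real n))
      \<le> ereal (t * \<alpha> + s * \<beta> + c)" by simp
qed

lemma mdim_dominated:
  assumes Y: "\<And>Y. Y \<in> \<Y> \<Longrightarrow> closed Y \<and> Y \<noteq> {}"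
    and dom: "dominated h t f s g c"
    and \<alpha>: "mdim_of (pressure \<Y> K) f < ereal \<alpha>" and \<beta>: "mdim_of (pressure \<Y> K) g < ereal \<beta>"
  shows "mdim_of (pressure \<Y> K) h \<le> ereal (t * \<alpha> + s * \<beta> + c)"
proof -
  have less: "pressure \<Y> K (\<lambda>z. u z * ln (1 / \<epsilon>)) \<epsilon> < ereal (ln (1 / \<epsilon>) * x)"
    if "pressure \<Y> K (\<lambda>z. u z * ln (1 / \<epsilon>)) \<epsilon> / ereal (ln (1 / \<epsilon>)) < ereal x" "0 < ln (1 / \<epsilon>)" for u x \<epsilon>
    using that by (subst (asm) ereal_divide_less_pos) auto
  have "\<forall>\<^sub>F \<epsilon> in at_right 0. \<epsilon> \<in> {0<..<1::real}" by (rule eventually_at_right_real) simp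
  then have "\<forall>\<^sub>F \<epsilon> in at_right 0. pressure \<Y> K (\<lambda>z. h z * ln (1 / \<epsilon>)) \<epsilon> / ereal (ln (1 / \<epsilon>))
      \<le> ereal (t * \<alpha> + s * \<beta> + c)"
    using Limsup_lessD[OF \<alpha>[unfolded mdim_of_def]] Limsup_lessD[OF \<beta>[unfolded mdim_of_def]]
  proof eventually_elim
    case (elim \<epsilon>)
    have pos: "0 < ln (1 / \<epsilon>)" using elim by simp
    have "pressure \<Y> K (\<lambda>z. h z * ln (1 / \<epsilon>)) \<epsilon>
        \<le> ereal (t * (ln (1 / \<epsilon>) * \<alpha>) + s * (ln (1 / \<epsilon>) * \<beta>) + ln (1 / \<epsilon>) * c)"
      by (rule pressure_dominated[OF Y _ dominated_scale[OF dom less_imp_le[OF pos]]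
            less[OF elim(2) pos] less[OF elim(3) pos]]) (use elim(1) in auto)
    also have "\<dots> = ereal (ln (1 / \<epsilon>)) * ereal (t * \<alpha> + s * \<beta> + c)" by (simp add: algebra_simps)
    finally show ?case using pos by (subst ereal_divide_le_pos) auto
  qed
  then show ?thesis unfolding mdim_of_def by (rule Limsup_bounded)
qed

section \<open>Instances of domination\<close>

lemma bsum_add: "bsum (\<lambda>z. f z + g z) n \<omega> y = bsum f n \<omega> y + bsum g n \<omega> y"
  by (simp add: birkhoff_sum_def sum.distrib)

lemma dominated_convex:
  assumes "f \<in> L1" "g \<in> L1" "0 \<le> t" "0 \<le> s" "t + s = 1"
  shows "dominated (\<lambda>z. t * f z + s * g z) t f s g 0"
proof -
  have "bsum (\<lambda>z. t * f z + s * g z) n \<omega> y = t * bsum f n \<omega> y + s * bsum g n \<omega> y" for n \<omega> y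
    using bsum_scale[of f t] bsum_scale[of g s] by (simp add: bsum_add mult.commute)
  then show ?thesis
    unfolding dominated_def using assms
    by (auto intro!: exI[of _ "\<lambda>_ _. 0"] exI[of _ 0] L1_add L1_scale)
qed

text \<open>Invariance of \<open>P\<close> makes the mean of the n-th Birkhoff sum of
  \<open>H\<close> equal to n times the integral, so the rate is exact and no additive constant
  arises. The second potential has weight 0 and is a placeholder.\<close>

lemma dominated_mono:
  assumes f: "f \<in> L1" and g: "g \<in> L1" and H: "integrable P H"
    and le: "\<And>z. f z \<le> g z + H (fst z)"
  shows "dominated f 1 g 0 g (\<integral>\<omega>. H \<omega> \<partial>P)"
proof -
  define B where "B = (\<lambda>n \<omega>. \<Sum>j<n. H ((\<theta> ^^ j) \<omega>))"
  have "bsum f n \<omega> y \<le> bsum g n \<omega> y + B n \<omega>" for n \<omega> y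
  proof -
    have "bsum f n \<omega> y \<le> (\<Sum>j<n. g ((\<theta> ^^ j) \<omega>, iter j \<omega> y) + H (fst ((\<theta> ^^ j) \<omega>, iter j \<omega> y)))"
      unfolding birkhoff_sum_def by (intro sum_mono le)
    then show ?thesis by (simp add: sum.distrib B_def birkhoff_sum_def)
  qed
  moreover have "integrable P (B n)" "(\<integral>\<omega>. B n \<omega> \<partial>P) = real n * (\<integral>\<omega>. H \<omega> \<partial>P)" for n
    unfolding B_def using integral_theta_pow[OF H] by simp_all
  ultimately show ?thesis
    unfolding dominated_def using f g
    by (auto intro!: exI[of _ B] exI[of _ 0])
qed

text \<open>The Birkhoff sum telescopes to two boundary terms, whose means are bounded by the norm
  of \<open>f\<close> independently of n; they go into the additive constant.\<close>

lemma dominated_coboundary: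
  assumes f: "f \<in> L1"
  shows "dominated (\<lambda>z. f (skew_product \<theta> T z) - f z) 1 (\<lambda>z. 0) 0 (\<lambda>z. 0) 0"
proof -
  have "bsum (\<lambda>z. f (skew_product \<theta> T z) - f z) n \<omega> y = f ((\<theta> ^^ n) \<omega>, iter n \<omega> y) - f (\<omega>, y)" for n \<omega> y
    unfolding birkhoff_sum_def
    using sum_lessThan_telescope[of "\<lambda>j. f ((\<theta> ^^ j) \<omega>, iter j \<omega> y)" n]
    by (simp add: skew_product_def)
  then have "bsum (\<lambda>z. f (skew_product \<theta> T z) - f z) n \<omega> y
      \<le> fibre_norm f ((\<theta> ^^ n) \<omega>) + fibre_norm f \<omega>" for n \<omega> y
    using fibre_norm_upper[OF f, of "(\<theta> ^^ n) \<omega>" "iter n \<omega> y"] fibre_norm_upper[OF f, of \<omega> y]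
    by (simp add: abs_le_iff)
  moreover have "integrable P (\<lambda>\<omega>. fibre_norm f ((\<theta> ^^ n) \<omega>) + fibre_norm f \<omega>)"
    "(\<integral>\<omega>. fibre_norm f ((\<theta> ^^ n) \<omega>) + fibre_norm f \<omega> \<partial>P) = 2 * (\<integral>\<omega>. fibre_norm f \<omega> \<partial>P)" for n
    using integral_theta_pow[OF fibre_norm_integrable[OF f], of n] fibre_norm_integrable[OF f] by simp_all
  moreover have "bsum (\<lambda>z. 0) n \<omega> y = 0" for n \<omega> y by (simp add: birkhoff_sum_def)
  moreover have "(\<lambda>z. f (skew_product \<theta> T z) - f z) \<in> L1"
    using L1_add[OF L1_skew_product[OF f] L1_scale[OF f, of "-1"]] by simp
  ultimately show ?thesis
    unfolding dominated_def using L1_zero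
    by (auto intro!: exI[of _ "\<lambda>n \<omega>. fibre_norm f ((\<theta> ^^ n) \<omega>) + fibre_norm f \<omega>"])
qed

lemma mean_log_mono: "Y \<subseteq> Z \<Longrightarrow> mean_log Y f n \<epsilon> k \<le> mean_log Z f n \<epsilon> k"
  unfolding mean_log_def target_sum_def by (intro eintegral_mono elog_mono SUP_subset_mono) auto

text \<open>Enlarging targets or depths raises the pressure. This orders the pointwise, the m and
  the full version, so that finiteness of the last passes to the other two.\<close>

lemma pressure_mono:
  assumes "\<And>Y. Y \<in> \<Y> \<Longrightarrow> \<exists>Z\<in>\<Z>. Y \<subseteq> Z" "\<And>n. K n \<subseteq> K' n"
  shows "pressure \<Y> K f \<epsilon> \<le> pressure \<Z> K' f \<epsilon>"
  unfolding pressure_def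
proof (rule SUP_mono)
  fix Y assume "Y \<in> \<Y>"
  then obtain Z where Z: "Z \<in> \<Z>" "Y \<subseteq> Z" using assms(1) by blast
  have "limsup (\<lambda>n. (SUP k\<in>K n. mean_log Y f n \<epsilon> k) / ereal (real n))
      \<le> limsup (\<lambda>n. (SUP k\<in>K' n. mean_log Z f n \<epsilon> k) / ereal (real n))"
  proof (rule Limsup_mono)
    show "\<forall>\<^sub>F n in sequentially. (SUP k\<in>K n. mean_log Y f n \<epsilon> k) / ereal (real n)
        \<le> (SUP k\<in>K' n. mean_log Z f n \<epsilon> k) / ereal (real n)"
      using eventually_gt_at_top[of 0]
      by eventually_elim (auto intro!: ereal_divide_right_mono SUP_subset_mono mean_log_mono Z assms(2))
  qed
  then show "\<exists>Z\<in>\<Z>. limsup (\<lambda>n. (SUP k\<in>K n. mean_log Y f n \<epsilon> k) / ereal (real n))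
      \<le> limsup (\<lambda>n. (SUP k\<in>K' n. mean_log Z f n \<epsilon> k) / ereal (real n))" using Z(1) by blast
qed

text \<open>Some preimage is nonempty, so every separated count is at least \<open>1\<close>.\<close>

lemma mdim_pressure_UNIV_nonneg:
  assumes "\<And>n. K n \<noteq> {}"
  shows "0 \<le> mdim_of (pressure {UNIV} K) (\<lambda>z. 0)"
proof -
  have mean: "0 \<le> mean_log UNIV (\<lambda>z. 0) n \<epsilon> k" for n \<epsilon> k
  proof -
    have "0 \<le> elog (target_sum UNIV (\<lambda>z. 0) n \<epsilon> k \<omega>)" for \<omega>
    proof -
      have "1 \<le> target_sum UNIV (\<lambda>z. 0) n \<epsilon> k \<omega>"
        using target_sum_ge[of k \<omega> _ UNIV "\<lambda>z. 0" n \<epsilon>] by (simp add: birkhoff_sum_def)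
      then have "elog 1 \<le> elog (target_sum UNIV (\<lambda>z. 0) n \<epsilon> k \<omega>)" by (rule elog_mono)
      then show ?thesis by (simp add: elog_def zero_ereal_def)
    qed
    then have "eintegral P (\<lambda>_. 0) \<le> mean_log UNIV (\<lambda>z. 0) n \<epsilon> k"
      unfolding mean_log_def by (rule eintegral_mono)
    then show ?thesis by (simp add: eintegral_def)
  qed
  have "0 \<le> pressure {UNIV} K (\<lambda>z. 0) \<epsilon>" for \<epsilon>
  proof -
    have "limsup (\<lambda>n. 0) \<le> limsup (\<lambda>n. (SUP k\<in>K n. mean_log UNIV (\<lambda>z. 0) n \<epsilon> k) / ereal (real n))"
    proof (rule Limsup_mono)
      show "\<forall>\<^sub>F n in sequentially. 0 \<le> (SUP k\<in>K n. mean_log UNIV (\<lambda>z. 0) n \<epsilon> k) / ereal (real n)"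
        using eventually_gt_at_top[of 0]
      proof eventually_elim
        case (elim n)
        obtain k where "k \<in> K n" using assms by blast
        then have "0 \<le> (SUP k\<in>K n. mean_log UNIV (\<lambda>z. 0) n \<epsilon> k)"
          using mean by (rule SUP_upper2)
        then show ?case using elim by simp
      qed
    qed
    then show ?thesis by (simp add: pressure_def Limsup_const)
  qed
  then have "Limsup (at_right 0) (\<lambda>_ :: real. 0)
      \<le> Limsup (at_right 0) (\<lambda>\<epsilon>. pressure {UNIV} K (\<lambda>z. 0) \<epsilon> / ereal (ln (1 / \<epsilon>)))"
  proof (intro Limsup_mono)
    have "\<forall>\<^sub>F \<epsilon> in at_right 0. \<epsilon> \<in> {0<..<1::real}" by (rule eventually_at_right_real) simp
    then show "\<forall>\<^sub>F \<epsilon> in at_right 0. 0 \<le> pressure {UNIV} K (\<lambda>z. 0) \<epsilon> / ereal (ln (1 / \<epsilon>))"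
      by eventually_elim (use \<open>\<And>\<epsilon>. 0 \<le> pressure {UNIV} K (\<lambda>z. 0) \<epsilon>\<close> in simp)
  qed
  then show ?thesis by (simp add: mdim_of_def Limsup_const)
qed

section \<open>The variational principle\<close>

text \<open>Dini's theorem on one fibre: the open sets where \<open>F n < e / 2\<close> increase
  with n and cover a compact space, so the last set of a finite subcover is the whole fibre.\<close>

lemma fibre_norm_tendsto_0:
  assumes F: "\<And>n. F n \<in> L1" and dec: "\<And>n z. F (Suc n) z \<le> F n z" and lim: "\<And>z. (\<lambda>n. F n z) \<longlonglongrightarrow> 0"
  shows "(\<lambda>n. fibre_norm (F n) \<omega>) \<longlonglongrightarrow> 0"
proof (rule LIMSEQ_I)
  fix e :: real assume e: "e > 0"
  have anti: "F m z \<le> F n z" if "n \<le> m" for n m z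
    using that by (induction rule: dec_induct) (auto intro: order_trans dec)
  have nonneg: "0 \<le> F n z" for n z
    by (rule decseq_ge[OF decseq_SucI lim]) (rule dec)
  have "\<exists>C'\<subseteq>UNIV. finite C' \<and> (UNIV :: 'x set) \<subseteq> (\<Union>n\<in>C'. {x. F n (\<omega>, x) < e / 2})"
  proof (rule compactE_image[OF compact_fibre])
    show "open {x. F n (\<omega>, x) < e / 2}" for n
      by (intro open_Collect_less L1_continuous F continuous_on_const)
    show "(UNIV :: 'x set) \<subseteq> (\<Union>n\<in>UNIV. {x. F n (\<omega>, x) < e / 2})"
    proof
      fix x
      have "\<forall>\<^sub>F n in sequentially. F n (\<omega>, x) < e / 2"
        by (rule order_tendstoD(2)[OF lim]) (use e in simp)
      then show "x \<in> (\<Union>n\<in>UNIV. {x. F n (\<omega>, x) < e / 2})"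
        by (auto simp: eventually_sequentially)
    qed
  qed auto
  then obtain C' where C': "finite C'" "(UNIV :: 'x set) \<subseteq> (\<Union>n\<in>C'. {x. F n (\<omega>, x) < e / 2})"
    by blast
  have "norm (fibre_norm (F m) \<omega> - 0) < e" if m: "m \<ge> Max (insert 0 C')" for m
  proof -
    have "\<bar>F m (\<omega>, x)\<bar> \<le> e / 2" for x
    proof -
      obtain n where n: "n \<in> C'" "F n (\<omega>, x) < e / 2" using C'(2) by blast
      then have "n \<le> m" using m C'(1) by simp
      then show ?thesis using anti[of n m "(\<omega>, x)"] n nonneg[of m "(\<omega>, x)"] by simp
    qed
    then have "fibre_norm (F m) \<omega> \<le> e / 2" unfolding fibre_norm_def by (intro cSUP_least) auto
    then show ?thesis using fibre_norm_nonneg[OF F, of m \<omega>] e by simp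
  qed
  then show "\<exists>no. \<forall>n\<ge>no. norm (fibre_norm (F n) \<omega> - 0) < e" by blast
qed

section \<open>Bounded potentials as test functions\<close>

lemma function_space_L1: "function_space L1"
  by unfold_locales (simp_all add: L1_zero L1_add L1_scale)

lemma L1_max:
  assumes f: "f \<in> L1" and g: "g \<in> L1"
  shows "(\<lambda>z. max (f z) (g z)) \<in> L1"
proof (rule L1I)
  show "(\<lambda>z. max (f z) (g z)) \<in> borel_measurable (P \<Otimes>\<^sub>M borel)"
    by (intro borel_measurable_max L1_measurable f g)
  show "continuous_on UNIV (\<lambda>x. max (f (\<omega>, x)) (g (\<omega>, x)))" for \<omega>
    by (intro continuous_on_max L1_continuous f g)
  show "integrable P (\<lambda>\<omega>. fibre_norm f \<omega> + fibre_norm g \<omega>)"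
    by (intro Bochner_Integration.integrable_add fibre_norm_integrable f g)
  show "\<bar>max (f (\<omega>, x)) (g (\<omega>, x))\<bar> \<le> fibre_norm f \<omega> + fibre_norm g \<omega>" for \<omega> x
    using fibre_norm_upper[OF f, of \<omega> x] fibre_norm_upper[OF g, of \<omega> x] by linarith
qed

lemma L1_const: "(\<lambda>z. c) \<in> L1"
  using L1_base[of "\<lambda>_. c"] by simp

text \<open>Products of integrable potentials need not be integrable, so the Daniell construction
  runs on this subspace.\<close>

definition bounded_L1 :: "('w \<times> 'x \<Rightarrow> real) set" where
  "bounded_L1 = {f \<in> L1. \<exists>B. \<forall>z. \<bar>f z\<bar> \<le> B}"

lemma bounded_L1_iff:
  "f \<in> bounded_L1 \<longleftrightarrow> f \<in> borel_measurable (P \<Otimes>\<^sub>M borel) \<and>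
    (\<forall>\<omega>. continuous_on UNIV (\<lambda>x. f (\<omega>, x))) \<and> (\<exists>B. \<forall>z. \<bar>f z\<bar> \<le> B)"
proof
  assume "f \<in> bounded_L1"
  then show "f \<in> borel_measurable (P \<Otimes>\<^sub>M borel) \<and>
    (\<forall>\<omega>. continuous_on UNIV (\<lambda>x. f (\<omega>, x))) \<and> (\<exists>B. \<forall>z. \<bar>f z\<bar> \<le> B)"
    by (simp add: bounded_L1_def L1_measurable L1_continuous)
next
  assume f: "f \<in> borel_measurable (P \<Otimes>\<^sub>M borel) \<and>
    (\<forall>\<omega>. continuous_on UNIV (\<lambda>x. f (\<omega>, x))) \<and> (\<exists>B. \<forall>z. \<bar>f z\<bar> \<le> B)"
  then obtain B where "\<forall>z. \<bar>f z\<bar> \<le> B" by blast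
  then have "f \<in> L1" using f by (intro L1I[of f "\<lambda>_. B"]) auto
  then show "f \<in> bounded_L1" using f by (simp add: bounded_L1_def)
qed

lemma bounded_L1_rectangle:
  fixes g :: "'x \<Rightarrow> real"
  assumes A: "A \<in> sets P" and g: "continuous_on UNIV g"
  shows "(\<lambda>z. indicator A (fst z) * g (snd z)) \<in> bounded_L1"
proof -
  obtain B where B: "\<And>x. \<bar>g x\<bar> \<le> B"
    using continuous_attains_sup[OF compact_fibre UNIV_not_empty continuous_on_rabs[OF g]] by blast
  have [measurable]: "g \<in> borel_measurable borel" using g by (rule borel_measurable_continuous_onI)
  have [measurable]: "A \<in> sets P" by (rule A)
  have "\<bar>indicator A (fst z) * g (snd z)\<bar> \<le> B" for z :: "'w \<times> 'x"
    using B[of "snd z"] by (cases "fst z \<in> A") auto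
  moreover have "(\<lambda>z. indicator A (fst z) * g (snd z)) \<in> borel_measurable (P \<Otimes>\<^sub>M borel)"
    by measurable
  moreover have "continuous_on UNIV (\<lambda>x. indicator A (fst (\<omega>, x)) * g (snd (\<omega>, x)))" for \<omega> :: 'w
    using g by (auto intro!: continuous_intros)
  ultimately show ?thesis
    unfolding bounded_L1_iff by blast
qed

text \<open>For the harder inclusion both projections are made measurable: an indicator of a base
  set recovers that set, and the distance to the complement recovers an open set of the
  fibre.\<close>

lemma sets_bounded_L1:
  "sigma_sets UNIV {{z. 0 < f z} |f. f \<in> bounded_L1} = sets (P \<Otimes>\<^sub>M (borel :: 'x measure))"
proof
  define E where "E = {{z. 0 < f z} |f. f \<in> bounded_L1}"
  define S where "S = measure_of UNIV E (\<lambda>_. 0)"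
  have space_S: "space S = UNIV" unfolding S_def by (simp add: space_measure_of_conv)
  have sets_S: "sets S = sigma_sets UNIV E" unfolding S_def by (rule sets_measure_of) simp
  have space_PX: "space (P \<Otimes>\<^sub>M (borel :: 'x measure)) = UNIV" by (simp add: space_pair_measure space_UNIV)
  have "E \<subseteq> sets (P \<Otimes>\<^sub>M (borel :: 'x measure))"
  proof
    fix A assume "A \<in> E"
    then obtain f where "A = {z. 0 < f z}" "f \<in> bounded_L1"
      unfolding E_def by blast
    then have "A = {z. 0 < f z}" "f \<in> borel_measurable (P \<Otimes>\<^sub>M borel)"
      by (auto simp: bounded_L1_iff)
    then show "A \<in> sets (P \<Otimes>\<^sub>M (borel :: 'x measure))"
      using measurable_sets[of f "P \<Otimes>\<^sub>M borel" borel "{0<..}"] by (simp add: space_PX vimage_def)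
  qed
  from sets.sigma_sets_subset[OF this]
  show "sigma_sets UNIV {{z. 0 < f z} |f. f \<in> bounded_L1} \<subseteq> sets (P \<Otimes>\<^sub>M (borel :: 'x measure))"
    by (simp add: space_PX E_def)
  have in_S: "{z. 0 < f z} \<in> sets S" if "f \<in> bounded_L1" for f
    unfolding sets_S using that by (intro sigma_sets.Basic) (auto simp: E_def)
  have "fst \<in> S \<rightarrow>\<^sub>M P"
  proof (rule measurableI)
    fix A assume "A \<in> sets P"
    from in_S[OF bounded_L1_rectangle[OF this continuous_on_const[of _ 1]]]
    show "fst -` A \<inter> space S \<in> sets S" by (simp add: space_S indicator_def vimage_def)
  qed (simp add: space_UNIV)
  moreover have "snd \<in> S \<rightarrow>\<^sub>M (borel :: 'x measure)"
  proof (rule borel_measurableI)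
    fix U :: "'x set" assume U: "open U"
    \<comment> \<open>\<open>infdist\<close> to the empty set is 0 by convention, so the whole space
      is not recovered from the distance to its complement.\<close>
    show "snd -` U \<inter> space S \<in> sets S"
    proof (cases "U = UNIV")
      case False
      then have "x \<in> U \<longleftrightarrow> 0 < infdist x (- U)" for x
        using in_closed_iff_infdist_zero[of "- U" x] infdist_nonneg[of x "- U"] U
        by (auto simp: closed_def less_le)
      then show ?thesis
        using in_S[OF bounded_L1_rectangle[OF sets.top continuous_on_infdist[OF continuous_on_id, of UNIV "- U"]]]
        by (simp add: space_S space_UNIV vimage_def)
    qed (use sets.top[of S] in \<open>simp add: space_S\<close>)
  qed
  ultimately have "(\<lambda>z. (fst z, snd z)) \<in> S \<rightarrow>\<^sub>M P \<Otimes>\<^sub>M (borel :: 'x measure)" by (rule measurable_Pair)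
  then have id: "(\<lambda>z. z) \<in> S \<rightarrow>\<^sub>M P \<Otimes>\<^sub>M (borel :: 'x measure)" by simp
  show "sets (P \<Otimes>\<^sub>M (borel :: 'x measure)) \<subseteq> sigma_sets UNIV {{z. 0 < f z} |f. f \<in> bounded_L1}"
    using measurable_sets[OF id] by (auto simp: space_S sets_S[unfolded E_def])
qed

text \<open>Bounded fibre-continuous functions approximate the indicators of the rectangles with closed
  second side, which form a generating pi-system.\<close>

lemma measure_eqI_bounded_L1:
  assumes M: "prob_space M" "sets M = sets (P \<Otimes>\<^sub>M (borel :: 'x measure))"
    and N: "prob_space N" "sets N = sets (P \<Otimes>\<^sub>M (borel :: 'x measure))"
    and eq: "\<And>f. f \<in> bounded_L1 \<Longrightarrow> (\<integral>z. f z \<partial>M) = (\<integral>z. f z \<partial>N)"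
  shows "M = N"
proof (rule measure_eqI_generator_eq)
  define E where "E = {A \<times> C |A C. A \<in> sets P \<and> closed (C :: 'x set)}"
  have space_PX: "space (P \<Otimes>\<^sub>M (borel :: 'x measure)) = UNIV" by (simp add: space_pair_measure space_UNIV)
  have "sets (P \<Otimes>\<^sub>M (borel :: 'x measure)) = sigma_sets UNIV E"
  proof -
    have "sets (P \<Otimes>\<^sub>M (borel :: 'x measure)) = sets (sigma UNIV (sets P) \<Otimes>\<^sub>M sigma UNIV (Collect closed))"
      unfolding borel_eq_closed[symmetric]
      using sets.sigma_sets_eq[of P] by (intro sets_pair_measure_cong) (simp_all add: space_UNIV)
    also have "sigma UNIV (sets P) \<Otimes>\<^sub>M sigma UNIV (Collect closed)
        = sigma (UNIV \<times> UNIV) {A \<times> C |A C. A \<in> sets P \<and> C \<in> Collect (closed :: 'x set \<Rightarrow> bool)}"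
      using sets.top[of P] by (intro sigma_prod exI[of _ "{UNIV}"]) (auto simp: space_UNIV)
    finally have "sets (P \<Otimes>\<^sub>M (borel :: 'x measure))
        = sets (sigma UNIV {A \<times> C |A C. A \<in> sets P \<and> C \<in> Collect (closed :: 'x set \<Rightarrow> bool)})"
      by simp
    then show ?thesis by (simp add: E_def)
  qed
  then show "sets M = sigma_sets UNIV E" "sets N = sigma_sets UNIV E" using M N by auto
  show "Int_stable E"
  proof (rule Int_stableI)
    fix X Y assume "X \<in> E" "Y \<in> E"
    then obtain A B C D where "X = A \<times> C" "Y = B \<times> D" "A \<in> sets P" "B \<in> sets P" "closed C" "closed D"
      unfolding E_def by blast
    then show "X \<inter> Y \<in> E"
      unfolding E_def
      by (intro CollectI exI[of _ "A \<inter> B"] exI[of _ "C \<inter> D"]) (auto simp: Times_Int_Times)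
  qed
  show "E \<subseteq> Pow UNIV" by simp
  show "range (\<lambda>_ :: nat. UNIV) \<subseteq> E"
    unfolding E_def using sets.top[of P] by (auto simp: space_UNIV intro!: exI[of _ UNIV])
  show "(\<Union>i :: nat. UNIV) = UNIV" by simp
  show "emeasure M UNIV \<noteq> \<infinity>"
    using prob_space.emeasure_space_1[OF M(1)] sets_eq_imp_space_eq[OF M(2)] by (simp add: space_PX)
  fix X assume "X \<in> E"
  then obtain A C where X: "X = A \<times> C" and A: "A \<in> sets P" and C: "closed C" unfolding E_def by blast
  \<comment> \<open>The case \<open>C = {}\<close> is separate because \<open>infdist\<close> to the
    empty set is 0, and \<open>F n\<close> would be the indicator of \<open>A\<close> instead of
    0.\<close>
  show "emeasure M X = emeasure N X"
  proof (cases "C = {}")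
    case False
    define F where "F = (\<lambda>n (z :: 'w \<times> 'x). indicator A (fst z) * max 0 (1 - real n * infdist (snd z) C))"
    have F: "F n \<in> bounded_L1" for n
      unfolding F_def by (intro bounded_L1_rectangle A continuous_intros)
    have lim: "(\<lambda>n. F n z) \<longlonglongrightarrow> indicator X z" for z
    proof (cases "snd z \<in> C")
      case True
      then show ?thesis by (auto simp: F_def X indicator_def mem_Times_iff)
    next
      case False
      then have pos: "0 < infdist (snd z) C"
        using in_closed_iff_infdist_zero[OF C \<open>C \<noteq> {}\<close>] infdist_nonneg[of "snd z" C] by (auto simp: less_le)
      obtain m :: nat where m: "1 / infdist (snd z) C < real m" using reals_Archimedean2 by blast
      have "F n z = 0" if "n \<ge> m" for n
      proof -
        have "1 / infdist (snd z) C < real n" using m that by (meson less_le_trans of_nat_mono)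
        then show ?thesis using pos by (simp add: F_def field_simps)
      qed
      then have "\<forall>\<^sub>F n in sequentially. F n z = 0" by (auto simp: eventually_sequentially)
      then show ?thesis using False by (simp add: X tendsto_eventually mem_Times_iff)
    qed
    have conv: "(\<lambda>n. \<integral>z. F n z \<partial>K) \<longlonglongrightarrow> measure K X"
      if "prob_space K" "sets K = sets (P \<Otimes>\<^sub>M (borel :: 'x measure))" for K
    proof -
      interpret K: prob_space K by fact
      have XK: "X \<in> sets K" using A C by (simp add: that(2) X)
      have "(\<lambda>n. \<integral>z. F n z \<partial>K) \<longlonglongrightarrow> (\<integral>z. indicator X z \<partial>K)"
      proof (rule integral_dominated_convergence[where w = "\<lambda>_. 1"])
        show "F n \<in> borel_measurable K" for n
          using F[of n] that(2) by (simp add: bounded_L1_iff cong: measurable_cong_sets)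
        show "AE z in K. norm (F n z) \<le> 1" for n
          by (rule AE_I2) (auto simp: F_def indicator_def infdist_nonneg)
      qed (use lim XK in auto)
      then show ?thesis using XK by (simp add: K.emeasure_eq_measure)
    qed
    have "measure M X = measure N X"
      by (rule LIMSEQ_unique[OF conv[OF M]]) (use conv[OF N] eq[OF F] in simp)
    then show ?thesis
      using M(1) N(1) by (simp add: finite_measure.emeasure_eq_measure prob_space.finite_measure)
  qed (simp add: X)
qed

end

text \<open>Domination with strict real bounds and a finite value at 0 are all that the duality
  argument uses, so the three mean dimensions become interpretations.\<close>

locale mean_dimension = compact_rds P \<theta> T
  for P :: "'w measure" and \<theta> and T :: "'w \<Rightarrow> 'x::metric_space \<Rightarrow> 'x" +
  fixes D :: "('w \<times> 'x \<Rightarrow> real) \<Rightarrow> ereal" and d :: real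
  assumes dominated: "dominated h t f s g c \<Longrightarrow> D f < ereal \<alpha> \<Longrightarrow> D g < ereal \<beta> \<Longrightarrow>
      D h \<le> ereal (t * \<alpha> + s * \<beta> + c)"
    and D_zero: "D (\<lambda>z. 0) = ereal d"
begin

sublocale L1: function_space "L1_fibre_continuous P :: ('w \<times> 'x \<Rightarrow> real) set"
  by (rule function_space_L1)

section \<open>Subgradients at the zero potential\<close>

definition increment :: "('w \<times> 'x \<Rightarrow> real) \<Rightarrow> real" where
  "increment f = real_of_ereal (D f) - d"

text \<open>Finiteness spreads from 0 to every \<open>f\<close>, because \<open>f\<close> and 0
  dominate each other up to \<open>fibre_norm f\<close>, a function of \<omega> alone.\<close>

lemma D_eq: assumes f: "f \<in> L1" shows "D f = ereal (d + increment f)"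
proof -
  define I where "I = (\<integral>\<omega>. fibre_norm f \<omega> \<partial>P)"
  have "D f \<le> ereal (1 * (d + 1) + 0 * (d + 1) + I)"
    unfolding I_def using fibre_norm_upper[OF f]
    by (intro dominated[OF dominated_mono[OF f L1_zero fibre_norm_integrable[OF f]]])
      (auto simp: D_zero abs_le_iff)
  moreover have "D f \<noteq> -\<infinity>"
  proof
    assume minus_infinity: "D f = -\<infinity>"
    \<comment> \<open>If \<open>D f\<close> were -\<infinity>, any real would bound it;
      \<open>d - I - 1\<close> makes the right-hand side \<open>d - 1\<close>, less than
      \<open>D 0\<close>.\<close>
    have "D (\<lambda>z. 0) \<le> ereal (1 * (d - I - 1) + 0 * (d - I - 1) + I)"
      unfolding I_def
    proof (intro dominated[OF dominated_mono[OF L1_zero f fibre_norm_integrable[OF f]]])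
      show "0 \<le> f z + fibre_norm f (fst z)" for z
        using fibre_norm_upper[OF f, of "fst z" "snd z"] by (simp add: abs_le_iff)
    qed (auto simp: minus_infinity)
    then show False by (simp add: D_zero)
  qed
  ultimately show ?thesis by (cases "D f") (auto simp: increment_def)
qed

lemma increment_zero: "increment (\<lambda>z. 0) = 0"
  by (simp add: increment_def D_zero)

text \<open>The strict bounds of the locale are approached with slack \<open>e\<close>; the constant
  \<open>d\<close> cancels because \<open>t + s = 1\<close>.\<close>

lemma increment_dominated:
  assumes dom: "dominated h t f s g c"
  shows "increment h \<le> t * increment f + s * increment g + c"
proof (rule field_le_epsilon)
  fix e :: real assume e: "e > 0"
  have L: "h \<in> L1" "f \<in> L1" "g \<in> L1" and ts: "t + s = 1" using dom unfolding dominated_def by auto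
  have "D h \<le> ereal (t * (d + increment f + e) + s * (d + increment g + e) + c)"
    by (rule dominated[OF dom]) (use e in \<open>simp_all add: D_eq[OF L(2)] D_eq[OF L(3)]\<close>)
  then have "d + increment h \<le> t * (d + increment f + e) + s * (d + increment g + e) + c"
    by (simp add: D_eq[OF L(1)])
  also have "\<dots> = (t + s) * (d + e) + t * increment f + s * increment g + c" by (simp add: algebra_simps)
  finally show "increment h \<le> t * increment f + s * increment g + c + e" using ts by simp
qed

lemma increment_mono:
  assumes "f \<in> L1" "g \<in> L1" "integrable P H" "\<And>z. f z \<le> g z + H (fst z)"
  shows "increment f \<le> increment g + (\<integral>\<omega>. H \<omega> \<partial>P)"
  using increment_dominated[OF dominated_mono[OF assms]] by simp

text \<open>By convexity this infimum is the one-sided derivative of \<open>D\<close> at \<open>0\<close> in direction \<open>f\<close>.\<close>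

definition slope :: "('w \<times> 'x \<Rightarrow> real) \<Rightarrow> real" where
  "slope f = (INF t\<in>{0<..}. increment (\<lambda>z. t * f z) / t)"

text \<open>Comparing 0 with \<open>t * f\<close> bounds every difference quotient below by minus
  the integral of \<open>fibre_norm f\<close>, so the infimum is a genuine one.\<close>

lemma slope_le:
  assumes f: "f \<in> L1" and t: "t > 0"
  shows "slope f \<le> increment (\<lambda>z. t * f z) / t"
proof -
  have "bdd_below ((\<lambda>t. increment (\<lambda>z. t * f z) / t) ` {0<..})"
  proof (rule bdd_belowI2)
    fix t :: real assume "t \<in> {0<..}"
    then have t: "t > 0" by simp
    have "increment (\<lambda>z. 0) \<le> increment (\<lambda>z. t * f z) + (\<integral>\<omega>. t * fibre_norm f \<omega> \<partial>P)"
    proof (rule increment_mono[OF L1_zero L1_scale[OF f]])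
      show "integrable P (\<lambda>\<omega>. t * fibre_norm f \<omega>)" using fibre_norm_integrable[OF f] by simp
      fix z
      have "0 \<le> t * (f z + fibre_norm f (fst z))"
        using fibre_norm_upper[OF f, of "fst z" "snd z"] t by (intro mult_nonneg_nonneg) (auto simp: abs_le_iff)
      then show "0 \<le> t * f z + t * fibre_norm f (fst z)" by (simp add: distrib_left)
    qed
    then show "- (\<integral>\<omega>. fibre_norm f \<omega> \<partial>P) \<le> increment (\<lambda>z. t * f z) / t"
      using t by (simp add: increment_zero field_simps)
  qed
  then show ?thesis unfolding slope_def by (rule cINF_lower) (use t in simp)
qed

lemma sublinear_slope: "L1.sublinear slope"
  unfolding L1.sublinear_def
proof (intro conjI ballI allI impI)
  fix f g assume f: "f \<in> L1" and g: "g \<in> L1"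
  show "slope (\<lambda>z. f z + g z) \<le> slope f + slope g"
    unfolding slope_def[of f] slope_def[of g]
  proof (rule L1.le_cINF_add)
    fix s t :: real assume "s \<in> {0<..}" "t \<in> {0<..}"
    then have s: "s > 0" and t: "t > 0" by auto
    \<comment> \<open>With this step, \<open>r * (f + g)\<close> is the convex combination of
      \<open>s * f\<close> and \<open>t * g\<close> with weights \<open>t / (s + t)\<close> and
      \<open>s / (s + t)\<close>; dividing by \<open>r\<close> turns the weights into
      \<open>1 / s\<close> and \<open>1 / t\<close>.\<close>
    define r where "r = s * t / (s + t)"
    have r: "r > 0" using s t by (simp add: r_def)
    have r_over: "t / (s + t) = r / s" "s / (s + t) = r / t" using s t by (simp_all add: r_def)
    have st: "t / (s + t) + s / (s + t) = 1" using s t by (simp flip: add_divide_distrib)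
    have "(\<lambda>z. r * (f z + g z)) = (\<lambda>z. t / (s + t) * (s * f z) + s / (s + t) * (t * g z))"
      by (simp add: r_def distrib_left add_divide_distrib ac_simps)
    then have "increment (\<lambda>z. r * (f z + g z))
        \<le> t / (s + t) * increment (\<lambda>z. s * f z) + s / (s + t) * increment (\<lambda>z. t * g z) + 0"
      using increment_dominated[OF dominated_convex[OF L1_scale[OF f] L1_scale[OF g] _ _ st]] s t by simp
    then have "increment (\<lambda>z. r * (f z + g z)) / r
        \<le> (t / (s + t) * increment (\<lambda>z. s * f z) + s / (s + t) * increment (\<lambda>z. t * g z)) / r"
      using r by (intro divide_right_mono) auto
    also have "\<dots> = increment (\<lambda>z. s * f z) / s + increment (\<lambda>z. t * g z) / t"
      using r unfolding r_over by (simp add: add_divide_distrib)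
    finally show "slope (\<lambda>z. f z + g z) \<le> increment (\<lambda>z. s * f z) / s + increment (\<lambda>z. t * g z) / t"
      using slope_le[OF L1_add[OF f g] r] by linarith
  qed auto
next
  fix f and c :: real assume f: "f \<in> L1" and c: "c > 0"
  have le: "slope (\<lambda>z. a * u z) \<le> a * slope u" if u: "u \<in> L1" and a: "a > 0" for a u
  proof -
    have "slope (\<lambda>z. a * u z) / a \<le> slope u"
      unfolding slope_def[of u]
    proof (rule cINF_greatest)
      fix t :: real assume "t \<in> {0<..}"
      then have t: "t > 0" by simp
      have "slope (\<lambda>z. a * u z) \<le> increment (\<lambda>z. (t / a) * (a * u z)) / (t / a)"
        using t a by (intro slope_le L1_scale u) simp
      also have "(\<lambda>z. (t / a) * (a * u z)) = (\<lambda>z. t * u z)" using a by simp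
      finally show "slope (\<lambda>z. a * u z) / a \<le> increment (\<lambda>z. t * u z) / t"
        using a t by (simp add: field_simps)
    qed auto
    then show ?thesis using a by (simp add: field_simps)
  qed
  have "slope (\<lambda>z. (1 / c) * (c * f z)) \<le> (1 / c) * slope (\<lambda>z. c * f z)"
    using c by (intro le L1_scale f) simp
  then have "c * slope f \<le> slope (\<lambda>z. c * f z)" using c by (simp add: field_simps)
  then show "slope (\<lambda>z. c * f z) = c * slope f" using le[OF f c] by linarith
qed

text \<open>The quotient at \<open>t = 1\<close> shows that \<open>slope\<close> lies below
  \<open>increment\<close>, so each one-sided estimate of \<open>increment\<close> passes to
  \<open>l\<close>, where it may be applied to the difference \<open>f - g\<close> by
  linearity.\<close>

lemma exists_invariant_subgradient:
  obtains l where "L1.linear_functional l" "\<And>f. f \<in> L1 \<Longrightarrow> l f \<le> increment f"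
    "\<And>f. f \<in> L1 \<Longrightarrow> l (\<lambda>z. f (skew_product \<theta> T z)) = l f"
    "\<And>f g H. f \<in> L1 \<Longrightarrow> g \<in> L1 \<Longrightarrow> integrable P H \<Longrightarrow> (\<And>z. f z \<le> g z + H (fst z)) \<Longrightarrow>
      l f \<le> l g + (\<integral>\<omega>. H \<omega> \<partial>P)"
proof -
  obtain l where lin: "L1.linear_functional l" and l: "\<And>f. f \<in> L1 \<Longrightarrow> l f \<le> slope f"
    using L1.exists_linear_functional_le[OF sublinear_slope] by blast
  have le: "l f \<le> increment f" if "f \<in> L1" for f
    using l[OF that] slope_le[OF that, of 1] by simp
  note l_simps = L1.linear_functionalD[OF lin]
  have skew: "l (\<lambda>z. f (skew_product \<theta> T z)) \<le> l f" if f: "f \<in> L1" for f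
  proof -
    have "l (\<lambda>z. f (skew_product \<theta> T z)) - l f = l (\<lambda>z. f (skew_product \<theta> T z) - f z)"
      by (rule l_simps(4)[OF L1_skew_product[OF f] f, symmetric])
    also have "\<dots> \<le> increment (\<lambda>z. f (skew_product \<theta> T z) - f z)"
      by (intro le L1.diff L1_skew_product f)
    also have "\<dots> \<le> 0"
      using increment_dominated[OF dominated_coboundary[OF f]] by (simp add: increment_zero)
    finally show ?thesis by simp
  qed
  \<comment> \<open>The opposite inequality is \<open>skew\<close> for \<open>- f\<close>.\<close>
  have skew_eq: "l (\<lambda>z. f (skew_product \<theta> T z)) = l f" if f: "f \<in> L1" for f
    using skew[OF f] skew[OF L1.uminus[OF f]] l_simps(3)[OF f] l_simps(3)[OF L1_skew_product[OF f]]
    by simp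
  have mono: "l f \<le> l g + (\<integral>\<omega>. H \<omega> \<partial>P)"
    if f: "f \<in> L1" and g: "g \<in> L1" and H: "integrable P H" and fg: "\<And>z. f z \<le> g z + H (fst z)" for f g H
  proof -
    have "l f - l g = l (\<lambda>z. f z - g z)" by (rule l_simps(4)[OF f g, symmetric])
    also have "\<dots> \<le> increment (\<lambda>z. f z - g z)" by (intro le L1.diff f g)
    also have "\<dots> \<le> increment (\<lambda>z. 0) + (\<integral>\<omega>. H \<omega> \<partial>P)"
      by (rule increment_mono[OF L1.diff[OF f g] L1_zero H]) (use fg in \<open>simp add: algebra_simps\<close>)
    finally show ?thesis by (simp add: increment_zero)
  qed
  show thesis by (rule that[OF lin le skew_eq mono])
qed

text \<open>Monotone continuity is a sandwich: \<open>l (F n)\<close> lies between 0 and the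
  integral of \<open>fibre_norm (F n)\<close>, whose integrand tends to 0 on every fibre and is
  dominated by \<open>fibre_norm (F 0)\<close>.\<close>

lemma daniell_integral_bounded_L1:
  assumes lin: "L1.linear_functional l"
    and mono: "\<And>f g H. f \<in> L1 \<Longrightarrow> g \<in> L1 \<Longrightarrow> integrable P H \<Longrightarrow> (\<And>z. f z \<le> g z + H (fst z)) \<Longrightarrow>
      l f \<le> l g + (\<integral>\<omega>. H \<omega> \<partial>P)"
  shows "daniell_integral bounded_L1 l"
proof -
  have L1: "f \<in> L1" if "f \<in> bounded_L1" for f using that by (simp add: bounded_L1_def)
  note l_simps = L1.linear_functionalD[OF lin]
  have nonneg: "0 \<le> l f" if "f \<in> L1" "\<And>z. 0 \<le> f z" for f
    using mono[OF L1_zero that(1), of "\<lambda>_. 0"] that(2) l_simps(5)[OF L1_zero] by simp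
  interpret V: function_space bounded_L1
  proof
    show "(\<lambda>z. 0) \<in> bounded_L1" using L1_zero by (auto simp: bounded_L1_def)
    fix f g c assume f: "f \<in> bounded_L1"
    then obtain B where B: "\<And>z. \<bar>f z\<bar> \<le> B" by (auto simp: bounded_L1_def)
    have "\<bar>c * f z\<bar> \<le> \<bar>c\<bar> * B" for z using B[of z] by (simp add: abs_mult mult_left_mono)
    then show "(\<lambda>z. c * f z) \<in> bounded_L1" using L1_scale[OF L1[OF f]] by (auto simp: bounded_L1_def)
    assume g: "g \<in> bounded_L1"
    then obtain C where C: "\<And>z. \<bar>g z\<bar> \<le> C" by (auto simp: bounded_L1_def)
    have "\<bar>f z + g z\<bar> \<le> B + C" for z using B[of z] C[of z] by linarith
    then show "(\<lambda>z. f z + g z) \<in> bounded_L1" using L1_add[OF L1[OF f] L1[OF g]] by (auto simp: bounded_L1_def)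
  qed
  show ?thesis
  proof
    show "(\<lambda>z. 1) \<in> bounded_L1" using L1_const[of 1] by (auto simp: bounded_L1_def)
    show "V.linear_functional l"
      unfolding V.linear_functional_def using l_simps(1,2) L1 by blast
    show "0 \<le> l f" if "f \<in> bounded_L1" "\<And>z. 0 \<le> f z" for f by (rule nonneg[OF L1[OF that(1)] that(2)])
    show "\<exists>B. \<forall>z. \<bar>f z\<bar> \<le> B" if "f \<in> bounded_L1" for f using that by (simp add: bounded_L1_def)
    show "(\<lambda>z. max 0 (f z)) \<in> bounded_L1" if f: "f \<in> bounded_L1" for f
    proof -
      obtain B where B: "\<And>z. \<bar>f z\<bar> \<le> B" using f by (auto simp: bounded_L1_def)
      have "\<bar>max 0 (f z)\<bar> \<le> B" for z using B[of z] by linarith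
      then show ?thesis using L1_max[OF L1_zero L1[OF f]] by (auto simp: bounded_L1_def)
    qed
    show "(\<lambda>z. f z * g z) \<in> bounded_L1" if f: "f \<in> bounded_L1" and g: "g \<in> bounded_L1" for f g
    proof -
      obtain B C where "\<And>z. \<bar>f z\<bar> \<le> B" "\<And>z. \<bar>g z\<bar> \<le> C" using f g by (auto simp: bounded_L1_def)
      then have "\<bar>f z * g z\<bar> \<le> B * C" for z
        unfolding abs_mult by (intro mult_mono) (auto intro: order_trans[OF abs_ge_zero])
      then show ?thesis
        using f g unfolding bounded_L1_iff by (auto intro!: continuous_on_mult borel_measurable_times)
    qed
    show "(\<lambda>n. l (F n)) \<longlonglongrightarrow> 0"
      if F: "\<And>n. F n \<in> bounded_L1" and dec: "\<And>n z. F (Suc n) z \<le> F n z" and lim: "\<And>z. (\<lambda>n. F n z) \<longlonglongrightarrow> 0"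
      for F
    proof -
      have F0: "0 \<le> F n z" for n z by (rule decseq_ge[OF decseq_SucI lim]) (rule dec)
      have anti: "F n z \<le> F 0 z" for n z by (induction n) (auto intro: order_trans[OF dec])
      have "(\<lambda>n. \<integral>\<omega>. fibre_norm (F n) \<omega> \<partial>P) \<longlonglongrightarrow> (\<integral>\<omega>. 0 \<partial>P)"
      proof (rule integral_dominated_convergence[where w = "fibre_norm (F 0)"])
        show "AE \<omega> in P. (\<lambda>n. fibre_norm (F n) \<omega>) \<longlonglongrightarrow> 0"
          by (intro AE_I2 fibre_norm_tendsto_0 L1 F dec lim)
        show "AE \<omega> in P. norm (fibre_norm (F n) \<omega>) \<le> fibre_norm (F 0) \<omega>" for n
        proof (rule AE_I2)
          fix \<omega>
          have "\<bar>F n (\<omega>, x)\<bar> \<le> fibre_norm (F 0) \<omega>" for x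
            using fibre_norm_upper[OF L1[OF F], of 0 \<omega> x] anti[of n "(\<omega>, x)"] F0[of n "(\<omega>, x)"] by simp
          then have "fibre_norm (F n) \<omega> \<le> fibre_norm (F 0) \<omega>"
            unfolding fibre_norm_def[of "F n"] by (intro cSUP_least) auto
          then show "norm (fibre_norm (F n) \<omega>) \<le> fibre_norm (F 0) \<omega>"
            using fibre_norm_nonneg[OF L1[OF F], of n \<omega>] by simp
        qed
      qed (use fibre_norm_integrable[OF L1[OF F]] in \<open>auto intro: borel_measurable_integrable\<close>)
      moreover have "l (F n) \<le> l (\<lambda>z. 0) + (\<integral>\<omega>. fibre_norm (F n) \<omega> \<partial>P)" for n
      proof (rule mono[OF L1[OF F] L1_zero fibre_norm_integrable[OF L1[OF F]]])
        show "F n z \<le> 0 + fibre_norm (F n) (fst z)" for z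
          using fibre_norm_upper[OF L1[OF F], of n "fst z" "snd z"] by (simp add: abs_le_iff)
      qed
      ultimately show ?thesis
        using nonneg[OF L1[OF F] F0] l_simps(5)[OF L1_zero]
        by (intro tendsto_sandwich[of "\<lambda>_. 0" "\<lambda>n. l (F n)"  _ "\<lambda>n. \<integral>\<omega>. fibre_norm (F n) \<omega> \<partial>P"]) auto
    qed
  qed
qed

text \<open>The Daniell measure is known to represent \<open>l\<close> on bounded potentials only.
  Once its marginal is identified as \<open>P\<close>, \<open>fibre_norm f\<close> becomes
  integrable for it and truncation extends the representation to all of \<open>L1\<close>.\<close>

theorem exists_equilibrium_measure:
  "\<exists>\<mu>\<in>invariant_measures P \<theta> T. \<forall>f\<in>L1. D (\<lambda>z. 0) + ereal (\<integral>z. f z \<partial>\<mu>) \<le> D f"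
proof -
  obtain l where lin: "L1.linear_functional l" and le: "\<And>f. f \<in> L1 \<Longrightarrow> l f \<le> increment f"
    and skew: "\<And>f. f \<in> L1 \<Longrightarrow> l (\<lambda>z. f (skew_product \<theta> T z)) = l f"
    and mono: "\<And>f g H. f \<in> L1 \<Longrightarrow> g \<in> L1 \<Longrightarrow> integrable P H \<Longrightarrow> (\<And>z. f z \<le> g z + H (fst z)) \<Longrightarrow>
      l f \<le> l g + (\<integral>\<omega>. H \<omega> \<partial>P)"
    using exists_invariant_subgradient by blast
  note l_simps = L1.linear_functionalD[OF lin]
  interpret I: daniell_integral bounded_L1 l
    by (rule daniell_integral_bounded_L1[OF lin mono])
  obtain M where space_M: "space M = UNIV"
    and sets_M: "sets M = sets (P \<Otimes>\<^sub>M (borel :: 'x measure))"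
    and fin: "finite_measure M" and rep: "\<And>f. f \<in> bounded_L1 \<Longrightarrow> integrable M f \<and> (\<integral>z. f z \<partial>M) = l f"
    using I.daniell_representation unfolding sets_bounded_L1 by metis
  \<comment> \<open>A function of \<omega> alone can serve as its own error term \<open>H\<close>,
    with sign plus for the upper bound and minus for the lower one.\<close>
  have base: "l (\<lambda>z. h (fst z)) = (\<integral>\<omega>. h \<omega> \<partial>P)" if h: "integrable P h" for h
  proof (rule antisym)
    show "l (\<lambda>z. h (fst z)) \<le> (\<integral>\<omega>. h \<omega> \<partial>P)"
      using mono[OF L1_base[OF h] L1_zero h] l_simps(5)[OF L1_zero] by simp
    have "l (\<lambda>z. 0) \<le> l (\<lambda>z. h (fst z)) + (\<integral>\<omega>. - h \<omega> \<partial>P)"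
      by (rule mono[OF L1_zero L1_base[OF h]]) (use h in auto)
    then show "(\<integral>\<omega>. h \<omega> \<partial>P) \<le> l (\<lambda>z. h (fst z))"
      using l_simps(5)[OF L1_zero] by simp
  qed
  have "measure M UNIV = (\<integral>z. 1 \<partial>M)" by (simp add: space_M)
  also have "\<dots> = l (\<lambda>z. 1)" using rep[OF I.one] by simp
  also have "\<dots> = 1" using base[of "\<lambda>_. 1"] prob_space by simp
  finally have prob: "prob_space M"
    using fin by (intro prob_spaceI) (simp add: finite_measure.emeasure_eq_measure space_M)
  interpret M: prob_space M by (rule prob)
  have fst_meas: "fst \<in> M \<rightarrow>\<^sub>M P" using measurable_cong_sets[OF sets_M refl, of P] by simp
  have marginal: "distr M P fst = P"
  proof (rule measure_eqI)
    fix A assume "A \<in> sets (distr M P fst)"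
    then have A: "A \<in> sets P" by simp
    have "emeasure (distr M P fst) A = ennreal (measure M (fst -` A))"
      using A fst_meas by (simp add: emeasure_distr M.emeasure_eq_measure space_M)
    also have "measure M (fst -` A) = (\<integral>z. indicator A (fst z) * 1 \<partial>M)"
      using measurable_sets[OF fst_meas A] by (simp add: space_M indicator_vimage[symmetric])
    also have "\<dots> = l (\<lambda>z. indicator A (fst z) * 1)"
      using rep[OF bounded_L1_rectangle[OF A continuous_on_const[of _ 1]]] by simp
    also have "\<dots> = measure P A"
      using base[of "indicator A"] A by (simp add: emeasure_eq_measure)
    finally show "emeasure (distr M P fst) A = emeasure P A" by (simp add: emeasure_eq_measure)
  qed simp
  have base_M: "integrable M (\<lambda>z. h (fst z))" "(\<integral>z. h (fst z) \<partial>M) = (\<integral>\<omega>. h \<omega> \<partial>P)"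
    if h: "integrable P h" for h :: "'w \<Rightarrow> real"
  proof -
    have h': "h \<in> borel_measurable P" using h by simp
    show "integrable M (\<lambda>z. h (fst z))"
      using integrable_distr_eq[OF fst_meas h'] h marginal by simp
    show "(\<integral>z. h (fst z) \<partial>M) = (\<integral>\<omega>. h \<omega> \<partial>P)"
      using integral_distr[OF fst_meas h'] marginal by simp
  qed
  have meas_M: "f \<in> borel_measurable M" if "f \<in> L1" for f
    using L1_measurable[OF that] sets_M by (simp cong: measurable_cong_sets)
  have int_M: "integrable M f" if f: "f \<in> L1" for f
  proof (rule Bochner_Integration.integrable_bound[OF base_M(1)[OF fibre_norm_integrable[OF f]] meas_M[OF f]])
    show "AE z in M. norm (f z) \<le> norm (fibre_norm f (fst z))"
    proof (rule AE_I2)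
      fix z show "norm (f z) \<le> norm (fibre_norm f (fst z))"
        using fibre_norm_upper[OF f, of "fst z" "snd z"] by simp
    qed
  qed
  have rep_L1: "(\<integral>z. f z \<partial>M) = l f" if f: "f \<in> L1" for f
  proof -
    \<comment> \<open>The mean excess of the fibre norm over level n. It bounds the truncation error
      both under \<open>l\<close>, by \<open>mono\<close>, and under \<open>M\<close>, by the
      marginal, which explains the factor 2 below.\<close>
    define I where "I = (\<lambda>n. \<integral>\<omega>. max 0 (fibre_norm f \<omega> - real n) \<partial>P)"
    have int: "integrable P (\<lambda>\<omega>. max 0 (fibre_norm f \<omega> - real n))" for n
      using fibre_norm_integrable[OF f] by (intro integrable_max) auto
    have "I \<longlonglongrightarrow> (\<integral>\<omega>. 0 \<partial>P)"
      unfolding I_def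
    proof (rule integral_dominated_convergence[where w = "fibre_norm f"])
      show "AE \<omega> in P. (\<lambda>n. max 0 (fibre_norm f \<omega> - real n)) \<longlonglongrightarrow> 0"
      proof (rule AE_I2)
        fix \<omega>
        obtain m :: nat where "fibre_norm f \<omega> < real m" using reals_Archimedean2 by blast
        then have "\<forall>\<^sub>F n in sequentially. max 0 (fibre_norm f \<omega> - real n) = 0"
          by (auto simp: eventually_sequentially intro!: exI[of _ m])
        then show "(\<lambda>n. max 0 (fibre_norm f \<omega> - real n)) \<longlonglongrightarrow> 0" by (rule tendsto_eventually)
      qed
      show "AE \<omega> in P. norm (max 0 (fibre_norm f \<omega> - real n)) \<le> fibre_norm f \<omega>" for n
        using fibre_norm_nonneg[OF f] by (intro AE_I2) simp
    qed (use fibre_norm_integrable[OF f] int in \<open>auto intro: borel_measurable_integrable\<close>)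
    moreover have "\<bar>(\<integral>z. f z \<partial>M) - l f\<bar> \<le> 2 * I n" for n
    proof -
      \<comment> \<open>The truncation of \<open>f\<close> to the interval from \<open>- n\<close>
        to \<open>n\<close>; the minimum is written through \<open>max\<close> and signs so that
        \<open>L1_max\<close> gives membership.\<close>
      define g where "g = (\<lambda>z. max (- real n) (- max (- real n) (- f z)))"
      have g_L1: "g \<in> L1" unfolding g_def by (intro L1_max L1_const L1.uminus f)
      moreover have "\<bar>g z\<bar> \<le> real n" for z by (auto simp: g_def)
      ultimately have gV: "g \<in> bounded_L1" by (auto simp: bounded_L1_def)
      have fg: "f z \<le> g z + max 0 (fibre_norm f (fst z) - real n)"
        "g z \<le> f z + max 0 (fibre_norm f (fst z) - real n)" for z
        using fibre_norm_upper[OF f, of "fst z" "snd z"] by (auto simp: g_def)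
      have "l f \<le> l g + I n" "l g \<le> l f + I n"
        unfolding I_def by (rule mono[OF f g_L1 int fg(1)], rule mono[OF g_L1 f int fg(2)])
      moreover have "(\<integral>z. f z \<partial>M) \<le> (\<integral>z. g z + max 0 (fibre_norm f (fst z) - real n) \<partial>M)"
        "(\<integral>z. g z \<partial>M) \<le> (\<integral>z. f z + max 0 (fibre_norm f (fst z) - real n) \<partial>M)"
        using int_M[OF f] int_M[OF g_L1] base_M(1)[OF int] fg
        by (intro integral_mono Bochner_Integration.integrable_add; simp)+
      moreover have "(\<integral>z. max 0 (fibre_norm f (fst z) - real n) \<partial>M) = I n"
        using base_M(2)[OF int] by (simp add: I_def)
      ultimately show ?thesis
        using rep[OF gV] int_M[OF f] int_M[OF g_L1] base_M(1)[OF int, of n] by simp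
    qed
    ultimately have "\<bar>(\<integral>z. f z \<partial>M) - l f\<bar> \<le> 2 * 0"
      by (intro LIMSEQ_le_const[OF tendsto_mult_left]) auto
    then show ?thesis by simp
  qed
  have skew_meas: "skew_product \<theta> T \<in> M \<rightarrow>\<^sub>M M"
  proof -
    have "skew_product \<theta> T \<in> P \<Otimes>\<^sub>M borel \<rightarrow>\<^sub>M P \<Otimes>\<^sub>M borel"
      unfolding skew_product_def using base_measurable fibre_measurable by measurable
    then show ?thesis by (simp add: measurable_cong_sets[OF sets_M sets_M])
  qed
  have invariant: "distr M M (skew_product \<theta> T) = M"
  proof (rule measure_eqI_bounded_L1)
    show "prob_space (distr M M (skew_product \<theta> T))" by (rule M.prob_space_distr[OF skew_meas])
    fix f assume "f \<in> bounded_L1"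
    then have f: "f \<in> L1" by (simp add: bounded_L1_def)
    show "(\<integral>z. f z \<partial>distr M M (skew_product \<theta> T)) = (\<integral>z. f z \<partial>M)"
      using integral_distr[OF skew_meas meas_M[OF f]] rep_L1[OF f] rep_L1[OF L1_skew_product[OF f]] skew[OF f]
      by simp
  qed (simp_all add: sets_M prob)
  have "M \<in> invariant_measures P \<theta> T"
    unfolding invariant_measures_def using prob sets_M marginal invariant by simp
  moreover have "D (\<lambda>z. 0) + ereal (\<integral>z. f z \<partial>M) \<le> D f" if "f \<in> L1" for f
    using le[OF that] rep_L1[OF that] by (simp add: D_zero D_eq[OF that])
  ultimately show ?thesis by blast
qed

lemma measure_mdim_attained: "is_max_over (D (\<lambda>z. 0)) (invariant_measures P \<theta> T) (measure_mdim P D)"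
  unfolding is_max_over_def
proof
  have upper: "measure_mdim P D \<mu> \<le> D (\<lambda>z. 0)" for \<mu>
    unfolding measure_mdim_def by (rule INF_lower2[OF L1_zero]) simp
  then show "\<forall>\<mu>\<in>invariant_measures P \<theta> T. measure_mdim P D \<mu> \<le> D (\<lambda>z. 0)" by blast
  obtain \<mu> where \<mu>: "\<mu> \<in> invariant_measures P \<theta> T"
    "\<And>f. f \<in> L1 \<Longrightarrow> D (\<lambda>z. 0) + ereal (\<integral>z. f z \<partial>\<mu>) \<le> D f"
    using exists_equilibrium_measure by blast
  have "D (\<lambda>z. 0) \<le> measure_mdim P D \<mu>"
    unfolding measure_mdim_def
  proof (rule INF_greatest)
    fix f assume "f \<in> L1"
    from \<mu>(2)[OF this] show "D (\<lambda>z. 0) \<le> D f - ereal (\<integral>z. f z \<partial>\<mu>)"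
      by (simp add: ereal_le_minus)
  qed
  then show "\<exists>\<mu>\<in>invariant_measures P \<theta> T. measure_mdim P D \<mu> = D (\<lambda>z. 0)"
    using \<mu>(1) upper[of \<mu>] by (intro bexI[of _ \<mu>]) auto
qed

end

theorem theoremD:
  fixes P :: "'w::metric_space measure"
    and \<theta> :: "'w \<Rightarrow> 'w"
    and T :: "'w \<Rightarrow> 'x::metric_space \<Rightarrow> 'x"
  assumes "locally_compact_space (euclidean :: 'w topology)"
    and "separable_space (euclidean :: 'w topology)"
    and "sets P = sets borel"
    and "compact (UNIV :: 'x set)"
    and "ergodic_system P \<theta>"
    and "random_dynamical_system P \<theta> T"
    and "mdim_pre P \<theta> T (\<lambda>_. 0) < \<infinity>"
  shows "is_max_over (mdim_pre P \<theta> T (\<lambda>_. 0)) (invariant_measures P \<theta> T)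
           (measure_mdim P (mdim_pre P \<theta> T)) \<and>
         is_max_over (mdim_pre_p P \<theta> T (\<lambda>_. 0)) (invariant_measures P \<theta> T)
           (measure_mdim P (mdim_pre_p P \<theta> T)) \<and>
         is_max_over (mdim_pre_m P \<theta> T (\<lambda>_. 0)) (invariant_measures P \<theta> T)
           (measure_mdim P (mdim_pre_m P \<theta> T))"
proof -
  interpret R: random_dynamical_system P \<theta> T by (rule assms(6))
  interpret R: compact_rds P \<theta> T
    by unfold_locales (use assms(4) sets_eq_imp_space_eq[OF assms(3)] in auto)
  define pre m p where "pre = mdim_of (R.pressure {UNIV} atLeast)"
    and "m = mdim_of (R.pressure {UNIV} (\<lambda>n. {n}))"
    and "p = mdim_of (R.pressure (range (\<lambda>x. {x})) (\<lambda>n. {n}))"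
  have eqs: "mdim_pre P \<theta> T = pre" "mdim_pre_m P \<theta> T = m" "mdim_pre_p P \<theta> T = p"
    by (simp_all add: mdim_pre_def mdim_pre_m_def mdim_pre_p_def pre_def m_def p_def
        R.P_pre_eq R.P_pre_m_eq R.P_pre_p_eq)
  have dom: "pre h \<le> ereal (t * \<alpha> + s * \<beta> + c)" if "R.dominated h t f s g c" "pre f < ereal \<alpha>" "pre g < ereal \<beta>"
    for h t f s g c \<alpha> \<beta>
    using that unfolding pre_def by (intro R.mdim_dominated) auto
  have dom_m: "m h \<le> ereal (t * \<alpha> + s * \<beta> + c)" if "R.dominated h t f s g c" "m f < ereal \<alpha>" "m g < ereal \<beta>"
    for h t f s g c \<alpha> \<beta>
    using that unfolding m_def by (intro R.mdim_dominated) auto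
  have dom_p: "p h \<le> ereal (t * \<alpha> + s * \<beta> + c)" if "R.dominated h t f s g c" "p f < ereal \<alpha>" "p g < ereal \<beta>"
    for h t f s g c \<alpha> \<beta>
    using that unfolding p_def by (intro R.mdim_dominated) auto
  \<comment> \<open>Only \<open>pre\<close> is assumed finite; these inequalities carry the upper
    bound to the other two.\<close>
  have p_le_m: "p (\<lambda>_. 0) \<le> m (\<lambda>_. 0)" and m_le_pre: "m (\<lambda>_. 0) \<le> pre (\<lambda>_. 0)"
    unfolding pre_def m_def p_def by (intro mdim_of_mono R.pressure_mono; auto)+
  have nonneg: "0 \<le> pre (\<lambda>_. 0)" "0 \<le> m (\<lambda>_. 0)"
    unfolding pre_def m_def by (intro R.mdim_pressure_UNIV_nonneg; auto)+
  have fin: "pre (\<lambda>_. 0) < \<infinity>" using assms(7) by (simp add: eqs)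
  have attained: "is_max_over (D (\<lambda>_. 0)) (invariant_measures P \<theta> T) (measure_mdim P D)"
    if dom: "\<And>h t f s g c \<alpha> \<beta>. R.dominated h t f s g c \<Longrightarrow> D f < ereal \<alpha> \<Longrightarrow> D g < ereal \<beta> \<Longrightarrow>
      D h \<le> ereal (t * \<alpha> + s * \<beta> + c)"
      and finite: "D (\<lambda>_. 0) \<noteq> \<infinity>" "D (\<lambda>_. 0) \<noteq> -\<infinity>" for D
  proof -
    obtain d where "D (\<lambda>_. 0) = ereal d" using finite by (cases "D (\<lambda>_. 0)") auto
    then interpret mean_dimension P \<theta> T D d by unfold_locales (use dom in auto)
    show ?thesis by (rule measure_mdim_attained)
  qed
  have max_pre: "is_max_over (pre (\<lambda>_. 0)) (invariant_measures P \<theta> T) (measure_mdim P pre)"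
    by (rule attained[OF dom]) (use nonneg fin in auto)
  have max_m: "is_max_over (m (\<lambda>_. 0)) (invariant_measures P \<theta> T) (measure_mdim P m)"
    by (rule attained[OF dom_m]) (use nonneg fin m_le_pre in auto)
  have "is_max_over (p (\<lambda>_. 0)) (invariant_measures P \<theta> T) (measure_mdim P p)"
  proof (cases "p (\<lambda>_. 0) = -\<infinity>")
    case True
    have "measure_mdim P p \<mu> = -\<infinity>" for \<mu>
      using INF_lower[of "\<lambda>_. 0" "L1_fibre_continuous P" "\<lambda>f. p f - ereal (\<integral>z. f z \<partial>\<mu>)"] R.L1_zero True
      by (simp add: measure_mdim_def)
    \<comment> \<open>Attainment of -\<infinity> still needs some invariant measure to exist;
      \<open>max_pre\<close> provides one.\<close>
    then show ?thesis
      using max_pre unfolding is_max_over_def True by auto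
  next
    case False
    then show ?thesis by (intro attained[OF dom_p]) (use p_le_m fin m_le_pre in auto)
  qed
  then show ?thesis using max_pre max_m by (simp add: eqs)
qed

end
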